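(* The algebraic intersection number of any $\gamma\in H_1(\mathbf{P}_1^\circ;\mathbb{R})$ and any $\sigma\in H_1(\mathbf{P}_1,\Sigma;\mathbb{R})$ is given by $$\gamma\cap\sigma=\frac{1}{2\pi}\int_0^\pi\big((\widetilde{\mathrm{hol}}\,\gamma)\wedge(\widetilde{\mathrm{hol}}\,\sigma)\big)(1-\cos t)\,dt,$$ where the wedge product in the integral yields an element of $\mathbb{R}[c]$ interpreted as a function of $t$ by setting $c=\cos t$.
   Context: Surfaces: for $c\ge1$ let $T_c(x,y)=(cx+(c-1)y+1,\ (c+1)x+cy+1)$ and $v_n=T_c^n(0,0)$, $n\in\mathbb{Z}$ (coordinates polynomial in $c$; $v_n=(n,n^2)$ when $c=1$). $Q_c^+$ is the convex hull of $\{v_n:n\in\mathbb{Z}\}$, $Q_c^-$ its image under rotation by $\pi$ about the origin, and $\mathbf{P}_c$ is obtained by gluing each edge $e$ of $Q_c^+$, by translation, to the edge of $Q_c^-$ that is the image of $e$ under this rotation. The vertices of $\mathbf{P}_1$ become two singularities forming $\Sigma$, and $\mathbf{P}_1^\circ=\mathbf{P}_1\smallsetminus\Sigma$ is a translation surface. There are canonical (up to isotopy) homeomorphisms $\mathbf{P}_1\to\mathbf{P}_c$ respecting the decompositions into $Q^\pm$ and sending the $n$-th vertex of $Q_1^+$ to the $n$-th vertex of $Q_c^+$. Homology: $H_1(\mathbf{P}_1^\circ;\mathbb{R})$ is the abelianization of $\pi_1(\mathbf{P}_1^\circ)$ tensored with $\mathbb{R}$. $H_1(\mathbf{P}_1,\Sigma;\mathbb{R})$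 consists of homology classes of finite real-weighted sums of closed curves and curves joining points of $\Sigma$ (generated by the oriented edges of a triangulation of $\mathbf{P}_1$ with vertices in $\Sigma$, modulo: an edge plus its reversal is zero, and the sum of edges oriented as the boundary of a triangle is zero). Algebraic intersection number $\cap:H_1(\mathbf{P}_1^\circ;\mathbb{R})\times H_1(\mathbf{P}_1,\Sigma;\mathbb{R})\to\mathbb{R}$ is bilinear, with $\alpha\cap\beta$ positive if $\alpha$ moves rightward and $\beta$ upward. Deformation holonomy: for a class $\sigma$ and $c\ge1$, $\mathrm{hol}_c(\sigma)\in\mathbb{R}^2$ is the holonomy vector (displacement under developing to the plane, extended linearly) of the image of $\sigma$ in $\mathbf{P}_c$ under the canonical homeomorphism. It is polynomial in $c$, and $\widetilde{\mathrm{hol}}(\sigma)\in\mathbb{R}[c]^2$ denotes the pair of polynomials with $\widetilde{\mathrm{hol}}(\sigma)(c)=\mathrm{hol}_c(\sigma)$ for $c\ge1$. It is defined on $H_1(\mathbf{P}_1^\circ;\mathbb{R})$ via the map to $H_1(\mathbf{P}_1,\Sigma;\mathbb{R})$ induced by inclusion. The wedge product is $(a,b)\wedge(a',b')=ab'-ba'$. *)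

theory Defs
  imports
    "HOL-Analysis.Analysis"
    "HOL-Analysis.Finite_Function_Topology"
    "HOL-Algebra.Generated_Groups"
    "HOL-Computational_Algebra.Polynomial"
begin

section \<open>Generalities\<close>

subsection \<open>Quotient spaces, fundamental groups\<close>

definition quotient_topology :: "'a topology \<Rightarrow> ('a \<times> 'a) set \<Rightarrow> 'a set topology" where
  "quotient_topology X r =
     topology (\<lambda>U. U \<subseteq> topspace X // r \<and> openin X {x \<in> topspace X. r `` {x} \<in> U})"

lemma openin_quotient_topology:
  "openin (quotient_topology X r) U \<longleftrightarrow>
     U \<subseteq> topspace X // r \<and> openin X {x \<in> topspace X. r `` {x} \<in> U}"
proof -
  have 1: "{x \<in> topspace X. r `` {x} \<in> S \<inter> T} =
      {x \<in> topspace X. r `` {x} \<in> S} \<inter> {x \<in> topspace X. r `` {x} \<in> T}" for S T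
    by auto
  have 2: "{x \<in> topspace X. r `` {x} \<in> \<Union>K} = (\<Union>S\<in>K. {x \<in> topspace X. r `` {x} \<in> S})" for K
    by auto
  have "istopology (\<lambda>U. U \<subseteq> topspace X // r \<and> openin X {x \<in> topspace X. r `` {x} \<in> U})"
    unfolding istopology_def 1 2 by blast
  then show ?thesis
    by (simp add: quotient_topology_def)
qed

lemma topspace_quotient_topology [simp]:
  "topspace (quotient_topology X r) = topspace X // r"
proof -
  have "{x \<in> topspace X. r `` {x} \<in> topspace X // r} = topspace X"
    by (auto simp: quotient_def)
  then have "openin (quotient_topology X r) (topspace X // r)"
    by (simp add: openin_quotient_topology)
  moreover have "U \<subseteq> topspace X // r" if "openin (quotient_topology X r) U" for U
    using that by (simp add: openin_quotient_topology)
  ultimately show ?thesis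
    by (metis openin_subset openin_topspace subset_antisym)
qed

definition based_loops :: "'a topology \<Rightarrow> 'a \<Rightarrow> (real \<Rightarrow> 'a) set" where
  "based_loops X b = {g. pathin X g \<and> g 0 = b \<and> g 1 = b}"

definition based_homotopy :: "'a topology \<Rightarrow> 'a \<Rightarrow> ((real \<Rightarrow> 'a) \<times> (real \<Rightarrow> 'a)) set" where
  "based_homotopy X b =
     {(f, g). homotopic_with (\<lambda>r. r 0 = b \<and> r 1 = b) (top_of_set {0..1}) X f g}"

definition freely_homotopic :: "'a topology \<Rightarrow> (real \<Rightarrow> 'a) \<Rightarrow> (real \<Rightarrow> 'a) \<Rightarrow> bool" where
  "freely_homotopic X = homotopic_with (\<lambda>r. r 1 = r 0) (top_of_set {0..1}) X"

definition concat_paths :: "(real \<Rightarrow> 'a) \<Rightarrow> (real \<Rightarrow> 'a) \<Rightarrow> real \<Rightarrow> 'a" where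
  "concat_paths f g = (\<lambda>t. if t \<le> 1/2 then f (2 * t) else g (2 * t - 1))"

definition fundamental_group :: "'a topology \<Rightarrow> 'a \<Rightarrow> (real \<Rightarrow> 'a) set monoid" where
  "fundamental_group X b =
     \<lparr>carrier = based_loops X b // based_homotopy X b,
      mult = (\<lambda>A B. based_homotopy X b `` {concat_paths f g |f g. f \<in> A \<and> g \<in> B}),
      one = based_homotopy X b `` {\<lambda>_. b}\<rparr>"

definition abelianization :: "'a monoid \<Rightarrow> 'a set monoid" where
  "abelianization G = G Mod derived G (carrier G)"


subsection \<open>Real vector spaces given by generators and relations\<close>

text \<open>The elements of a presented vector space are cosets of the span of the relators
  inside the space of finitely supported real combinations of generators.\<close>

definition presented_space :: "'g set \<Rightarrow> ('g \<Rightarrow>\<^sub>0 real) set \<Rightarrow> ('g \<Rightarrow>\<^sub>0 real) set set" where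
  "presented_space gens rels =
     {(\<lambda>y. x + y) ` span rels |x. x \<in> span ((\<lambda>g. Poly_Mapping.single g 1) ` gens)}"

definition lin_ext :: "('g \<Rightarrow> 'v::real_vector) \<Rightarrow> ('g \<Rightarrow>\<^sub>0 real) \<Rightarrow> 'v" where
  "lin_ext f x = (\<Sum>g\<in>Poly_Mapping.keys x. Poly_Mapping.lookup x g *\<^sub>R f g)"

text \<open>The tensor product of an abelian group (written multiplicatively) with the reals,
  the generator \<open>x\<close> standing for \<open>x \<otimes> 1\<close>.\<close>

definition tensor_real :: "'a monoid \<Rightarrow> ('a \<Rightarrow>\<^sub>0 real) set set" where
  "tensor_real A = presented_space (carrier A)
     {Poly_Mapping.single (x \<otimes>\<^bsub>A\<^esub> y) 1 - Poly_Mapping.single x 1 - Poly_Mapping.single y 1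
        |x y. x \<in> carrier A \<and> y \<in> carrier A}"

definition wedge :: "'a::comm_ring \<times> 'a \<Rightarrow> 'a \<times> 'a \<Rightarrow> 'a" where
  "wedge u w = fst u * snd w - snd u * fst w"


section \<open>The surfaces\<close>

definition T_map :: "real \<Rightarrow> real \<times> real \<Rightarrow> real \<times> real" where
  "T_map c = (\<lambda>(x, y). (c * x + (c - 1) * y + 1, (c + 1) * x + c * y + 1))"

definition vtx :: "real \<Rightarrow> int \<Rightarrow> real \<times> real" where
  "vtx c n = (if 0 \<le> n then (T_map c ^^ nat n) (0, 0) else (inv_into UNIV (T_map c) ^^ nat (- n)) (0, 0))"

datatype side = Pos | Neg

fun polygon :: "real \<Rightarrow> side \<Rightarrow> (real \<times> real) set" where
  "polygon c Pos = convex hull (range (vtx c))"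
| "polygon c Neg = uminus ` (convex hull (range (vtx c)))"

fun vertex :: "real \<Rightarrow> side \<Rightarrow> int \<Rightarrow> real \<times> real" where
  "vertex c Pos n = vtx c n"
| "vertex c Neg n = - vtx c n"

definition polygons :: "real \<Rightarrow> (side \<times> (real \<times> real)) topology" where
  "polygons c = sum_topology (\<lambda>s. top_of_set (polygon c s)) UNIV"

text \<open>The translation by \<open>- (vtx c n + vtx c (n + 1))\<close> carries the edge from \<open>vtx c n\<close> to
  \<open>vtx c (n + 1)\<close> onto its image under the rotation by \<open>\<pi>\<close>, swapping the roles of the endpoints.\<close>

definition edge_gluing :: "real \<Rightarrow> ((side \<times> (real \<times> real)) \<times> (side \<times> (real \<times> real))) set" where
  "edge_gluing c = {((Pos, p), (Neg, p - (vtx c n + vtx c (n + 1)))) |n p.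
                      p \<in> closed_segment (vtx c n) (vtx c (n + 1))}"

definition glue :: "real \<Rightarrow> ((side \<times> (real \<times> real)) \<times> (side \<times> (real \<times> real))) set" where
  "glue c = (edge_gluing c \<union> (edge_gluing c)\<inverse>)\<^sup>*"

type_synonym point = "(side \<times> (real \<times> real)) set"

definition surface :: "real \<Rightarrow> point topology" where
  "surface c = quotient_topology (polygons c) (glue c)"

definition proj :: "real \<Rightarrow> side \<times> (real \<times> real) \<Rightarrow> point" where
  "proj c x = glue c `` {x}"

definition singularities :: "real \<Rightarrow> point set" where
  "singularities c = {proj c (s, vertex c s n) |s n. True}"

definition punctured_surface :: "real \<Rightarrow> point topology" where
  "punctured_surface c = subtopology (surface c) (topspace (surface c) - singularities c)"


subsection \<open>Translation structure and holonomy\<close>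

text \<open>The chart with index \<open>n\<close> develops the union of the two open polygons and the \<open>n\<close>-th open
  edge: the positive polygon by the identity, the negative one by the translation that places it
  across the \<open>n\<close>-th edge. These charts cover the punctured surface, and their
  transition maps are translations on each of the two open polygons.\<close>

definition chart_rel :: "real \<Rightarrow> int \<Rightarrow> point \<Rightarrow> real \<times> real \<Rightarrow> bool" where
  "chart_rel c n x p \<longleftrightarrow>
     (p \<in> interior (polygon c Pos) \<union> open_segment (vtx c n) (vtx c (n + 1)) \<and> x = proj c (Pos, p)) \<or>
     (p - (vtx c n + vtx c (n + 1)) \<in> interior (polygon c Neg) \<and>
        x = proj c (Neg, p - (vtx c n + vtx c (n + 1))))"

definition chart_dom :: "real \<Rightarrow> int \<Rightarrow> point set" where
  "chart_dom c n = {x. \<exists>p. chart_rel c n x p}"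

definition chart :: "real \<Rightarrow> int \<Rightarrow> point \<Rightarrow> real \<times> real" where
  "chart c n x = (THE p. chart_rel c n x p)"

text \<open>The endpoints of \<open>g\<close> may be singular; there only continuity of \<open>d\<close> is required.\<close>

definition developing :: "real \<Rightarrow> (real \<Rightarrow> point) \<Rightarrow> (real \<Rightarrow> real \<times> real) \<Rightarrow> bool" where
  "developing c g d \<longleftrightarrow> continuous_on {0..1} d \<and>
     (\<forall>t\<in>{0<..<1}. \<exists>n. g t \<in> chart_dom c n \<and>
        (\<forall>\<^sub>F s in at t. g s \<in> chart_dom c n \<and>
            d s - d t = chart c n (g s) - chart c n (g t)))"

definition holonomy :: "real \<Rightarrow> (real \<Rightarrow> point) \<Rightarrow> real \<times> real" where
  "holonomy c g = (THE w. \<exists>d. developing c g d \<and> w = d 1 - d 0)"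


subsection \<open>Canonical homeomorphisms\<close>

text \<open>Vertices with indices of equal parity coincide in the surface, so the condition on the
  \<open>n\<close>-th vertex is imposed on a lift to the disjoint union of the polygons.\<close>

definition canonical_homeo :: "real \<Rightarrow> (point \<Rightarrow> point) \<Rightarrow> bool" where
  "canonical_homeo c h \<longleftrightarrow> homeomorphic_map (surface 1) (surface c) h \<and>
     (\<exists>H. homeomorphic_map (polygons 1) (polygons c) H \<and>
        (\<forall>x\<in>topspace (polygons 1). fst (H x) = fst x \<and> h (proj 1 x) = proj c (H x)) \<and>
        (\<forall>n. H (Pos, vtx 1 n) = (Pos, vtx c n)))"


section \<open>Homology\<close>

definition H1_punctured :: "point \<Rightarrow> ((real \<Rightarrow> point) set set \<Rightarrow>\<^sub>0 real) set set" where
  "H1_punctured b = tensor_real (abelianization (fundamental_group (punctured_surface 1) b))"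

text \<open>A triangle with vertices of indices \<open>i < j < k\<close> in the polygon \<open>s\<close> is encoded as
  \<open>(s, i, j, k)\<close>; this lists its vertices counterclockwise.\<close>

definition triangle :: "side \<times> int \<times> int \<times> int \<Rightarrow> (real \<times> real) set" where
  "triangle = (\<lambda>(s, i, j, k). convex hull {vertex 1 s i, vertex 1 s j, vertex 1 s k})"

definition polygonal_triangulation :: "(side \<times> int \<times> int \<times> int) set \<Rightarrow> bool" where
  "polygonal_triangulation \<T> \<longleftrightarrow>
     (\<forall>(s, i, j, k)\<in>\<T>. i < j \<and> j < k) \<and>
     (\<forall>\<tau>\<in>\<T>. \<forall>\<tau>'\<in>\<T>. fst \<tau> = fst \<tau>' \<and> \<tau> \<noteq> \<tau>' \<longrightarrow>
        interior (triangle \<tau>) \<inter> interior (triangle \<tau>') = {}) \<and>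
     (\<forall>s. (\<Union>\<tau>\<in>{\<tau>\<in>\<T>. fst \<tau> = s}. triangle \<tau>) = polygon 1 s)"

text \<open>An oriented edge is represented by its affine parametrization in the surface, so that edges of
  the two polygons that are glued together give the same generator.\<close>

definition edge_path :: "side \<Rightarrow> int \<Rightarrow> int \<Rightarrow> real \<Rightarrow> point" where
  "edge_path s i j =
     restrict (\<lambda>t. proj 1 (s, (1 - t) *\<^sub>R vertex 1 s i + t *\<^sub>R vertex 1 s j)) {0..1}"

definition oriented_edges :: "(side \<times> int \<times> int \<times> int) set \<Rightarrow> (real \<Rightarrow> point) set" where
  "oriented_edges \<T> = {edge_path s a b |s a b.
     \<exists>i j k. (s, i, j, k) \<in> \<T> \<and> a \<in> {i, j, k} \<and> b \<in> {i, j, k} \<and> a \<noteq> b}"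

definition edge_chain :: "side \<Rightarrow> int \<Rightarrow> int \<Rightarrow> (real \<Rightarrow> point) \<Rightarrow>\<^sub>0 real" where
  "edge_chain s i j = Poly_Mapping.single (edge_path s i j) 1"

definition edge_relators ::
    "(side \<times> int \<times> int \<times> int) set \<Rightarrow> ((real \<Rightarrow> point) \<Rightarrow>\<^sub>0 real) set" where
  "edge_relators \<T> =
     {edge_chain s a b + edge_chain s b a |s a b.
        \<exists>i j k. (s, i, j, k) \<in> \<T> \<and> a \<in> {i, j, k} \<and> b \<in> {i, j, k} \<and> a \<noteq> b} \<union>
     {edge_chain s i j + edge_chain s j k + edge_chain s k i |s i j k. (s, i, j, k) \<in> \<T>}"

definition H1_relative ::
    "(side \<times> int \<times> int \<times> int) set \<Rightarrow> ((real \<Rightarrow> point) \<Rightarrow>\<^sub>0 real) set set" where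
  "H1_relative \<T> = presented_space (oriented_edges \<T>) (edge_relators \<T>)"


subsection \<open>Algebraic intersection number\<close>

text \<open>The number \<open>crossing_sign w f t\<close> is \<open>1\<close> if at time \<open>t\<close> the curve \<open>f\<close> passes from the left to the
  right of the line with direction \<open>w\<close> through \<open>f t\<close>, and \<open>-1\<close> if it passes from right to left.
  So a rightward curve crosses an upward edge positively.\<close>

definition left_of :: "int \<Rightarrow> real \<times> real \<Rightarrow> point \<Rightarrow> point \<Rightarrow> bool" where
  "left_of n w x y \<longleftrightarrow> 0 < wedge w (chart 1 n y - chart 1 n x)"

definition right_of :: "int \<Rightarrow> real \<times> real \<Rightarrow> point \<Rightarrow> point \<Rightarrow> bool" where
  "right_of n w x y \<longleftrightarrow> wedge w (chart 1 n y - chart 1 n x) < 0"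

definition crossing_sign :: "real \<times> real \<Rightarrow> (real \<Rightarrow> point) \<Rightarrow> real \<Rightarrow> real" where
  "crossing_sign w f t =
     (if \<exists>n. f t \<in> chart_dom 1 n \<and> (\<forall>\<^sub>F s in at_left t. left_of n w (f t) (f s)) \<and>
             (\<forall>\<^sub>F s in at_right t. right_of n w (f t) (f s)) then 1
      else if \<exists>n. f t \<in> chart_dom 1 n \<and> (\<forall>\<^sub>F s in at_left t. right_of n w (f t) (f s)) \<and>
             (\<forall>\<^sub>F s in at_right t. left_of n w (f t) (f s)) then -1
      else 0)"

definition crossings :: "(real \<Rightarrow> point) \<Rightarrow> (real \<Rightarrow> point) \<Rightarrow> real set" where
  "crossings f e = {t \<in> {0..1}. f t \<in> e ` {0..1}}"

definition transverse :: "(real \<Rightarrow> point) \<Rightarrow> (real \<Rightarrow> point) \<Rightarrow> bool" where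
  "transverse f e \<longleftrightarrow> f 0 \<notin> e ` {0..1} \<and> finite (crossings f e) \<and>
     (\<forall>t\<in>crossings f e. crossing_sign (holonomy 1 e) f t \<noteq> 0)"

text \<open>Signed number of crossings of a closed curve \<open>g\<close> in the punctured surface with a straight oriented
  edge \<open>e\<close>, computed from any transverse closed curve freely homotopic to \<open>g\<close>.\<close>

definition loop_edge_intersection :: "(real \<Rightarrow> point) \<Rightarrow> (real \<Rightarrow> point) \<Rightarrow> real" where
  "loop_edge_intersection g e =
     (THE k. \<exists>f. freely_homotopic (punctured_surface 1) g f \<and> transverse f e \<and>
        k = (\<Sum>t\<in>crossings f e. crossing_sign (holonomy 1 e) f t))"

text \<open>A function on loops induces one on the abelianized fundamental group when it is constant on
  \<open>\<Union>A\<close>, the set of loops belonging to some homotopy class in the coset \<open>A\<close>; likewise a linear map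
  on chains descends to homology when it is constant on cosets. In both cases the induced value
  is the unique element of the image.\<close>

definition on_coset :: "((real \<Rightarrow> point) \<Rightarrow> 'v) \<Rightarrow> (real \<Rightarrow> point) set set \<Rightarrow> 'v" where
  "on_coset F A = the_elem (F ` \<Union>A)"

definition intersection_number ::
    "((real \<Rightarrow> point) set set \<Rightarrow>\<^sub>0 real) set \<Rightarrow> ((real \<Rightarrow> point) \<Rightarrow>\<^sub>0 real) set \<Rightarrow> real" where
  "intersection_number \<gamma> \<sigma> = the_elem
     {lin_ext (\<lambda>A. lin_ext (\<lambda>e. on_coset (\<lambda>g. loop_edge_intersection g e) A) y) x |x y.
        x \<in> \<gamma> \<and> y \<in> \<sigma>}"


subsection \<open>Deformation holonomy\<close>

text \<open>Throughout, \<open>h c\<close> is the canonical homeomorphism from the surface at parameter \<open>1\<close> to the one at \<open>c\<close>.\<close>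

definition hol_punctured ::
    "(real \<Rightarrow> point \<Rightarrow> point) \<Rightarrow> ((real \<Rightarrow> point) set set \<Rightarrow>\<^sub>0 real) set \<Rightarrow> real \<Rightarrow> real \<times> real" where
  "hol_punctured h \<gamma> c =
     the_elem (lin_ext (on_coset (\<lambda>g. holonomy c (h c \<circ> g))) ` \<gamma>)"

definition hol_relative ::
    "(real \<Rightarrow> point \<Rightarrow> point) \<Rightarrow> ((real \<Rightarrow> point) \<Rightarrow>\<^sub>0 real) set \<Rightarrow> real \<Rightarrow> real \<times> real" where
  "hol_relative h \<sigma> c = the_elem (lin_ext (\<lambda>e. holonomy c (h c \<circ> e)) ` \<sigma>)"

definition polynomial_form :: "(real \<Rightarrow> real \<times> real) \<Rightarrow> real poly \<times> real poly" where
  "polynomial_form F = (THE pq. \<forall>c\<ge>1. (poly (fst pq) c, poly (snd pq) c) = F c)"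

end

theory Submission
  imports Defs
begin

text \<open>The surface minus its singularities retracts onto a graph with two vertices, one in each
  polygon, joined by one edge for every \<open>n\<close>. Hence a closed curve is described, up to everything that
  matters here, by the numbers \<open>a\<^sub>n\<close> of signed crossings with the \<open>n\<close>-th edge, and these satisfy
  \<open>\<Sum>\<^sub>n a\<^sub>n = 0\<close>. Its holonomy in the surface with parameter \<open>c\<close> is \<open>\<Sum>\<^sub>n a\<^sub>n (v\<^sub>n + v\<^bsub>n+1\<^esub>)\<close>, and its
  intersection number with the straight segment from \<open>v\<^sub>i\<close> to \<open>v\<^sub>j\<close>, which has holonomy
  \<open>\<Sum>\<^bsub>i\<le>n<j\<^esub> (v\<^bsub>n+1\<^esub> - v\<^sub>n)\<close>, is \<open>\<Sum>\<^bsub>i\<le>n<j\<^esub> a\<^sub>n\<close>. For \<open>c = cos t\<close> the map \<open>T\<^sub>c\<close> is conjugate to a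
  rotation by \<open>t\<close>, so that \<open>v\<^sub>n = (sin n t / sin t, (1 - cos n t) / (1 - cos t))\<close> and
  \<open>(v\<^sub>m + v\<^bsub>m+1\<^esub>) \<and> (v\<^bsub>n+1\<^esub> - v\<^sub>n) (1 - cos t) = 2 cos ((m - n) t) + K\<^sub>n(t)\<close>. The term \<open>K\<^sub>n\<close> does not depend on
  \<open>m\<close> and cancels because \<open>\<Sum>\<^sub>m a\<^sub>m = 0\<close>; orthogonality of the cosines on \<open>[0, \<pi>]\<close> yields the formula.\<close>

section \<open>Vertices\<close>

text \<open>The loops are arbitrary continuous curves and may meet an edge infinitely often, so the
  counts cannot be obtained by enumerating crossings, and the retraction is never constructed.
  Inside one chart the net number of crossings is the change of the indicator \<open>chi\<close>,
  and \<open>lifts\<close> continues these local increments along the curve. The intersection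
  number, on the other hand, is defined through transverse curves only. Two independent facts
  connect it with the counts: \<open>turns\<close> is invariant under free homotopy, and every free
  homotopy class contains a transverse curve.

  A canonical homeomorphism is prescribed only at the vertices. That it sends each edge to the edge
  with the same index follows from the sizes of the gluing classes together with continuity.

  The parameter lives in two ranges. The convex geometry takes place at \<open>c >= 1\<close>; the
  integral runs over \<open>c = cos t\<close>, where the points \<open>vtx c n\<close> lie on an
  ellipse. Only the polynomials in \<open>c\<close> connect the two.\<close>

primrec vpoly :: "nat \<Rightarrow> real poly \<times> real poly" where
  "vpoly 0 = (0, 0)"
| "vpoly (Suc k) =
     ([:0, 1:] * fst (vpoly k) + [:-1, 1:] * snd (vpoly k) + 1,
      [:1, 1:] * fst (vpoly k) + [:0, 1:] * snd (vpoly k) + 1)"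

text \<open>The reflection \<open>(x, y) \<mapsto> (- x, y)\<close> conjugates \<open>T_map c\<close> to its inverse; this gives the vertices of negative index.\<close>

definition vtx_poly :: "int \<Rightarrow> real poly \<times> real poly" where
  "vtx_poly n = (if 0 \<le> n then vpoly (nat n) else (- fst (vpoly (nat (- n))), snd (vpoly (nat (- n)))))"

lemma inj_T_map: "inj (T_map c)"
proof (rule injI)
  fix p q assume "T_map c p = T_map c q"
  then have 1: "c * fst p + (c - 1) * snd p = c * fst q + (c - 1) * snd q"
    and 2: "(c + 1) * fst p + c * snd p = (c + 1) * fst q + c * snd q"
    by (auto simp: T_map_def split: prod.splits)
  have "fst p = c * (c * fst p + (c - 1) * snd p) - (c - 1) * ((c + 1) * fst p + c * snd p)"
    by (simp add: algebra_simps)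
  also have "\<dots> = fst q"
    unfolding 1 2 by (simp add: algebra_simps)
  finally have "fst p = fst q" .
  moreover have "snd p = c * ((c + 1) * fst p + c * snd p) - (c + 1) * (c * fst p + (c - 1) * snd p)"
    by (simp add: algebra_simps)
  then have "snd p = snd q"
    unfolding 1 2 by (simp add: algebra_simps)
  ultimately show "p = q"
    by (simp add: prod_eq_iff)
qed

lemma vtx_nonneg: "vtx c (int k) = (poly (fst (vpoly k)) c, poly (snd (vpoly k)) c)"
proof (induction k)
  case 0
  then show ?case by (simp add: vtx_def)
next
  case (Suc k)
  have "vtx c (int (Suc k)) = T_map c (vtx c (int k))"
    by (simp add: vtx_def nat_add_distrib)
  then show ?case
    unfolding Suc.IH by (simp add: T_map_def algebra_simps)
qed

lemma vtx_nonpos: "vtx c (- int k) = (- poly (fst (vpoly k)) c, poly (snd (vpoly k)) c)"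
proof (induction k)
  case 0
  then show ?case by (simp add: vtx_def)
next
  case (Suc k)
  have T: "T_map c (- poly (fst (vpoly (Suc k))) c, poly (snd (vpoly (Suc k))) c) =
      (- poly (fst (vpoly k)) c, poly (snd (vpoly k)) c)"
    by (simp add: T_map_def algebra_simps)
  have "vtx c (- int (Suc k)) = inv_into UNIV (T_map c) (vtx c (- int k))"
    by (cases "k = 0") (simp_all add: vtx_def nat_add_distrib)
  then show ?case
    unfolding Suc.IH by (metis T inj_T_map inv_f_f)
qed

lemma vtx_poly: "vtx c n = (poly (fst (vtx_poly n)) c, poly (snd (vtx_poly n)) c)"
proof (cases "0 \<le> n")
  case True
  then show ?thesis using vtx_nonneg[of c "nat n"] by (simp add: vtx_poly_def)
next
  case False
  then show ?thesis using vtx_nonpos[of c "nat (-n)"] by (simp add: vtx_poly_def)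
qed

lemma vtx_reflect: "vtx c (- n) = (- fst (vtx c n), snd (vtx c n))"
  by (cases "n = 0") (auto simp: vtx_poly vtx_poly_def)

lemma vtx_step: "vtx c (n + 1) = T_map c (vtx c n)"
proof (cases "0 \<le> n")
  case True
  then have "nat (n + 1) = Suc (nat n)" by simp
  with True show ?thesis by (simp add: vtx_def)
next
  case False
  then obtain k where k: "n = - int (Suc k)"
    by (metis int_cases not_le add.commute of_nat_0_le_iff)
  have n: "n + 1 = - int k" by (simp add: k)
  show ?thesis
    unfolding n vtx_nonpos unfolding k vtx_nonpos by (simp add: T_map_def algebra_simps)
qed

lemma vtx_0 [simp]: "vtx c 0 = (0, 0)"
  by (simp add: vtx_def)

lemma vtx_1: "vtx 1 n = (real_of_int n, (real_of_int n)\<^sup>2)"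
proof -
  have *: "vtx 1 (int k) = (real k, (real k)\<^sup>2)" for k
  proof (induction k)
    case (Suc k)
    have "vtx 1 (int (Suc k)) = T_map 1 (vtx 1 (int k))"
      using vtx_step[of 1 "int k"] by (simp add: add.commute)
    then show ?case unfolding Suc by (simp add: T_map_def power2_eq_square algebra_simps)
  qed simp
  show ?thesis
  proof (cases "0 \<le> n")
    case True
    then show ?thesis using *[of "nat n"] by simp
  next
    case False
    then show ?thesis using *[of "nat (- n)"] vtx_reflect[of 1 "- n"] by simp
  qed
qed

text \<open>In the coordinates \<open>X = x * sin t\<close> and
  \<open>Y = 1 - y * (1 - cos t)\<close> one step of \<open>T_map\<close> reads
  \<open>X' = cos t * X + sin t * Y\<close>, \<open>Y' = cos t * Y - sin t * X\<close>, and the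
  origin becomes \<open>(0, 1)\<close>. The induction is therefore the addition theorem, with the
  denominators multiplied out.\<close>

lemma vtx_cos:
  assumes "sin t \<noteq> 0"
  shows "fst (vtx (cos t) n) = sin (of_int n * t) / sin t"
    and "snd (vtx (cos t) n) = (1 - cos (of_int n * t)) / (1 - cos t)"
proof -
  have c: "1 - cos t \<noteq> 0" using assms
    by (metis cos_one_sin_zero eq_iff_diff_eq_0)
  have sc: "(sin t)\<^sup>2 = (1 - cos t) * (1 + cos t)"
    by (simp add: sin_squared_eq power2_eq_square algebra_simps)
  have *: "fst (vtx (cos t) (int k)) * sin t = sin (real k * t) \<and>
    snd (vtx (cos t) (int k)) * (1 - cos t) = 1 - cos (real k * t)" for k
  proof (induction k)
    case (Suc k)
    define u w where "u = fst (vtx (cos t) (int k))" and "w = snd (vtx (cos t) (int k))"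
    have u: "u * sin t = sin (real k * t)" and w: "w * (1 - cos t) = 1 - cos (real k * t)"
      using Suc by (auto simp: u_def w_def)
    have v: "vtx (cos t) (int (Suc k)) = T_map (cos t) (u, w)"
      using vtx_step[of "cos t" "int k"] by (simp add: u_def w_def add.commute)
    note [simp del] = of_nat_Suc
    have "fst (vtx (cos t) (int (Suc k))) * sin t = cos t * (u * sin t) - sin t * (w * (1 - cos t)) + sin t"
      by (simp add: v T_map_def algebra_simps)
    also have "\<dots> = sin (real (Suc k) * t)"
      unfolding u w by (simp add: algebra_simps sin_add of_nat_Suc)
    finally have 1: "fst (vtx (cos t) (int (Suc k))) * sin t = sin (real (Suc k) * t)" .
    have "snd (vtx (cos t) (int (Suc k))) * (1 - cos t) =
        u * ((1 - cos t) * (1 + cos t)) + cos t * (w * (1 - cos t)) + (1 - cos t)"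
      by (simp add: v T_map_def algebra_simps)
    also have "u * ((1 - cos t) * (1 + cos t)) = sin (real k * t) * sin t"
      unfolding sc[symmetric] u[symmetric] by (simp add: power2_eq_square)
    also have "sin (real k * t) * sin t + cos t * (w * (1 - cos t)) + (1 - cos t) = 1 - cos (real (Suc k) * t)"
      unfolding w by (simp add: algebra_simps cos_add of_nat_Suc)
    finally show ?case using 1 by simp
  qed simp
  have **: "fst (vtx (cos t) n) * sin t = sin (of_int n * t) \<and>
    snd (vtx (cos t) n) * (1 - cos t) = 1 - cos (of_int n * t)"
  proof (cases "0 \<le> n")
    case True
    then show ?thesis using *[of "nat n"] by simp
  next
    case False
    then show ?thesis using *[of "nat (- n)"] vtx_reflect[of "cos t" "- n"] by simp
  qed
  then show "fst (vtx (cos t) n) = sin (of_int n * t) / sin t"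
    "snd (vtx (cos t) n) = (1 - cos (of_int n * t)) / (1 - cos t)"
    using assms c by (simp_all add: field_simps)
qed

section \<open>Edge vectors and the convexity of the chain of vertices\<close>

definition edge_vec :: "real \<Rightarrow> int \<Rightarrow> real \<times> real" where
  "edge_vec c n = vtx c (n + 1) - vtx c n"

definition edge_sum :: "real \<Rightarrow> int \<Rightarrow> real \<times> real" where
  "edge_sum c n = vtx c n + vtx c (n + 1)"

text \<open>For \<open>c >= 1\<close> the map \<open>T_map c\<close> preserves the first quadrant
  and there increases the first coordinate by \<open>(c - 1) * (x + y) + 1\<close>. Negative indices
  follow by reflection.\<close>

lemma fst_vtx_less_Suc:
  assumes "1 \<le> c"
  shows "fst (vtx c n) < fst (vtx c (n + 1))"
proof -
  have nn: "0 \<le> fst (vtx c (int k)) \<and> 0 \<le> snd (vtx c (int k))" for k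
  proof (induction k)
    case (Suc k)
    have "vtx c (int (Suc k)) = T_map c (vtx c (int k))"
      using vtx_step[of c "int k"] by (simp add: add.commute)
    with Suc assms show ?case
      by (cases "vtx c (int k)") (simp add: T_map_def)
  qed simp
  have *: "fst (vtx c (int k)) < fst (vtx c (int k + 1))" for k
  proof -
    have "0 \<le> (c - 1) * fst (vtx c (int k)) + (c - 1) * snd (vtx c (int k))"
      using nn[of k] assms by (intro add_nonneg_nonneg mult_nonneg_nonneg) auto
    then show ?thesis
      unfolding vtx_step by (cases "vtx c (int k)") (simp add: T_map_def algebra_simps)
  qed
  show ?thesis
  proof (cases "0 \<le> n")
    case True
    then show ?thesis using *[of "nat n"] by simp
  next
    case False
    then show ?thesis
      using *[of "nat (- n - 1)"] vtx_reflect[of c "- n"] vtx_reflect[of c "- n - 1"]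
      by (simp add: add.commute)
  qed
qed

lemma strict_mono_int_SucI:
  fixes f :: "int \<Rightarrow> 'a::linorder"
  assumes "\<And>n. f n < f (n + 1)"
  shows "strict_mono f"
proof (rule strict_monoI)
  fix x y :: int assume "x < y"
  then show "f x < f y"
  proof (induction rule: int_gr_induct)
    case base
    then show ?case by (rule assms)
  next
    case (step i)
    then show ?case using assms[of i] by (meson less_trans)
  qed
qed

lemma strict_mono_fst_vtx: "1 \<le> c \<Longrightarrow> strict_mono (\<lambda>n. fst (vtx c n))"
  using fst_vtx_less_Suc by (rule strict_mono_int_SucI)

lemma fst_vtx_less_iff [simp]: "1 \<le> c \<Longrightarrow> fst (vtx c i) < fst (vtx c j) \<longleftrightarrow> i < j"
  using strict_mono_less[OF strict_mono_fst_vtx] .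

lemma fst_vtx_le_iff [simp]: "1 \<le> c \<Longrightarrow> fst (vtx c i) \<le> fst (vtx c j) \<longleftrightarrow> i \<le> j"
  using strict_mono_less_eq[OF strict_mono_fst_vtx] .

lemma vtx_eq_iff [simp]: "1 \<le> c \<Longrightarrow> vtx c i = vtx c j \<longleftrightarrow> i = j"
  using strict_mono_eq[OF strict_mono_fst_vtx, of c i j] by (metis)

lemma edge_vec_step:
  "edge_vec c (n + 1) = (c * fst (edge_vec c n) + (c - 1) * snd (edge_vec c n),
                         (c + 1) * fst (edge_vec c n) + c * snd (edge_vec c n))"
proof -
  have "edge_vec c (n + 1) = T_map c (vtx c (n + 1)) - T_map c (vtx c n)"
    unfolding edge_vec_def vtx_step[of c "n + 1"] vtx_step[of c n, symmetric] by simp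
  then show ?thesis
    unfolding edge_vec_def
    by (cases "vtx c (n + 1)"; cases "vtx c n") (simp add: T_map_def algebra_simps)
qed

text \<open>The linear part of \<open>T_map c\<close> has determinant
  \<open>c * c - (c - 1) * (c + 1) = 1\<close>, so the value does not depend on \<open>n\<close>.
  The constant 2 comes from the edge vectors \<open>(1, 1)\<close> and
  \<open>(2 * c - 1, 2 * c + 1)\<close>.\<close>

lemma wedge_edge_vec_step: "wedge (edge_vec c n) (edge_vec c (n + 1)) = 2"
proof -
  have inv: "wedge (edge_vec c (n + 1)) (edge_vec c (n + 1 + 1)) = wedge (edge_vec c n) (edge_vec c (n + 1))" for n
    unfolding edge_vec_step[of c "n + 1"] edge_vec_step[of c n]
    by (simp add: wedge_def algebra_simps)
  have "vtx c 1 = T_map c (0,0)" using vtx_step[of c 0] by simp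
  then have "edge_vec c 0 = (1, 1)" by (simp add: edge_vec_def T_map_def)
  then have base: "wedge (edge_vec c 0) (edge_vec c (0 + 1)) = 2"
    unfolding edge_vec_step[of c 0] by (simp add: wedge_def)
  have "wedge (edge_vec c n) (edge_vec c (n + 1)) = wedge (edge_vec c 0) (edge_vec c (0 + 1))"
  proof (induction n rule: int_induct[where k = 0])
    case base
    then show ?case by simp
  next
    case (step1 i)
    then show ?case using inv[of i] by simp
  next
    case (step2 i)
    then show ?case using inv[of "i - 1"] by simp
  qed
  with base show ?thesis by simp
qed

lemma fst_edge_vec_pos: "1 \<le> c \<Longrightarrow> 0 < fst (edge_vec c n)"
  by (simp add: edge_vec_def)

text \<open>Consecutive wedges are positive and all edges run to the right, so the slopes increase
  with the index.\<close>

lemma wedge_edge_vec_pos: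
  assumes c: "1 \<le> c" and "i < j"
  shows "0 < wedge (edge_vec c i) (edge_vec c j)"
proof -
  have "strict_mono (\<lambda>n. snd (edge_vec c n) / fst (edge_vec c n))"
  proof (rule strict_mono_int_SucI)
    fix n
    show "snd (edge_vec c n) / fst (edge_vec c n) < snd (edge_vec c (n + 1)) / fst (edge_vec c (n + 1))"
      using wedge_edge_vec_step[of c n] fst_edge_vec_pos[OF c, of n] fst_edge_vec_pos[OF c, of "n + 1"]
      by (simp add: wedge_def field_simps)
  qed
  then have "snd (edge_vec c i) / fst (edge_vec c i) < snd (edge_vec c j) / fst (edge_vec c j)"
    using \<open>i < j\<close> by (auto dest: strict_monoD)
  then show ?thesis
    using fst_edge_vec_pos[OF c, of i] fst_edge_vec_pos[OF c, of j]
    by (simp add: wedge_def field_simps)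
qed

section \<open>The polygons\<close>

abbreviation edge_seg :: "real \<Rightarrow> int \<Rightarrow> (real \<times> real) set" where
  "edge_seg c n \<equiv> closed_segment (vtx c n) (vtx c (n + 1))"

abbreviation open_edge :: "real \<Rightarrow> int \<Rightarrow> (real \<times> real) set" where
  "open_edge c n \<equiv> open_segment (vtx c n) (vtx c (n + 1))"

text \<open>Twice the signed area of the triangle \<open>vtx c i\<close>, \<open>vtx c j\<close>,
  \<open>p\<close>. For \<open>i < j\<close> and \<open>c >= 1\<close> it is positive above the line
  through the two vertices.\<close>

definition height :: "real \<Rightarrow> int \<Rightarrow> int \<Rightarrow> real \<times> real \<Rightarrow> real" where
  "height c i j p = wedge (vtx c j - vtx c i) (p - vtx c i)"

lemma height_inner:
  "height c i j p = (- snd (vtx c j - vtx c i), fst (vtx c j - vtx c i)) \<bullet> p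
     - (- snd (vtx c j - vtx c i), fst (vtx c j - vtx c i)) \<bullet> vtx c i"
  by (cases p; cases "vtx c i"; cases "vtx c j") (simp add: height_def wedge_def algebra_simps)

lemma height_convex_comb:
  "height c i j ((1 - u) *\<^sub>R p + u *\<^sub>R q) = (1 - u) * height c i j p + u * height c i j q"
  by (simp add: height_def wedge_def algebra_simps)

lemma continuous_on_height [continuous_intros]:
  "continuous_on S f \<Longrightarrow> continuous_on S (\<lambda>x. height c i j (f x))"
  unfolding height_inner by (intro continuous_intros)

text \<open>From vertex \<open>k\<close> to vertex \<open>k + 1\<close> the height over edge
  \<open>n\<close> changes by \<open>wedge (edge_vec c n) (edge_vec c k)\<close>, which is positive
  for \<open>k > n\<close> and negative for \<open>k < n\<close>. The height therefore grows away
  from the edge in both directions.\<close>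

lemma height_vtx_edge:
  assumes c: "1 \<le> c"
  shows "k < n \<or> n + 1 < k \<Longrightarrow> 0 < height c n (n + 1) (vtx c k)"
    and "height c n (n + 1) (vtx c n) = 0"
    and "height c n (n + 1) (vtx c (n + 1)) = 0"
proof -
  show 0: "height c n (n + 1) (vtx c n) = 0" and 1: "height c n (n + 1) (vtx c (n + 1)) = 0"
    by (simp_all add: height_def wedge_def)
  have st: "height c n (n + 1) (vtx c (k + 1)) =
      height c n (n + 1) (vtx c k) + wedge (edge_vec c n) (edge_vec c k)" for k
    by (simp add: height_def edge_vec_def wedge_def algebra_simps)
  have anti: "wedge x y = - wedge y x" for x y :: "real \<times> real"
    by (simp add: wedge_def)
  have up: "0 < height c n (n + 1) (vtx c k)" if "n + 1 < k" for k
    using that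
  proof (induction rule: int_gr_induct)
    case base
    then show ?case using st[of "n + 1"] 1 wedge_edge_vec_pos[OF c, of n "n + 1"] by simp
  next
    case (step i)
    then show ?case
      using wedge_edge_vec_pos[OF c, of n i] st[of i] by simp
  qed
  have down: "0 < height c n (n + 1) (vtx c k)" if "k < n" for k
    using that
  proof (induction rule: int_less_induct)
    case base
    then show ?case using st[of "n - 1"] 0 wedge_edge_vec_pos[OF c, of "n - 1" n]
      by (simp add: anti[of "edge_vec c n"])
  next
    case (step i)
    then show ?case
      using wedge_edge_vec_pos[OF c, of "i - 1" n] st[of "i - 1"]
      by (simp add: anti[of "edge_vec c n"])
  qed
  show "k < n \<or> n + 1 < k \<Longrightarrow> 0 < height c n (n + 1) (vtx c k)"
    using up down by blast
qed

text \<open>For three points of the parabola the signed area is a Vandermonde determinant.\<close>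

lemma height_vtx_1: "height 1 i j (vtx 1 k) = of_int ((j - i) * (k - i) * (k - j))"
  by (simp add: height_def wedge_def vtx_1 power2_eq_square algebra_simps)

text \<open>The open half-plane together with the edge on its boundary line is convex: a proper
  convex combination can lie on the line only if both points do. This set contains all vertices,
  hence their hull. The argument is indifferent to the infinite number of vertices.\<close>

lemma polygon_supporting_line:
  assumes ge: "\<And>k. b \<le> a \<bullet> vtx c k" and eq: "\<And>k. a \<bullet> vtx c k = b \<Longrightarrow> k = n \<or> k = n + 1"
    and p: "p \<in> polygon c Pos"
  shows "b \<le> a \<bullet> p" and "a \<bullet> p = b \<Longrightarrow> p \<in> edge_seg c n"
proof -
  define C where "C = {x. b < a \<bullet> x} \<union> ({x. a \<bullet> x = b} \<inter> edge_seg c n)"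
  have "convex C"
  proof (rule convexI)
    fix x y and u v :: real
    assume x: "x \<in> C" and y: "y \<in> C" and uv: "0 \<le> u" "0 \<le> v" "u + v = 1"
    have seg: "u *\<^sub>R x + v *\<^sub>R y \<in> edge_seg c n" if "x \<in> edge_seg c n" "y \<in> edge_seg c n"
      using that uv by (meson convexD convex_closed_segment)
    have ax: "b \<le> a \<bullet> x" "b \<le> a \<bullet> y" using x y by (auto simp: C_def)
    have sum: "a \<bullet> (u *\<^sub>R x + v *\<^sub>R y) - b = u * (a \<bullet> x - b) + v * (a \<bullet> y - b)"
      using uv by (simp add: inner_add_right algebra_simps flip: distrib_left)
    consider "u = 0" | "v = 0" | "0 < u" "0 < v" using uv by linarith
    then show "u *\<^sub>R x + v *\<^sub>R y \<in> C"
    proof cases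
      case 3
      show ?thesis
      proof (cases "a \<bullet> x = b \<and> a \<bullet> y = b")
        case True
        then show ?thesis using x y seg sum by (auto simp: C_def)
      next
        case False
        then have "0 < u * (a \<bullet> x - b) + v * (a \<bullet> y - b)"
        proof -
          have nn: "0 \<le> u * (a \<bullet> x - b)" "0 \<le> v * (a \<bullet> y - b)"
            using ax uv by simp_all
          have "0 < u * (a \<bullet> x - b) \<or> 0 < v * (a \<bullet> y - b)"
            using ax 3 False by (simp add: less_le)
          with nn show ?thesis by linarith
        qed
        then show ?thesis using sum by (simp add: C_def)
      qed
    qed (use x y uv in auto)
  qed
  moreover have "range (vtx c) \<subseteq> C"
  proof
    fix x assume "x \<in> range (vtx c)"
    then obtain k where x: "x = vtx c k" by blast
    show "x \<in> C"
    proof (cases "a \<bullet> vtx c k = b")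
      case True
      then show ?thesis using eq[OF True] x by (auto simp: C_def)
    next
      case False
      then show ?thesis using ge[of k] x by (simp add: C_def)
    qed
  qed
  ultimately have "polygon c Pos \<subseteq> C"
    by (simp add: hull_minimal)
  with p have "p \<in> C" by blast
  then show "b \<le> a \<bullet> p" "a \<bullet> p = b \<Longrightarrow> p \<in> edge_seg c n"
    by (auto simp: C_def)
qed

lemma vtx_in_polygon: "vtx c n \<in> polygon c Pos"
  by (simp add: hull_inc)

lemma convex_polygon: "convex (polygon c s)"
proof (cases s)
  case Neg
  have "convex (uminus ` (convex hull range (vtx c)))"
    by (intro convex_linear_image convex_convex_hull linear_uminus)
  then show ?thesis by (simp add: Neg)
qed (simp add: convex_convex_hull)

lemma edge_seg_subset_polygon: "edge_seg c n \<subseteq> polygon c Pos"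
  using convex_polygon[of c Pos] vtx_in_polygon closed_segment_subset by blast

lemma height_edge:
  assumes c: "1 \<le> c" and p: "p \<in> polygon c Pos"
  shows "0 \<le> height c n (n + 1) p" and "height c n (n + 1) p = 0 \<Longrightarrow> p \<in> edge_seg c n"
proof -
  define a b where "a = (- snd (vtx c (n + 1) - vtx c n), fst (vtx c (n + 1) - vtx c n))" and "b = a \<bullet> vtx c n"
  have h: "height c n (n + 1) q = a \<bullet> q - b" for q
    by (simp only: a_def b_def height_inner)
  have ge: "b \<le> a \<bullet> vtx c k" for k

  proof (cases "k < n \<or> n + 1 < k")
    case False
    then have "k = n \<or> k = n + 1" by linarith
    then have "height c n (n + 1) (vtx c k) = 0"
      using height_vtx_edge(2,3)[OF c, where n = n] by blast
    then show ?thesis using h[of "vtx c k"] by simp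
  qed (use height_vtx_edge(1)[OF c, where n = n] h[of "vtx c k"] in force)
  have eq: "k = n \<or> k = n + 1" if "a \<bullet> vtx c k = b" for k
    using height_vtx_edge(1)[OF c, where n = n and k = k] h[of "vtx c k"] that by force
  show "0 \<le> height c n (n + 1) p" "height c n (n + 1) p = 0 \<Longrightarrow> p \<in> edge_seg c n"
    using polygon_supporting_line[OF ge eq p] h[of p] by auto
qed

lemma height_edge_seg: "p \<in> edge_seg c n \<Longrightarrow> height c n (n + 1) p = 0"
  unfolding in_segment by (auto simp: height_convex_comb) (simp_all add: height_def wedge_def)

lemma edge_seg_not_interior:
  assumes c: "1 \<le> c" and p: "p \<in> edge_seg c n"
  shows "p \<notin> interior (polygon c Pos)"
proof
  assume "p \<in> interior (polygon c Pos)"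
  then obtain e where e: "0 < e" "ball p e \<subseteq> polygon c Pos"
    by (auto simp: mem_interior)
  \<comment> \<open>Moving straight down from an edge leaves the polygon, because every edge runs to
    the right.\<close>
  define q where "q = p + (0, - (e / 2))"
  have "dist p q < e"
    using e by (simp add: q_def dist_norm norm_Pair)
  then have "q \<in> polygon c Pos" using e by auto
  moreover have "height c n (n + 1) q = height c n (n + 1) p - e / 2 * (fst (vtx c (n + 1)) - fst (vtx c n))"
    by (simp add: q_def height_def wedge_def algebra_simps)
  then have "height c n (n + 1) q < 0"
    using height_edge_seg[OF p] e c by simp
  ultimately show False
    using height_edge(1)[OF c, of q n] by simp
qed

text \<open>A point that is not interior minimizes some nonzero linear functional \<open>a\<close>
  over the polygon. The vertices where the minimum is attained are at most two and neighbours, so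
  the point lies on the edge between them by \<open>polygon_supporting_line\<close>.\<close>

lemma not_edge_interior:
  assumes c: "1 \<le> c" and p: "p \<in> polygon c Pos" and no: "\<And>n. p \<notin> edge_seg c n"
  shows "p \<in> interior (polygon c Pos)"
proof (rule ccontr)
  assume pn: "p \<notin> interior (polygon c Pos)"
  have e_diff: "a \<bullet> edge_vec c k = a \<bullet> vtx c (k + 1) - a \<bullet> vtx c k" for a k
    by (simp add: edge_vec_def inner_diff_right)
  \<comment> \<open>Two independent edge vectors prevent the polygon from lying on a line; hence the
    relative interior, for which the supporting hyperplane exists, is the interior.\<close>
  have "interior (polygon c Pos) \<noteq> {}"
  proof
    assume "interior (polygon c Pos) = {}"
    then obtain a b where a: "a \<noteq> 0" "polygon c Pos \<subseteq> {x. a \<bullet> x = b}"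
      using empty_interior_subset_hyperplane[OF convex_polygon] by metis
    then have "a \<bullet> vtx c k = b" for k
      using vtx_in_polygon by blast
    then have "a \<bullet> edge_vec c 0 = 0" "a \<bullet> edge_vec c 1 = 0"
      by (simp_all add: e_diff del: vtx_0)
    then have "fst a * fst (edge_vec c 0) + snd a * snd (edge_vec c 0) = 0"
      "fst a * fst (edge_vec c 1) + snd a * snd (edge_vec c 1) = 0"
      by (simp_all add: inner_prod_def)
    moreover have "fst (edge_vec c 0) * snd (edge_vec c 1) - snd (edge_vec c 0) * fst (edge_vec c 1) = 2"
      using wedge_edge_vec_step[of c 0] by (simp add: wedge_def)
    ultimately have "2 * fst a = 0" "2 * snd a = 0" by algebra+
    with a show False by (simp add: prod_eq_iff)
  qed
  then have "p \<notin> rel_interior (polygon c Pos)"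
    using pn by (simp add: rel_interior_nonempty_interior)
  then obtain a where a: "a \<noteq> 0" and supp: "\<And>y. y \<in> polygon c Pos \<Longrightarrow> a \<bullet> p \<le> a \<bullet> y"
    using supporting_hyperplane_rel_boundary[OF convex_polygon p] by metis
  define b where "b = a \<bullet> p"
  have ge: "b \<le> a \<bullet> vtx c k" for k
    using supp vtx_in_polygon by (simp add: b_def)
  define B where "B k = a \<bullet> edge_vec c k" for k
  have B: "B k = fst a * fst (edge_vec c k) + snd a * snd (edge_vec c k)" for k
    by (simp add: B_def inner_prod_def)
  note pos = fst_edge_vec_pos[OF c]
  have BB: "fst (edge_vec c i) * B j - fst (edge_vec c j) * B i = snd a * wedge (edge_vec c i) (edge_vec c j)" for i j
    by (simp add: B wedge_def algebra_simps)
  \<comment> \<open>\<open>B\<close> gives the increments of the functional along the chain. At a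
    minimum \<open>B (k - 1) <= 0 <= B k\<close>, and then \<open>BB\<close> forces
    \<open>snd a > 0\<close>. By \<open>BB\<close> again \<open>B m > 0\<close> for all
    \<open>m > k\<close>, so the functional exceeds \<open>b\<close> beyond vertex
    \<open>k + 1\<close>.\<close>
  have close: "l = k + 1" if k: "a \<bullet> vtx c k = b" and l: "a \<bullet> vtx c l = b" and "k < l" for k l
  proof (rule ccontr)
    assume "l \<noteq> k + 1"
    with \<open>k < l\<close> have kl: "k + 1 < l" by simp
    have Bk: "0 \<le> B k" "B (k - 1) \<le> 0"
      using ge[of "k + 1"] ge[of "k - 1"] k by (simp_all add: B_def e_diff)
    have "0 \<le> fst (edge_vec c (k - 1)) * B k - fst (edge_vec c k) * B (k - 1)"
      using Bk pos[of k] pos[of "k - 1"]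
      by (simp add: mult_nonneg_nonpos order_trans[of _ 0])
    then have "0 \<le> snd a"
      using wedge_edge_vec_step[of c "k - 1"] by (simp add: BB)
    moreover have "snd a \<noteq> 0"
    proof
      assume 0: "snd a = 0"
      then have "fst a = 0"
        using Bk pos[of k] pos[of "k - 1"]
        by (simp add: B zero_le_mult_iff mult_le_0_iff)
      with 0 a show False by (simp add: prod_eq_iff)
    qed
    ultimately have "0 < snd a" by simp
    have Bm: "0 < B m" if "k < m" for m
    proof -
      have "0 < fst (edge_vec c k) * B m - fst (edge_vec c m) * B k"
        unfolding BB using \<open>0 < snd a\<close> wedge_edge_vec_pos[OF c that] by simp
      moreover have "0 \<le> fst (edge_vec c m) * B k"
        using pos[of m] Bk by simp
      ultimately have "0 < fst (edge_vec c k) * B m" by linarith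
      then show ?thesis using pos[of k] by (simp add: zero_less_mult_iff)
    qed
    have "b < a \<bullet> vtx c l" using kl
    proof (induction rule: int_gr_induct)
      case base
      then show ?case using Bm[of "k + 1"] ge[of "k + 1"] by (simp add: B_def e_diff)
    next
      case (step i)
      then show ?case using Bm[of i] by (simp add: B_def e_diff)
    qed
    with l show False by simp
  qed
  \<comment> \<open>If no vertex lies on the line, the condition is vacuous and any \<open>n\<close>
    serves.\<close>
  obtain n where n: "\<And>k. a \<bullet> vtx c k = b \<Longrightarrow> k = n \<or> k = n + 1"
  proof (cases "\<exists>k. a \<bullet> vtx c k = b")
    case True
    then obtain k0 where k0: "a \<bullet> vtx c k0 = b" by blast
    show ?thesis
    proof (cases "a \<bullet> vtx c (k0 - 1) = b")
      case True
      show ?thesis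
      proof (rule that[of "k0 - 1"])
        fix k assume k: "a \<bullet> vtx c k = b"
        show "k = k0 - 1 \<or> k = k0 - 1 + 1"
          using close[OF k True] close[OF True k] close[OF k k0]
          by (cases k "k0 - 1" rule: linorder_cases) auto
      qed
    next
      case False
      show ?thesis
      proof (rule that[of k0])
        fix k assume k: "a \<bullet> vtx c k = b"
        have "k \<noteq> k0 - 1" using False k by auto
        then show "k = k0 \<or> k = k0 + 1"
          using close[OF k k0] close[OF k0 k] by (cases k k0 rule: linorder_cases) auto
      qed
    qed
  qed blast
  have "p \<in> edge_seg c n"
    by (rule polygon_supporting_line(2)[OF ge n p]) (simp_all add: b_def)
  with no show False by blast
qed

section \<open>Projection of the edges to the first coordinate\<close>

lemma edge_seg_fst:
  assumes c: "1 \<le> c" and p: "p \<in> edge_seg c n"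
  shows "fst (vtx c n) \<le> fst p" and "fst p \<le> fst (vtx c (n + 1))"
proof -
  obtain u where u: "0 \<le> u" "u \<le> 1" "p = (1 - u) *\<^sub>R vtx c n + u *\<^sub>R vtx c (n + 1)"
    using p by (auto simp: in_segment)
  have f: "fst p = fst (vtx c n) + u * (fst (vtx c (n + 1)) - fst (vtx c n))"
    unfolding u(3) by (simp add: algebra_simps)
  have "0 \<le> u * (fst (vtx c (n + 1)) - fst (vtx c n))"
    using u c by simp
  moreover have "u * (fst (vtx c (n + 1)) - fst (vtx c n)) \<le> 1 * (fst (vtx c (n + 1)) - fst (vtx c n))"
    using u c by (intro mult_right_mono) auto
  ultimately show "fst (vtx c n) \<le> fst p" and "fst p \<le> fst (vtx c (n + 1))"
    unfolding f mult_1 by linarith+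
qed

lemma open_edge_fst:
  assumes c: "1 \<le> c" and p: "p \<in> open_edge c n"
  shows "fst (vtx c n) < fst p" and "fst p < fst (vtx c (n + 1))"
proof -
  obtain u where u: "0 < u" "u < 1" "p = (1 - u) *\<^sub>R vtx c n + u *\<^sub>R vtx c (n + 1)"
    using p by (auto simp: in_segment)
  have f: "fst p = fst (vtx c n) + u * (fst (vtx c (n + 1)) - fst (vtx c n))"
    unfolding u(3) by (simp add: algebra_simps)
  have "0 < u * (fst (vtx c (n + 1)) - fst (vtx c n))"
    using u c by simp
  moreover have "u * (fst (vtx c (n + 1)) - fst (vtx c n)) < 1 * (fst (vtx c (n + 1)) - fst (vtx c n))"
    using u c by (intro mult_strict_right_mono) auto
  ultimately show "fst (vtx c n) < fst p" and "fst p < fst (vtx c (n + 1))"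
    unfolding f mult_1 by linarith+
qed

lemma open_edge_unique:
  assumes c: "1 \<le> c" and p: "p \<in> open_edge c n" "p \<in> edge_seg c m"
  shows "m = n"
proof -
  have "fst (vtx c n) < fst (vtx c (m + 1))" "fst (vtx c m) < fst (vtx c (n + 1))"
    using open_edge_fst[OF c p(1)] edge_seg_fst[OF c p(2)] by linarith+
  then show ?thesis using c by simp
qed

lemma vtx_not_open_edge:
  assumes c: "1 \<le> c"
  shows "vtx c k \<notin> open_edge c n"
  using open_edge_fst[OF c, of "vtx c k" n] c by auto

lemma vtx_not_interior: "1 \<le> c \<Longrightarrow> vtx c k \<notin> interior (polygon c Pos)"
  using edge_seg_not_interior[of c "vtx c k" k] by simp

lemma open_edge_not_interior: "1 \<le> c \<Longrightarrow> p \<in> open_edge c n \<Longrightarrow> p \<notin> interior (polygon c Pos)"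
  using edge_seg_not_interior open_closed_segment by blast

lemma open_edge_in_polygon: "p \<in> open_edge c n \<Longrightarrow> p \<in> polygon c Pos"
  using edge_seg_subset_polygon open_closed_segment by blast

lemma polygon_cases:
  assumes "1 \<le> c" "p \<in> polygon c Pos"
  obtains (interior) "p \<in> interior (polygon c Pos)"
    | (edge) n where "p \<in> open_edge c n"
    | (vertex) n where "p = vtx c n"
proof (cases "p \<in> interior (polygon c Pos)")
  case False
  then obtain n where "p \<in> edge_seg c n"
    using not_edge_interior[OF assms] by blast
  then show ?thesis
    using edge vertex by (cases "p = vtx c n \<or> p = vtx c (n + 1)") (auto simp: open_segment_def)
qed (rule interior)

text \<open>Inside the polygon an open edge is singled out, up to interior points, by an open
  condition on the first coordinate. This makes \<open>chart_zone\<close> relatively open and so the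
  chart domains open.\<close>

lemma polygon_strip:
  assumes c: "1 \<le> c" and p: "p \<in> polygon c Pos" "fst (vtx c n) < fst p" "fst p < fst (vtx c (n + 1))"
    and "p \<notin> interior (polygon c Pos)"
  shows "p \<in> open_edge c n"
  using c p(1)
proof (cases rule: polygon_cases)
  case interior
  with assms show ?thesis by simp
next
  case (edge m)
  have "fst (vtx c n) < fst (vtx c (m + 1))" "fst (vtx c m) < fst (vtx c (n + 1))"
    using open_edge_fst[OF c edge] p(2,3) by linarith+
  then have "m = n" using c by simp
  with edge show ?thesis by simp
next
  case (vertex m)
  then show ?thesis using p c by simp
qed

section \<open>Gluing and canonical homeomorphisms\<close>

fun sgn_side :: "side \<Rightarrow> real" where
  "sgn_side Pos = 1"
| "sgn_side Neg = -1"

fun flip :: "side \<Rightarrow> side" where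
  "flip Pos = Neg"
| "flip Neg = Pos"

text \<open>Coordinates in which both polygons are the positive one: the negative polygon is rotated by \<open>\<pi>\<close>.\<close>

definition upright :: "side \<times> (real \<times> real) \<Rightarrow> real \<times> real" where
  "upright x = sgn_side (fst x) *\<^sub>R snd x"

text \<open>In upright coordinates this is the point reflection in the midpoint of the
  \<open>n\<close>-th edge, with the same formula for both polygons. It is a gluing when
  \<open>upright x\<close> lies on that edge.\<close>

definition partner :: "real \<Rightarrow> int \<Rightarrow> side \<times> (real \<times> real) \<Rightarrow> side \<times> (real \<times> real)" where
  "partner c n x = (flip (fst x), snd x - sgn_side (fst x) *\<^sub>R edge_sum c n)"

lemma sgn_side_mult [simp]: "sgn_side s * sgn_side s = 1"
  by (cases s) auto

lemma sgn_side_flip [simp]: "sgn_side (flip s) = - sgn_side s"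
  by (cases s) auto

lemma flip_flip [simp]: "flip (flip s) = s" and flip_neq [simp]: "flip s \<noteq> s"
  by (cases s; simp)+

lemma upright_inj: "fst x = fst y \<Longrightarrow> upright x = upright y \<Longrightarrow> x = y"
  by (cases "fst y") (auto simp: upright_def prod_eq_iff)

lemma upright_simps [simp]: "upright (Pos, p) = p" "upright (Neg, p) = - p"
  by (simp_all add: upright_def)

lemma fst_partner [simp]: "fst (partner c n x) = flip (fst x)"
  by (simp add: partner_def)

lemma partner_partner [simp]: "partner c n (partner c n x) = x"
  by (simp add: partner_def)

lemma upright_partner: "upright (partner c n x) = edge_sum c n - upright x"
  by (simp add: upright_def partner_def algebra_simps)

lemma vertex_sgn: "vertex c s n = sgn_side s *\<^sub>R vtx c n"
  by (cases s) auto

lemma upright_vertex [simp]: "upright (s, vertex c s n) = vtx c n"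
  by (simp add: upright_def vertex_sgn)

lemma in_polygon_iff: "snd x \<in> polygon c (fst x) \<longleftrightarrow> upright x \<in> polygon c Pos"
  by (cases x; cases "fst x") (auto simp: image_iff intro: bexI[of _ "- snd x"])

lemma interior_polygon_iff: "snd x \<in> interior (polygon c (fst x)) \<longleftrightarrow> upright x \<in> interior (polygon c Pos)"
  by (cases x; cases "fst x") (auto simp: interior_negations image_iff intro: bexI[of _ "- snd x"])

lemma topspace_polygons: "x \<in> topspace (polygons c) \<longleftrightarrow> upright x \<in> polygon c Pos"
  unfolding polygons_def using in_polygon_iff[of x c] by (cases x) simp

lemma edge_reflect: "p \<in> edge_seg c n \<Longrightarrow> edge_sum c n - p \<in> edge_seg c n"
proof -
  assume "p \<in> edge_seg c n"
  then obtain u where u: "0 \<le> u" "u \<le> 1" "p = (1 - u) *\<^sub>R vtx c n + u *\<^sub>R vtx c (n + 1)"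
    by (auto simp: in_segment)
  have "edge_sum c n - p = (1 - (1 - u)) *\<^sub>R vtx c n + (1 - u) *\<^sub>R vtx c (n + 1)"
    by (simp add: u(3) edge_sum_def algebra_simps)
  then show ?thesis using u(1,2) unfolding in_segment by (intro exI[of _ "1 - u"]) simp
qed

lemma open_edge_reflect: "p \<in> open_edge c n \<Longrightarrow> edge_sum c n - p \<in> open_edge c n"
  using edge_reflect[of p c n] unfolding open_segment_def
  by (auto simp: edge_sum_def algebra_simps)

lemma edge_gluing_iff:
  "(x, y) \<in> edge_gluing c \<union> (edge_gluing c)\<inverse> \<longleftrightarrow> (\<exists>n. upright x \<in> edge_seg c n \<and> y = partner c n x)"
proof
  assume "(x, y) \<in> edge_gluing c \<union> (edge_gluing c)\<inverse>"
  then show "\<exists>n. upright x \<in> edge_seg c n \<and> y = partner c n x"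
  proof
    assume "(x, y) \<in> (edge_gluing c)\<inverse>"
    then obtain n p where *: "x = (Neg, p - edge_sum c n)" "y = (Pos, p)" "p \<in> edge_seg c n"
      by (auto simp: edge_gluing_def edge_sum_def)
    then show ?thesis using edge_reflect[of p c n] by (auto simp: partner_def)
  qed (auto simp: edge_gluing_def partner_def edge_sum_def)
next
  assume "\<exists>n. upright x \<in> edge_seg c n \<and> y = partner c n x"
  then obtain n where n: "upright x \<in> edge_seg c n" "y = partner c n x" by blast
  show "(x, y) \<in> edge_gluing c \<union> (edge_gluing c)\<inverse>"
  proof (cases "fst x")
    case Pos
    then show ?thesis using n by (cases x) (auto simp: edge_gluing_def partner_def edge_sum_def)
  next
    case Neg
    then obtain p where p: "x = (Neg, p)" by (cases x) auto
    have "- p \<in> edge_seg c n" using n p by simp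
    then have "p + edge_sum c n \<in> edge_seg c n"
      using edge_reflect[of "- p" c n] by (simp add: add.commute)
    moreover have "y = (Pos, p + edge_sum c n)"
      using n p by (simp add: partner_def)
    moreover have "x = (Neg, p + edge_sum c n - edge_sum c n)" using p by simp
    ultimately have "(y, x) \<in> edge_gluing c" unfolding edge_gluing_def edge_sum_def by blast
    then show ?thesis by blast
  qed
qed

section \<open>Gluing classes\<close>

lemma glue_refl [simp]: "(x, x) \<in> glue c"
  by (simp add: glue_def)

lemma glue_sym: "(x, y) \<in> glue c \<Longrightarrow> (y, x) \<in> glue c"
  unfolding glue_def by (metis converse_Un converse_converse rtrancl_converseD sup_commute)

lemma glue_trans: "(x, y) \<in> glue c \<Longrightarrow> (y, z) \<in> glue c \<Longrightarrow> (x, z) \<in> glue c"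
  unfolding glue_def by (rule rtrancl_trans)

lemma equiv_glue: "equiv UNIV (glue c)"
  by (intro equivI refl_onI symI transI) (auto intro: glue_sym glue_trans)

lemma proj_eq_iff: "proj c x = proj c y \<longleftrightarrow> (x, y) \<in> glue c"
  unfolding proj_def by (rule eq_equiv_class_iff[OF equiv_glue]) auto

lemma glue_partner: "upright x \<in> edge_seg c n \<Longrightarrow> (x, partner c n x) \<in> glue c"
  unfolding glue_def using edge_gluing_iff by (intro r_into_rtrancl) blast

lemma proj_partner: "upright x \<in> edge_seg c n \<Longrightarrow> proj c (partner c n x) = proj c x"
  using glue_partner glue_sym unfolding proj_eq_iff by blast

lemma glue_polygons: "(x, y) \<in> glue c \<Longrightarrow> x \<in> topspace (polygons c) \<Longrightarrow> y \<in> topspace (polygons c)"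
  unfolding glue_def
proof (induction rule: rtrancl_induct)
  case (step y z)
  then obtain n where "upright y \<in> edge_seg c n" "z = partner c n y"
    using edge_gluing_iff by blast
  then show ?case
    using edge_reflect[of "upright y" c n] edge_seg_subset_polygon
    by (auto simp: topspace_polygons upright_partner simp del: polygon.simps)
qed

lemma glue_interior:
  assumes c: "1 \<le> c" and "(x, y) \<in> glue c" and x: "upright x \<in> interior (polygon c Pos)"
  shows "y = x"
  using assms(2) unfolding glue_def
proof (induction rule: rtrancl_induct)
  case (step y z)
  then show ?case using x edge_gluing_iff[of y z c] edge_seg_not_interior[OF c] by metis
qed simp

lemma glue_open_edge:
  assumes c: "1 \<le> c" and "(x, y) \<in> glue c" and x: "upright x \<in> open_edge c n"
  shows "y = x \<or> y = partner c n x"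
  using assms(2) unfolding glue_def
proof (induction rule: rtrancl_induct)
  case (step y z)
  then obtain m where m: "upright y \<in> edge_seg c m" "z = partner c m y"
    using edge_gluing_iff by blast
  have "upright y \<in> open_edge c n"
    using step.IH x open_edge_reflect[of "upright x"] by (auto simp: upright_partner)
  then have "m = n" using open_edge_unique[OF c _ m(1)] by simp
  with m step.IH show ?case by auto
qed simp

lemma vtx_in_edge_seg:
  assumes c: "1 \<le> c" and "vtx c k \<in> edge_seg c n"
  shows "k = n \<or> k = n + 1"
  using vtx_not_open_edge[OF c, of k n] assms by (auto simp: open_segment_def)

lemma glue_vertex:
  assumes c: "1 \<le> c" and "(x, y) \<in> glue c" and x: "upright x \<in> range (vtx c)"
  shows "upright y \<in> range (vtx c)"
  using assms(2) unfolding glue_def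
proof (induction rule: rtrancl_induct)
  case (step y z)
  then obtain m where m: "upright y \<in> edge_seg c m" "z = partner c m y"
    using edge_gluing_iff by blast
  obtain k where k: "upright y = vtx c k" using step.IH by blast
  then have "k = m \<or> k = m + 1" using m vtx_in_edge_seg[OF c] by metis
  then have "upright z = vtx c (m + 1) \<or> upright z = vtx c m"
    using k m by (auto simp: upright_partner edge_sum_def)
  then show ?case by auto
qed (rule x)

text \<open>Interior points, points of open edges and vertices have gluing classes of size one, two
  and at least three. These sizes are preserved by any map of the polygons that covers a
  homeomorphism of the surfaces, and so are the three kinds of points.\<close>

lemma interior_iff_fiber:
  assumes c: "1 \<le> c" and x: "x \<in> topspace (polygons c)"
  shows "upright x \<in> interior (polygon c Pos) \<longleftrightarrow> (\<forall>y. (x, y) \<in> glue c \<longrightarrow> y = x)"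
proof
  assume "\<forall>y. (x, y) \<in> glue c \<longrightarrow> y = x"
  then have "upright x \<notin> edge_seg c n" for n
    using glue_partner[of x c n] fst_partner[of c n x] flip_neq by metis
  then show "upright x \<in> interior (polygon c Pos)"
    using not_edge_interior[OF c] x topspace_polygons by blast
qed (use glue_interior[OF c] in blast)

lemma vertex_iff_fiber:
  assumes c: "1 \<le> c" and x: "x \<in> topspace (polygons c)"
  shows "upright x \<in> range (vtx c) \<longleftrightarrow>
    (\<exists>y z. (x, y) \<in> glue c \<and> (x, z) \<in> glue c \<and> y \<noteq> x \<and> z \<noteq> x \<and> y \<noteq> z)"
proof
  assume "upright x \<in> range (vtx c)"
  then obtain k where k: "upright x = vtx c k" by blast
  \<comment> \<open>Gluing along edge \<open>k\<close> takes vertex \<open>k\<close> to vertex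
    \<open>k + 1\<close> of the other polygon, and gluing along edge \<open>k + 1\<close> takes that
    to vertex \<open>k + 2\<close> of the original one.\<close>
  let ?y = "partner c k x"
  let ?z = "partner c (k + 1) ?y"
  have y: "upright ?y = vtx c (k + 1)" by (simp add: upright_partner k edge_sum_def)
  have z: "upright ?z = vtx c (k + 1 + 1)"
    unfolding upright_partner[of c "k + 1"] y by (simp add: edge_sum_def)
  have "(x, ?y) \<in> glue c" using k by (intro glue_partner) simp
  moreover have "(?y, ?z) \<in> glue c" using y by (intro glue_partner) simp
  moreover have "?y \<noteq> x" "?z \<noteq> ?y"
    using fst_partner flip_neq by metis+
  moreover have "?z \<noteq> x" using z k c by (metis vtx_eq_iff add.assoc add_cancel_right_right one_add_one zero_neq_numeral)
  ultimately show "\<exists>y z. (x, y) \<in> glue c \<and> (x, z) \<in> glue c \<and> y \<noteq> x \<and> z \<noteq> x \<and> y \<noteq> z"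
    using glue_trans by metis
next
  assume R: "\<exists>y z. (x, y) \<in> glue c \<and> (x, z) \<in> glue c \<and> y \<noteq> x \<and> z \<noteq> x \<and> y \<noteq> z"
  show "upright x \<in> range (vtx c)"
    using c x[unfolded topspace_polygons]
  proof (cases rule: polygon_cases)
    case interior
    then show ?thesis using R glue_interior[OF c] by metis
  next
    case (edge n)
    then show ?thesis using R glue_open_edge[OF c] by metis
  qed blast
qed

lemma edge_sum_inject: "1 \<le> c \<Longrightarrow> edge_sum c m = edge_sum c n \<Longrightarrow> m = n"
proof -
  assume c: "1 \<le> c" and eq: "edge_sum c m = edge_sum c n"
  have "strict_mono (\<lambda>n. fst (edge_sum c n))"
    using c by (intro strict_mono_int_SucI) (simp add: edge_sum_def)
  from strict_mono_eq[OF this, of m n] show "m = n" using eq by simp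
qed

section \<open>Lifts of canonical homeomorphisms to the polygons\<close>

lemma continuous_map_polygons_side:
  "continuous_map (top_of_set (polygon c s)) (polygons c) (Pair s)"
  unfolding polygons_def by (rule continuous_map_component_injection) simp

lemma continuous_map_polygons_snd: "continuous_map (polygons c) euclidean snd"
proof -
  have "openin (top_of_set (polygon c s)) {x \<in> U. x \<in> polygon c s}" if "open U" for s U
    using openin_open_Int[OF that, of "polygon c s"] by (simp add: Int_def conj_commute)
  then show ?thesis
    unfolding continuous_map_def polygons_def openin_sum_topology
    by (auto simp: conj_commute)
qed

text \<open>Only the vertices of the positive polygon have prescribed images; the behaviour on the
  edges and on the negative vertices is derived. The identity at \<open>c = 1\<close> is an
  instance, through which facts about \<open>chart c n (h x)\<close> become facts about
  \<open>chart 1 n x\<close>.\<close>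

locale canonical_lift =
  fixes c :: real and h :: "point \<Rightarrow> point" and H :: "side \<times> (real \<times> real) \<Rightarrow> side \<times> (real \<times> real)"
  assumes c: "1 \<le> c"
    and h: "homeomorphic_map (surface 1) (surface c) h"
    and H: "homeomorphic_map (polygons 1) (polygons c) H"
    and fst_H: "x \<in> topspace (polygons 1) \<Longrightarrow> fst (H x) = fst x"
    and h_proj: "x \<in> topspace (polygons 1) \<Longrightarrow> h (proj 1 x) = proj c (H x)"
    and H_Pos_vtx: "H (Pos, vtx 1 n) = (Pos, vtx c n)"
begin

lemma H_in: "x \<in> topspace (polygons 1) \<Longrightarrow> H x \<in> topspace (polygons c)"
  using H homeomorphic_imp_surjective_map by blast

lemma H_inj: "x \<in> topspace (polygons 1) \<Longrightarrow> y \<in> topspace (polygons 1) \<Longrightarrow> H x = H y \<longleftrightarrow> x = y"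
  using H homeomorphic_imp_injective_map inj_onD by metis

lemma H_surj: "y \<in> topspace (polygons c) \<Longrightarrow> \<exists>x\<in>topspace (polygons 1). H x = y"
  using homeomorphic_imp_surjective_map[OF H, symmetric] by auto

lemma H_glue:
  assumes "x \<in> topspace (polygons 1)" "y \<in> topspace (polygons 1)"
  shows "(H x, H y) \<in> glue c \<longleftrightarrow> (x, y) \<in> glue 1"
proof -
  have "proj 1 x \<in> topspace (surface 1)" "proj 1 y \<in> topspace (surface 1)"
    using assms by (auto simp: surface_def proj_def quotientI)
  then have "h (proj 1 x) = h (proj 1 y) \<longleftrightarrow> proj 1 x = proj 1 y"
    using h homeomorphic_imp_injective_map inj_onD by metis
  then show ?thesis using assms by (simp add: h_proj proj_eq_iff)
qed

lemma H_fiber: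
  assumes x: "x \<in> topspace (polygons 1)"
  shows "(H x, z) \<in> glue c \<longleftrightarrow> (\<exists>y. (x, y) \<in> glue 1 \<and> z = H y \<and> y \<in> topspace (polygons 1))"
  using glue_polygons[OF _ H_in[OF x]] H_surj H_glue[OF x] by metis

lemma H_interior:
  assumes x: "x \<in> topspace (polygons 1)"
  shows "upright (H x) \<in> interior (polygon c Pos) \<longleftrightarrow> upright x \<in> interior (polygon 1 Pos)"
  unfolding interior_iff_fiber[OF c H_in[OF x]] interior_iff_fiber[OF order_refl x] H_fiber[OF x]
  using H_inj x glue_polygons[OF _ x] by metis

lemma H_vertex_iff:
  assumes x: "x \<in> topspace (polygons 1)"
  shows "upright (H x) \<in> range (vtx c) \<longleftrightarrow> upright x \<in> range (vtx 1)"
  unfolding vertex_iff_fiber[OF c H_in[OF x]] vertex_iff_fiber[OF order_refl x] H_fiber[OF x]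
  using H_inj x glue_polygons[OF _ x] by metis

lemma continuous_on_H: "continuous_on (polygon 1 s) (\<lambda>p. snd (H (s, p)))"
proof -
  have "continuous_map (top_of_set (polygon 1 s)) euclidean (snd \<circ> (H \<circ> Pair s))"
    using H continuous_map_polygons_side continuous_map_polygons_snd homeomorphic_imp_continuous_map
    by (intro continuous_map_compose)
  then show ?thesis by (simp add: o_def)
qed

text \<open>On a glued pair of edges the difference of the two lifts takes values in the countable set of
  the vectors \<open>edge_sum c k\<close>, so by continuity it is constant and the edges cannot be permuted.\<close>

lemma H_edge_aux:
  fixes n
  defines "\<phi> \<equiv> \<lambda>t. snd (H (Pos, (1 - t) *\<^sub>R vtx 1 n + t *\<^sub>R vtx 1 (n + 1)))"
    and "\<psi> \<equiv> \<lambda>t. snd (H (partner 1 n (Pos, (1 - t) *\<^sub>R vtx 1 n + t *\<^sub>R vtx 1 (n + 1))))"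
  shows "t \<in> {0..1} \<Longrightarrow> \<psi> t = \<phi> t - edge_sum c n" and "t \<in> {0<..<1} \<Longrightarrow> \<phi> t \<in> open_edge c n"
proof -
  let ?q = "\<lambda>t. (1 - t) *\<^sub>R vtx 1 n + t *\<^sub>R vtx 1 (n + 1)"
  have q: "?q t \<in> edge_seg 1 n" if "t \<in> {0..1}" for t
    using that by (auto simp: in_segment)
  have q': "?q t \<in> open_edge 1 n" if "t \<in> {0<..<1}" for t
    using that by (auto simp: in_segment)
  have x: "(Pos, ?q t) \<in> topspace (polygons 1)" if "t \<in> {0..1}" for t
    using q[OF that] edge_seg_subset_polygon by (auto simp: topspace_polygons simp del: polygon.simps)
  have y: "partner 1 n (Pos, ?q t) \<in> topspace (polygons 1)" if "t \<in> {0..1}" for t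
    using glue_polygons[OF glue_partner x] q that by simp
  have cq: "continuous_on {0..1} ?q" by (intro continuous_intros)
  have "continuous_on {0..1} \<phi>"
    unfolding \<phi>_def
    by (rule continuous_on_compose2[OF continuous_on_H cq])
       (use q edge_seg_subset_polygon in blast)
  have "?q t - edge_sum 1 n \<in> polygon 1 Neg" if "t \<in> {0..1}" for t
    using y[OF that] in_polygon_iff[of "(Neg, ?q t - edge_sum 1 n)" 1]
    by (simp add: topspace_polygons partner_def del: polygon.simps)
  then have "continuous_on {0..1} (\<lambda>t. snd (H (Neg, ?q t - edge_sum 1 n)))"
    by (intro continuous_on_compose2[OF continuous_on_H, of "{0..1}" "\<lambda>t. ?q t - edge_sum 1 n"]
        continuous_intros) blast
  then have "continuous_on {0..1} \<psi>"
    by (simp add: \<psi>_def partner_def)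
  have ex: "\<exists>k. \<phi> t \<in> open_edge c k \<and> \<psi> t = \<phi> t - edge_sum c k" if t: "t \<in> {0<..<1}" for t
  proof -
    have t': "t \<in> {0..1}" using t by auto
    let ?x = "(Pos, ?q t)"
    have Hx: "H ?x = (Pos, \<phi> t)" using fst_H[OF x[OF t']] by (simp add: \<phi>_def prod_eq_iff)
    have "upright ?x \<notin> interior (polygon 1 Pos)"
      using open_edge_not_interior[OF order_refl q'[OF t]] by simp
    moreover have "upright ?x \<notin> range (vtx 1)"
      using vtx_not_open_edge[of 1] q'[OF t] by auto
    ultimately have ni: "upright (H ?x) \<notin> interior (polygon c Pos)" "upright (H ?x) \<notin> range (vtx c)"
      using H_interior[OF x[OF t']] H_vertex_iff[OF x[OF t']] by blast+
    have "upright (H ?x) \<in> polygon c Pos" using H_in[OF x[OF t']] by (simp only: topspace_polygons)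
    with c obtain k where k: "upright (H ?x) \<in> open_edge c k"
      by (cases rule: polygon_cases) (use ni in blast)+
    have "(H ?x, H (partner 1 n ?x)) \<in> glue c"
      using H_glue[OF x[OF t'] y[OF t']] glue_partner[of ?x 1 n] q[OF t'] by simp
    moreover have "H (partner 1 n ?x) \<noteq> H ?x"
      using H_inj[OF x[OF t'] y[OF t']] fst_partner flip_neq by metis
    ultimately have "H (partner 1 n ?x) = partner c k (H ?x)"
      using glue_open_edge[OF c _ k] by blast
    then have "\<psi> t = \<phi> t - edge_sum c k"
      unfolding Hx by (simp add: \<psi>_def partner_def)
    with k Hx show ?thesis by auto
  qed
  have "countable ((\<lambda>t. \<phi> t - \<psi> t) ` {0<..<1})"
  proof (rule countable_subset)
    show "(\<lambda>t. \<phi> t - \<psi> t) ` {0<..<1} \<subseteq> range (edge_sum c)"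
      using ex by force
  qed simp
  moreover have cont: "continuous_on {0..1} (\<lambda>t. \<phi> t - \<psi> t)"
    using \<open>continuous_on {0..1} \<phi>\<close> \<open>continuous_on {0..1} \<psi>\<close> by (rule continuous_on_diff)
  then have "connected ((\<lambda>t. \<phi> t - \<psi> t) ` {0<..<1})"
    by (intro connected_continuous_image continuous_on_subset[OF cont]) auto
  ultimately have const: "\<phi> t - \<psi> t = \<phi> u - \<psi> u" if "t \<in> {0<..<1}" "u \<in> {0<..<1}" for t u
    using connected_uncountable that by (metis (no_types, lifting) image_eqI)
  obtain k where k: "\<phi> (1/2) \<in> open_edge c k" "\<psi> (1/2) = \<phi> (1/2) - edge_sum c k"
    using ex[of "1/2"] by auto
  have \<psi>k: "\<phi> t - \<psi> t = edge_sum c k" if "t \<in> {0<..<1}" for t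
    using const[OF that, of "1/2"] k by simp
  have \<phi>k: "\<phi> t \<in> open_edge c k" if t: "t \<in> {0<..<1}" for t
  proof -
    obtain m where m: "\<phi> t \<in> open_edge c m" "\<psi> t = \<phi> t - edge_sum c m" using ex[OF t] by blast
    then have "m = k" using \<psi>k[OF t] edge_sum_inject[OF c] by simp
    with m show ?thesis by simp
  qed
  have cl: "closure {0<..<1} = {0..1::real}" by simp
  have "\<phi> ` closure {0<..<1} \<subseteq> edge_seg c k"
  proof (rule image_closure_subset)
    show "\<phi> ` {0<..<1} \<subseteq> edge_seg c k" using \<phi>k open_closed_segment by blast
  qed (use \<open>continuous_on {0..1} \<phi>\<close> in \<open>simp_all add: closed_segment\<close>)
  \<comment> \<open>Continuity brings in the endpoints of the edge, whose images are prescribed;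
    vertices \<open>n\<close> and \<open>n + 1\<close> both lie on edge \<open>k\<close> only for
    \<open>k = n\<close>.\<close>
  then have "\<phi> 0 \<in> edge_seg c k" "\<phi> 1 \<in> edge_seg c k" by auto
  then have "vtx c n \<in> edge_seg c k" "vtx c (n + 1) \<in> edge_seg c k"
    by (simp_all add: \<phi>_def H_Pos_vtx)
  then have "k = n"
    using vtx_in_edge_seg[OF c, of n k] vtx_in_edge_seg[OF c, of "n + 1" k] by auto
  have "(\<lambda>t. \<phi> t - \<psi> t) ` closure {0<..<1} \<subseteq> {edge_sum c k}"
  proof (rule image_closure_subset)
    show "(\<lambda>t. \<phi> t - \<psi> t) ` {0<..<1} \<subseteq> {edge_sum c k}" using \<psi>k by blast
  qed (use cont in simp_all)
  then have "\<phi> t - \<psi> t = edge_sum c k" if "t \<in> {0..1}" for t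
    using that unfolding cl by blast
  then show "t \<in> {0..1} \<Longrightarrow> \<psi> t = \<phi> t - edge_sum c n"
    using \<open>k = n\<close> by (simp add: algebra_simps)
  show "t \<in> {0<..<1} \<Longrightarrow> \<phi> t \<in> open_edge c n"
    using \<phi>k \<open>k = n\<close> by simp
qed

lemma H_edge_partner:
  assumes "p \<in> edge_seg 1 n"
  shows "H (Neg, p - edge_sum 1 n) = (Neg, snd (H (Pos, p)) - edge_sum c n)"
proof -
  obtain t where t: "0 \<le> t" "t \<le> 1" and p: "p = (1 - t) *\<^sub>R vtx 1 n + t *\<^sub>R vtx 1 (n + 1)"
    using assms by (auto simp: in_segment)
  have x: "(Pos, p) \<in> topspace (polygons 1)"
    using assms edge_seg_subset_polygon by (auto simp: topspace_polygons simp del: polygon.simps)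
  have "partner 1 n (Pos, p) \<in> topspace (polygons 1)"
    using glue_polygons[OF glue_partner x] assms by simp
  then have "fst (H (Neg, p - edge_sum 1 n)) = Neg"
    using fst_H by (simp add: partner_def)
  then show ?thesis
    using H_edge_aux(1)[of t n] t unfolding p[symmetric]
    by (intro prod_eqI) (simp_all add: partner_def)
qed

lemma H_open_edge:
  assumes "p \<in> open_edge 1 n"
  shows "snd (H (Pos, p)) \<in> open_edge c n"
proof -
  obtain t where "0 < t" "t < 1" and p: "p = (1 - t) *\<^sub>R vtx 1 n + t *\<^sub>R vtx 1 (n + 1)"
    using assms by (auto simp: in_segment)
  then show ?thesis using H_edge_aux(2)[of t n] by auto
qed

lemma H_vertex: "H (s, vertex 1 s n) = (s, vertex c s n)"
proof (cases s)
  case Neg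
  \<comment> \<open>Vertex \<open>n\<close> of the negative polygon is glued to vertex
    \<open>n - 1\<close> of the positive one along edge \<open>n - 1\<close>.\<close>
  have "vtx 1 (n - 1) \<in> edge_seg 1 (n - 1)" by simp
  from H_edge_partner[OF this] show ?thesis
    by (simp add: Neg edge_sum_def H_Pos_vtx)
qed (simp add: H_Pos_vtx)

end

lemma canonical_lift_id: "canonical_lift 1 id id"
  by unfold_locales auto

lemma canonical_homeo_lift: "1 \<le> c \<Longrightarrow> canonical_homeo c h \<Longrightarrow> \<exists>H. canonical_lift c h H"
  unfolding canonical_homeo_def canonical_lift_def by blast

section \<open>Charts of the surface\<close>

declare polygon.simps [simp del]

text \<open>In upright coordinates the part of chart \<open>n\<close> in either polygon is this one
  set, since \<open>partner\<close> maps the open edge to itself.\<close>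

definition chart_zone :: "real \<Rightarrow> int \<Rightarrow> (real \<times> real) set" where
  "chart_zone c n = interior (polygon c Pos) \<union> open_edge c n"

definition shift :: "real \<Rightarrow> int \<Rightarrow> side \<Rightarrow> real \<times> real" where
  "shift c n s = (if s = Neg then edge_sum c n else 0)"

lemma chart_zone_polygon: "p \<in> chart_zone c n \<Longrightarrow> p \<in> polygon c Pos"
  unfolding chart_zone_def using interior_subset open_edge_in_polygon by blast

lemma glue_chart_zone:
  assumes c: "1 \<le> c" and "(x, y) \<in> glue c" and x: "upright x \<in> chart_zone c n"
  shows "upright y \<in> chart_zone c n \<and> snd y + shift c n (fst y) = snd x + shift c n (fst x) \<and> (y = x \<or> y = partner c n x)"
proof (cases "upright x \<in> interior (polygon c Pos)")
  case True
  then show ?thesis using glue_interior[OF c assms(2)] x by blast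
next
  case False
  then have xe: "upright x \<in> open_edge c n" using x by (simp add: chart_zone_def)
  have "upright (partner c n x) \<in> chart_zone c n"
    unfolding upright_partner chart_zone_def using open_edge_reflect[OF xe] by blast
  moreover have "snd (partner c n x) + shift c n (fst (partner c n x)) = snd x + shift c n (fst x)"
    by (cases "fst x") (simp_all add: shift_def partner_def)
  ultimately show ?thesis using glue_open_edge[OF c assms(2) xe] x by auto
qed

text \<open>\<open>chart_rel\<close> reads a point of the \<open>n\<close>-th edge in the positive
  polygon only. Its two preimages have the same position after \<open>shift\<close>, so either may
  be used.\<close>

lemma chart_rel_iff:
  assumes c: "1 \<le> c"
  shows "chart_rel c n x p \<longleftrightarrow> (\<exists>y. x = proj c y \<and> upright y \<in> chart_zone c n \<and> p = snd y + shift c n (fst y))"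
proof
  assume "chart_rel c n x p"
  then consider "p \<in> chart_zone c n" "x = proj c (Pos, p)"
    | "p - edge_sum c n \<in> interior (polygon c Neg)" "x = proj c (Neg, p - edge_sum c n)"
    unfolding chart_rel_def chart_zone_def edge_sum_def by blast
  then show "\<exists>y. x = proj c y \<and> upright y \<in> chart_zone c n \<and> p = snd y + shift c n (fst y)"
  proof cases
    case 1
    then show ?thesis by (intro exI[of _ "(Pos, p)"]) (simp add: shift_def)
  next
    case 2
    then show ?thesis
      using interior_polygon_iff[of "(Neg, p - edge_sum c n)" c]
      by (intro exI[of _ "(Neg, p - edge_sum c n)"]) (simp add: shift_def chart_zone_def)
  qed
next
  assume "\<exists>y. x = proj c y \<and> upright y \<in> chart_zone c n \<and> p = snd y + shift c n (fst y)"
  then obtain y where y: "x = proj c y" "upright y \<in> chart_zone c n" "p = snd y + shift c n (fst y)"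
    by blast
  show "chart_rel c n x p"
  proof (cases "fst y")
    case Pos
    then have "y = (Pos, p)" using y by (simp add: shift_def prod_eq_iff)
    with y(1,2) show ?thesis by (simp add: chart_rel_def chart_zone_def)
  next
    case Neg
    then have yp: "y = (Neg, p - edge_sum c n)" using y by (simp add: shift_def prod_eq_iff)
    show ?thesis
    proof (cases "upright y \<in> interior (polygon c Pos)")
      case True
      then show ?thesis
        using y(1) yp interior_polygon_iff[of "(Neg, p - edge_sum c n)" c]
        by (simp add: chart_rel_def edge_sum_def)
    next
      case False
      then have e: "upright y \<in> open_edge c n" using y by (simp add: chart_zone_def)
      have "partner c n y = (Pos, p)" using yp by (simp add: partner_def)
      then have "x = proj c (Pos, p)" "p \<in> open_edge c n"
        using y(1) proj_partner[of y c n] open_closed_segment[OF e] open_edge_reflect[OF e] yp by auto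
      then show ?thesis by (simp add: chart_rel_def)
    qed
  qed
qed

lemma proj_in_chart_dom:
  assumes c: "1 \<le> c"
  shows "proj c y \<in> chart_dom c n \<longleftrightarrow> upright y \<in> chart_zone c n"
  unfolding chart_dom_def chart_rel_iff[OF c]
  using glue_chart_zone[OF c] proj_eq_iff by blast

lemma chart_proj:
  assumes c: "1 \<le> c" and y: "upright y \<in> chart_zone c n"
  shows "chart c n (proj c y) = snd y + shift c n (fst y)"
  unfolding chart_def chart_rel_iff[OF c]
proof (rule the_equality)
  show "\<exists>ya. proj c y = proj c ya \<and> upright ya \<in> chart_zone c n \<and> snd y + shift c n (fst y) = snd ya + shift c n (fst ya)"
    using y by blast
  show "p = snd y + shift c n (fst y)"
    if "\<exists>ya. proj c y = proj c ya \<and> upright ya \<in> chart_zone c n \<and> p = snd ya + shift c n (fst ya)" for p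
    using that glue_chart_zone[OF c _ y] unfolding proj_eq_iff by metis
qed

lemma in_chart_domE:
  assumes c: "1 \<le> c" and "x \<in> chart_dom c n"
  obtains y where "x = proj c y" "upright y \<in> chart_zone c n" "chart c n x = snd y + shift c n (fst y)"
  using assms chart_proj[OF c] unfolding chart_dom_def chart_rel_iff[OF c] by blast

section \<open>Faces and open sets of the surface\<close>

definition face :: "side \<Rightarrow> point set" where
  "face s = {proj 1 y |y. fst y = s \<and> upright y \<in> interior (polygon 1 Pos)}"

text \<open>Points on the edges are attributed to the positive polygon.\<close>

definition chi :: "point \<Rightarrow> real" where
  "chi x = (if x \<in> face Neg then 1 else 0)"

lemma topspace_surface: "topspace (surface c) = proj c ` topspace (polygons c)"
  by (auto simp: surface_def proj_def quotient_def)

lemma openin_surface: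
  "openin (surface c) U \<longleftrightarrow> U \<subseteq> topspace (surface c) \<and> openin (polygons c) {x \<in> topspace (polygons c). proj c x \<in> U}"
  by (simp add: surface_def openin_quotient_topology proj_def)

lemma continuous_map_proj: "continuous_map (polygons c) (surface c) (proj c)"
  unfolding continuous_map_def by (auto simp: openin_surface topspace_surface)

lemma continuous_map_polygonsI:
  assumes "\<And>s. continuous_on (polygon c s) (\<lambda>p. f (s, p))"
  shows "continuous_map (polygons c) euclidean f"
proof -
  have "openin (top_of_set (polygon c s)) {p \<in> polygon c s. f (s, p) \<in> U}" if "open U" for s U
    using continuous_openin_preimage_gen[OF assms that, of s] by (simp add: vimage_def Int_def)
  then show ?thesis
    unfolding continuous_map_def polygons_def openin_sum_topology by auto
qed

lemma continuous_map_upright: "continuous_map (polygons c) euclidean upright"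
  by (rule continuous_map_polygonsI) (auto simp: upright_def intro!: continuous_intros)

lemma openin_upright:
  assumes "open V"
  shows "openin (polygons c) {y \<in> topspace (polygons c). upright y \<in> V}"
  using openin_continuous_map_preimage[OF continuous_map_upright, of V c] assms by simp

lemma chart_zone_strip:
  assumes c: "1 \<le> c" and p: "p \<in> polygon c Pos"
  shows "p \<in> chart_zone c n \<longleftrightarrow>
    p \<in> interior (polygon c Pos) \<union> {p. fst (vtx c n) < fst p \<and> fst p < fst (vtx c (n + 1))}"
  unfolding chart_zone_def using polygon_strip[OF c p] open_edge_fst[OF c, of p n] by blast

lemma openin_zone_preimage:
  assumes c: "1 \<le> c"
  shows "openin (polygons c) {y \<in> topspace (polygons c). upright y \<in> chart_zone c n}"
proof -
  have "{y \<in> topspace (polygons c). upright y \<in> chart_zone c n} = {y \<in> topspace (polygons c).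
      upright y \<in> interior (polygon c Pos) \<union> {p. fst (vtx c n) < fst p \<and> fst p < fst (vtx c (n + 1))}}"
    using chart_zone_strip[OF c] topspace_polygons by blast
  also have "openin (polygons c) \<dots>"
    by (intro openin_upright open_Un open_interior open_Collect_conj open_Collect_less continuous_intros)
  finally show ?thesis .
qed

lemma chart_dom_subset_surface: "1 \<le> c \<Longrightarrow> chart_dom c n \<subseteq> topspace (surface c)"
proof
  fix x assume "1 \<le> c" "x \<in> chart_dom c n"
  then obtain y where "x = proj c y" "upright y \<in> chart_zone c n" by (rule in_chart_domE)
  then show "x \<in> topspace (surface c)"
    unfolding topspace_surface using chart_zone_polygon topspace_polygons by blast
qed

lemma openin_surface_chart_dom:
  assumes c: "1 \<le> c"
  shows "openin (surface c) (chart_dom c n)"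
  unfolding openin_surface proj_in_chart_dom[OF c]
  using chart_dom_subset_surface[OF c] openin_zone_preimage[OF c] by simp

lemma proj_in_face:
  "proj 1 y \<in> face s \<longleftrightarrow> fst y = s \<and> upright y \<in> interior (polygon 1 Pos)"
proof
  assume "proj 1 y \<in> face s"
  then obtain z where z: "proj 1 z = proj 1 y" "fst z = s" "upright z \<in> interior (polygon 1 Pos)"
    unfolding face_def by blast
  then have "y = z" using glue_interior[of 1 z y] by (simp add: proj_eq_iff)
  with z show "fst y = s \<and> upright y \<in> interior (polygon 1 Pos)" by blast
qed (unfold face_def, blast)

lemma face_subset_chart_dom: "face s \<subseteq> chart_dom 1 n"
  by (auto simp: face_def proj_in_chart_dom chart_zone_def)

lemma openin_surface_face: "openin (surface 1) (face s)"
proof -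
  have "{y \<in> topspace (polygons 1). fst y = s} = {y \<in> topspace (polygons 1). (if fst y = s then 1 else (0::real)) \<in> {0<..}}"
    by auto
  also have "openin (polygons 1) \<dots>"
    using openin_continuous_map_preimage[OF continuous_map_polygonsI[of 1 "\<lambda>y. if fst y = s then 1 else (0::real)"], of "{0<..}"]
    by simp
  finally have "openin (polygons 1) ({y \<in> topspace (polygons 1). upright y \<in> interior (polygon 1 Pos)} \<inter>
      {y \<in> topspace (polygons 1). fst y = s})"
    by (intro openin_Int openin_upright open_interior)
  moreover have "face s \<subseteq> topspace (surface 1)"
    using face_subset_chart_dom[of s 0] chart_dom_subset_surface[of 1 0] by simp
  ultimately show ?thesis
    unfolding openin_surface proj_in_face by (simp add: Int_def conj_ac)
qed

lemma face_disjoint: "face Pos \<inter> face Neg = {}"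
proof -
  have False if x: "x \<in> face Pos" "x \<in> face Neg" for x
  proof -
    obtain y where "x = proj 1 y" using x unfolding face_def by blast
    with x show False unfolding \<open>x = proj 1 y\<close> proj_in_face by simp
  qed
  then show ?thesis by blast
qed

lemma chi_proj: "chi (proj 1 y) = (if fst y = Neg \<and> upright y \<in> interior (polygon 1 Pos) then 1 else 0)"
  by (simp add: chi_def proj_in_face)

text \<open>Open edges are pairwise disjoint, so different charts share only interior points of the
  polygons.\<close>

lemma chart_dom_Int:
  assumes "m \<noteq> n" "x \<in> chart_dom 1 m" "x \<in> chart_dom 1 n"
  obtains s where "x \<in> face s"
proof -
  obtain y where y: "x = proj 1 y" "upright y \<in> chart_zone 1 m"
    using in_chart_domE[OF order_refl assms(2)] by metis
  then have n: "upright y \<in> chart_zone 1 n" using assms(3) by (simp add: proj_in_chart_dom)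
  have "upright y \<in> interior (polygon 1 Pos)"
    using y(2) n open_edge_unique[of 1 "upright y" m n] open_closed_segment assms(1) order_refl
    unfolding chart_zone_def by blast
  then show ?thesis using that[of "fst y"] y by (simp add: proj_in_face)
qed

lemma chi_face: "x \<in> face s \<Longrightarrow> y \<in> face s \<Longrightarrow> chi x = chi y"
  using face_disjoint by (cases s) (auto simp: chi_def)

lemma singularities_eq: "singularities c = proj c ` {y. upright y \<in> range (vtx c)}"
proof -
  have "y = (fst y, vertex c (fst y) n)" if "upright y = vtx c n" for y n
    using that by (intro upright_inj) simp_all
  then show ?thesis
    unfolding singularities_def by (intro equalityI subsetI; clarsimp simp: image_iff) (metis upright_vertex fst_conv rangeI prod.collapse)+
qed

lemma topspace_punctured: "topspace (punctured_surface 1) = (\<Union>n. chart_dom 1 n)"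
proof -
  have sub: "topspace (punctured_surface 1) = topspace (surface 1) - singularities 1"
    by (auto simp: punctured_surface_def)
  show ?thesis
  proof (intro equalityI subsetI)
    fix x assume x: "x \<in> topspace (punctured_surface 1)"
    then obtain y where y: "x = proj 1 y" "y \<in> topspace (polygons 1)"
      unfolding sub topspace_surface by blast
    then have nv: "upright y \<notin> range (vtx 1)" using x unfolding sub singularities_eq by blast
    have "upright y \<in> polygon 1 Pos" using y topspace_polygons by blast
    with order_refl have "\<exists>n. upright y \<in> chart_zone 1 n"
      by (cases rule: polygon_cases) (use nv in \<open>auto simp: chart_zone_def\<close>)
    then show "x \<in> (\<Union>n. chart_dom 1 n)" by (auto simp: y proj_in_chart_dom)
  next
    fix x assume "x \<in> (\<Union>n. chart_dom 1 n)"
    then obtain n where n: "x \<in> chart_dom 1 n" by blast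
    then obtain y where y: "x = proj 1 y" "upright y \<in> chart_zone 1 n"      using in_chart_domE[OF order_refl n] by metis
    have "x \<notin> singularities 1"
    proof
      assume "x \<in> singularities 1"
      then obtain z where z: "upright z \<in> range (vtx 1)" "proj 1 z = proj 1 y"
        using y unfolding singularities_eq by blast
      then have "(z, y) \<in> glue 1" by (simp add: proj_eq_iff)
      then have "upright y \<in> range (vtx 1)" using glue_vertex[of 1 z y] z by simp
      then show False
        using y(2) vtx_not_interior[of 1] vtx_not_open_edge[of 1] by (auto simp: chart_zone_def)
    qed
    then show "x \<in> topspace (punctured_surface 1)"
      unfolding sub using n chart_dom_subset_surface[of 1] by auto
  qed
qed

lemma openin_punctured_iff:
  "openin (punctured_surface 1) U \<longleftrightarrow> openin (surface 1) U \<and> U \<subseteq> topspace (punctured_surface 1)"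
proof -
  have op: "openin (surface 1) (\<Union>n. chart_dom 1 n)"
    by (intro openin_Union) (auto intro: openin_surface_chart_dom)
  then have "punctured_surface 1 = subtopology (surface 1) (\<Union>n. chart_dom 1 n)"
    using topspace_punctured unfolding punctured_surface_def
    by (metis Diff_subset Int_absorb1 topspace_subtopology)
  then show ?thesis
    using openin_open_subtopology[OF op] topspace_punctured by simp
qed

lemma openin_chart_dom: "openin (punctured_surface 1) (chart_dom 1 n)"
  unfolding openin_punctured_iff topspace_punctured
  using openin_surface_chart_dom[of 1] by auto

lemma openin_face: "openin (punctured_surface 1) (face s)"
  unfolding openin_punctured_iff topspace_punctured
  using openin_surface_face face_subset_chart_dom by blast

section \<open>Charts after a canonical homeomorphism\<close>

context canonical_lift
begin

lemma H_open_edge_upright: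
  assumes "upright y \<in> open_edge 1 n"
  shows "upright (H y) \<in> open_edge c n"
proof -
  have ye: "upright y \<in> edge_seg 1 n" using assms open_closed_segment by blast
  have y: "y \<in> topspace (polygons 1)"
    using edge_seg_subset_polygon ye topspace_polygons by blast
  show ?thesis
  proof (cases "fst y")
    case Pos
    then have "y = (Pos, upright y)" by (cases y) simp
    then have "snd (H y) \<in> open_edge c n" using H_open_edge[OF assms] by simp
    then show ?thesis using fst_H[OF y] Pos by (simp add: upright_def)
  next
    case Neg
    let ?p = "edge_sum 1 n - upright y"
    have "y = (Neg, ?p - edge_sum 1 n)" using Neg by (cases y) simp
    then have "H y = (Neg, snd (H (Pos, ?p)) - edge_sum c n)"
      using H_edge_partner[OF edge_reflect[OF ye]] by simp
    then have "upright (H y) = edge_sum c n - snd (H (Pos, ?p))" by simp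
    then show ?thesis
      using open_edge_reflect[OF H_open_edge[OF open_edge_reflect[OF assms]]] by metis
  qed
qed

lemma H_chart_zone:
  assumes y: "y \<in> topspace (polygons 1)"
  shows "upright (H y) \<in> chart_zone c n \<longleftrightarrow> upright y \<in> chart_zone 1 n"
proof
  assume "upright y \<in> chart_zone 1 n"
  then show "upright (H y) \<in> chart_zone c n"
    using H_interior[OF y] H_open_edge_upright unfolding chart_zone_def by blast
next
  assume R: "upright (H y) \<in> chart_zone c n"
  have "upright y \<in> polygon 1 Pos" using y topspace_polygons by blast
  with order_refl show "upright y \<in> chart_zone 1 n"
  proof (cases rule: polygon_cases)
    case interior
    then show ?thesis by (simp add: chart_zone_def)
  next
    case (edge m)
    then have m: "upright (H y) \<in> open_edge c m" by (rule H_open_edge_upright)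
    then have "n = m"
      using R open_edge_not_interior[OF c m] open_edge_unique[OF c m, of n] open_closed_segment
      by (auto simp: chart_zone_def)
    then show ?thesis using edge by (simp add: chart_zone_def)
  next
    case (vertex m)
    then have "upright (H y) \<in> range (vtx c)" using H_vertex_iff[OF y] by blast
    then show ?thesis
      using R vtx_not_interior[OF c] vtx_not_open_edge[OF c] by (auto simp: chart_zone_def)
  qed
qed

lemma h_chart_dom:
  assumes "x \<in> topspace (surface 1)"
  shows "h x \<in> chart_dom c n \<longleftrightarrow> x \<in> chart_dom 1 n"
proof -
  obtain y where y: "y \<in> topspace (polygons 1)" "x = proj 1 y"
    using assms by (auto simp: topspace_surface)
  then show ?thesis
    by (simp add: h_proj proj_in_chart_dom c H_chart_zone)
qed

lemma chart_h_proj: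
  assumes "upright y \<in> chart_zone 1 n"
  shows "chart c n (h (proj 1 y)) = snd (H y) + shift c n (fst y)"
proof -
  have y: "y \<in> topspace (polygons 1)" using assms chart_zone_polygon topspace_polygons by blast
  then show ?thesis
    using assms by (simp add: h_proj chart_proj c H_chart_zone fst_H)
qed

text \<open>Chart \<open>m\<close> displaces the negative polygon by \<open>edge_sum c m\<close>.
  With this displacement removed, both sides are the position of the image point within its own
  polygon. This is why a crossing of edge \<open>m\<close> contributes \<open>edge_sum c m\<close>
  to the holonomy.\<close>

lemma chart_h_change:
  assumes "x \<in> chart_dom 1 m" "x \<in> chart_dom 1 n"
  shows "chart c m (h x) - chi x *\<^sub>R edge_sum c m = chart c n (h x) - chi x *\<^sub>R edge_sum c n"
proof (cases "m = n")
  case False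
  with assms obtain s where "x \<in> face s" using chart_dom_Int by blast
  then obtain y where y: "x = proj 1 y" "upright y \<in> interior (polygon 1 Pos)"
    by (auto simp: face_def)
  then have "upright y \<in> chart_zone 1 m" "upright y \<in> chart_zone 1 n" by (auto simp: chart_zone_def)
  then show ?thesis
    using y by (simp add: chart_h_proj chi_proj shift_def)
qed simp

lemma continuous_map_chart_h:
  "continuous_map (subtopology (surface 1) (chart_dom 1 n)) euclidean (\<lambda>x. chart c n (h x))"
  unfolding continuous_map_def
proof (intro conjI allI impI)
  fix V :: "(real \<times> real) set" assume "openin euclidean V"
  then have V: "open V" by simp
  let ?f = "\<lambda>y. snd (H y) + shift c n (fst y)"
  let ?S = "{x \<in> chart_dom 1 n. chart c n (h x) \<in> V}"
  have "continuous_map (polygons 1) euclidean ?f"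
    using continuous_map_compose[OF homeomorphic_imp_continuous_map[OF H] continuous_map_polygons_snd]
    by (intro continuous_map_add continuous_map_polygonsI[of 1 "\<lambda>y. shift c n (fst y)"]) (simp_all add: o_def)
  then have "openin (polygons 1) {y \<in> topspace (polygons 1). ?f y \<in> V}"
    using openin_continuous_map_preimage V by fastforce
  then have "openin (polygons 1) ({y \<in> topspace (polygons 1). upright y \<in> chart_zone 1 n} \<inter> {y \<in> topspace (polygons 1). ?f y \<in> V})"
    using openin_zone_preimage by (intro openin_Int) auto
  also have "\<dots> = {y \<in> topspace (polygons 1). proj 1 y \<in> ?S}"
    by (auto simp: proj_in_chart_dom chart_h_proj)
  finally have "openin (surface 1) ?S"
    unfolding openin_surface using chart_dom_subset_surface[of 1] by auto
  then have "openin (subtopology (surface 1) (chart_dom 1 n)) ?S"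
    using openin_open_subtopology[OF openin_surface_chart_dom[of 1]] by auto
  moreover have "{x \<in> topspace (subtopology (surface 1) (chart_dom 1 n)). chart c n (h x) \<in> V} = ?S"
    using chart_dom_subset_surface[of 1] by auto
  ultimately show "openin (subtopology (surface 1) (chart_dom 1 n))
      {x \<in> topspace (subtopology (surface 1) (chart_dom 1 n)). chart c n (h x) \<in> V}"
    by simp
qed simp

end

section \<open>Counting edge crossings along a path\<close>

text \<open>Proved by bisection. Through this lemma local information from single charts turns into
  statements about whole paths.\<close>

lemma locally_constant_on_interval:
  fixes F :: "real \<Rightarrow> 'a"
  assumes loc: "\<And>t. t \<in> {a..b} \<Longrightarrow> \<forall>\<^sub>F s in at t within {a..b}. F s = F t" and "a \<le> b"
  shows "F b = F a"
proof -
  have "a \<le> a \<and> b \<le> b \<longrightarrow> F b = F a"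
  proof (rule Bolzano[where P = "\<lambda>x y. a \<le> x \<and> y \<le> b \<longrightarrow> F y = F x", OF \<open>a \<le> b\<close>])
    fix x y z :: real
    assume "a \<le> x \<and> y \<le> b \<longrightarrow> F y = F x" "a \<le> y \<and> z \<le> b \<longrightarrow> F z = F y" "x \<le> y" "y \<le> z"
    then show "a \<le> x \<and> z \<le> b \<longrightarrow> F z = F x" by (metis order_trans)
  next
    fix x assume "a \<le> x" "x \<le> b"
    then obtain d where d: "0 < d" "\<And>s. s \<in> {a..b} \<Longrightarrow> s \<noteq> x \<Longrightarrow> dist s x < d \<Longrightarrow> F s = F x"
      using loc[of x] unfolding eventually_at by auto
    show "\<exists>d>0. \<forall>u v. u \<le> x \<and> x \<le> v \<and> v - u < d \<longrightarrow> a \<le> u \<and> v \<le> b \<longrightarrow> F v = F u"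
    proof (intro exI[of _ d] conjI allI impI)
      fix u v assume uv: "u \<le> x \<and> x \<le> v \<and> v - u < d" "a \<le> u \<and> v \<le> b"
      then show "F v = F u"
        using d(2)[of u] d(2)[of v] by (cases "u = x"; cases "v = x") (auto simp: dist_real_def)
    qed (rule d)
  qed
  then show ?thesis by simp
qed

lemma pathin_eventually:
  assumes g: "pathin X g" and U: "openin X U" and t: "t \<in> {0..1}" "g t \<in> U"
  shows "\<forall>\<^sub>F s in at t within {0..1}. g s \<in> U"
proof -
  have "openin (top_of_set {0..1}) {s \<in> {0..1}. g s \<in> U}"
    using openin_continuous_map_preimage[OF g[unfolded pathin_def] U] by simp
  then obtain T where T: "open T" "{s \<in> {0..1}. g s \<in> U} = {0..1} \<inter> T"
    by (auto simp: openin_open)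
  then have "t \<in> T" using t by blast
  then have "\<forall>\<^sub>F s in at t within {0..1}. s \<in> T"
    using T(1) eventually_at_topological by blast
  moreover have "\<forall>\<^sub>F s in at t within {0..1}. s \<in> {0..1}"
    by (simp add: eventually_at_filter)
  ultimately show ?thesis by eventually_elim (use T in blast)
qed

text \<open>A function \<open>D\<close> as below keeps track of the signed crossings of each edge, a passage from the
  positive to the negative polygon counting as \<open>1\<close>. The differences are independent of the chart
  because \<open>chi\<close> is locally constant where two charts overlap.\<close>

definition lifts :: "(real \<Rightarrow> point) \<Rightarrow> (real \<Rightarrow> int \<Rightarrow> real) \<Rightarrow> real set \<Rightarrow> bool" where
  "lifts g D S \<longleftrightarrow> (\<forall>t\<in>S. \<forall>n. g t \<in> chart_dom 1 n \<longrightarrow>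
     (\<forall>\<^sub>F s in at t within S. \<forall>m. D s m - D t m = (if m = n then chi (g s) - chi (g t) else 0)))"

lemma liftsD:
  "lifts g D S \<Longrightarrow> t \<in> S \<Longrightarrow> g t \<in> chart_dom 1 n \<Longrightarrow>
     \<forall>\<^sub>F s in at t within S. \<forall>m. D s m - D t m = (if m = n then chi (g s) - chi (g t) else 0)"
  by (simp add: lifts_def)

lemma lifts_subset: "lifts g D S \<Longrightarrow> T \<subseteq> S \<Longrightarrow> lifts g D T"
  unfolding lifts_def by (meson filter_leD at_le subsetD)

lemma lifts_cong:
  assumes "lifts g D S" "\<And>t. t \<in> S \<Longrightarrow> g t = g' t" "\<And>t. t \<in> S \<Longrightarrow> D t = D' t"
  shows "lifts g' D' S"
  unfolding lifts_def
proof (intro ballI allI impI)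
  fix t n assume t: "t \<in> S" "g' t \<in> chart_dom 1 n"
  then have "\<forall>\<^sub>F s in at t within S. \<forall>m. D s m - D t m = (if m = n then chi (g s) - chi (g t) else 0)"
    using assms by (simp add: lifts_def)
  moreover have "\<forall>\<^sub>F s in at t within S. s \<in> S" by (simp add: eventually_at_filter)
  ultimately show "\<forall>\<^sub>F s in at t within S. \<forall>m. D' s m - D' t m = (if m = n then chi (g' s) - chi (g' t) else 0)"
    by eventually_elim (use assms(2,3) t in auto)
qed

lemma chi_eventually_const:
  assumes g: "pathin (punctured_surface 1) g" and t: "t \<in> {0..1}"
    and mn: "m \<noteq> n" "g t \<in> chart_dom 1 m" "g t \<in> chart_dom 1 n"
  shows "\<forall>\<^sub>F s in at t within {0..1}. chi (g s) = chi (g t)"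
proof -
  obtain s where s: "g t \<in> face s" using chart_dom_Int[OF mn] by blast
  from pathin_eventually[OF g openin_face t s] show ?thesis
    by eventually_elim (use chi_face s in blast)
qed

lemma path_in_chart:
  assumes g: "pathin (punctured_surface 1) g" and t: "t \<in> {0..1}"
  obtains n where "g t \<in> chart_dom 1 n"
proof -
  have "g t \<in> topspace (punctured_surface 1)"
    using g t unfolding pathin_def continuous_map_def by auto
  then show ?thesis using that unfolding topspace_punctured by blast
qed

text \<open>Inside chart \<open>n\<close> all crossings belong to edge \<open>n\<close>. At a time
  when the path is also in another chart it is in a face, where \<open>chi\<close> does not change,
  so the conditions from both charts agree.\<close>

lemma lifts_in_chart:
  assumes g: "pathin (punctured_surface 1) g" and S: "S \<subseteq> {0..1}" "\<And>t. t \<in> S \<Longrightarrow> g t \<in> chart_dom 1 n"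
  shows "lifts g (\<lambda>t m. if m = n then chi (g t) else 0) S"
  unfolding lifts_def
proof (intro ballI allI impI)
  fix t k assume t: "t \<in> S" "g t \<in> chart_dom 1 k"
  show "\<forall>\<^sub>F s in at t within S. \<forall>m. (if m = n then chi (g s) else 0) - (if m = n then chi (g t) else 0) =
      (if m = k then chi (g s) - chi (g t) else 0)"
  proof (cases "k = n")
    case False
    have "\<forall>\<^sub>F s in at t within {0..1}. chi (g s) = chi (g t)"
      by (rule chi_eventually_const[OF g _ False]) (use S t in auto)
    then have "\<forall>\<^sub>F s in at t within S. chi (g s) = chi (g t)"
      by (rule filter_leD[OF at_le[OF S(1)]])
    then show ?thesis by eventually_elim auto
  qed auto
qed

lemma lifts_unique:
  assumes g: "pathin (punctured_surface 1) g" and ab: "{a..b} \<subseteq> {0..1}" "a \<le> b"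
    and D: "lifts g D {a..b}" and D': "lifts g D' {a..b}"
  shows "D b m - D a m = D' b m - D' a m"
proof -
  have "D b m - D' b m = D a m - D' a m"
  proof (rule locally_constant_on_interval[OF _ ab(2), of "\<lambda>t. D t m - D' t m"])
    fix t assume t: "t \<in> {a..b}"
    then obtain n where n: "g t \<in> chart_dom 1 n" using path_in_chart[OF g] ab by blast
    from liftsD[OF D t n] liftsD[OF D' t n]
    show "\<forall>\<^sub>F s in at t within {a..b}. D s m - D' s m = D t m - D' t m"
    proof eventually_elim
      case (elim s)
      then have "D s m - D t m = D' s m - D' t m" by metis
      then show ?case by linarith
    qed
  qed
  then show ?thesis by linarith
qed

lemma lifts_increment_chart:
  assumes g: "pathin (punctured_surface 1) g" and ab: "{a..b} \<subseteq> {0..1}" "a \<le> b"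
    and D: "lifts g D {0..1}" and n: "\<And>t. t \<in> {a..b} \<Longrightarrow> g t \<in> chart_dom 1 n"
  shows "D b m - D a m = (if m = n then chi (g b) - chi (g a) else 0)"
  using lifts_unique[OF g ab lifts_subset[OF D ab(1)] lifts_in_chart[OF g ab(1) n]] by simp

lemma eventually_at_within_interval_split:
  fixes a b c t :: real
  assumes "a \<le> b" "b \<le> c" "t \<in> {a..c}"
    and "t \<in> {a..b} \<Longrightarrow> \<forall>\<^sub>F s in at t within {a..b}. P s"
    and "t \<in> {b..c} \<Longrightarrow> \<forall>\<^sub>F s in at t within {b..c}. P s"
  shows "\<forall>\<^sub>F s in at t within {a..c}. P s"
proof -
  have *: "\<forall>\<^sub>F s in at t within T. P s" if "closed T" "t \<notin> T" for T
  proof -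
    have "at t within T = bot" using that by (metis closed_limpt trivial_limit_within)
    then show ?thesis by simp
  qed
  have "{a..c} = {a..b} \<union> {b..c}" using assms(1,2) by auto
  then have "at t within {a..c} = sup (at t within {a..b}) (at t within {b..c})"
    by (simp add: at_within_union)
  moreover have "eventually P (at t within {a..b})" using assms(4) *[of "{a..b}"] by blast
  moreover have "eventually P (at t within {b..c})" using assms(5) *[of "{b..c}"] by blast
  ultimately show ?thesis by (simp add: eventually_sup)
qed

lemma lifts_append:
  assumes D: "lifts g D {a..b}" and E: "lifts g E {b..c}" and ab: "a \<le> b" "b \<le> c"
  shows "lifts g (\<lambda>t m. if t \<le> b then D t m else E t m - E b m + D b m) {a..c}" (is "lifts g ?F _")
proof -
  have F1: "lifts g ?F {a..b}" by (rule lifts_cong[OF D]) auto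
  have F2: "lifts g ?F {b..c}"
  proof (rule lifts_cong[where g = g and D = "\<lambda>t m. E t m - E b m + D b m"])
    show "lifts g (\<lambda>t m. E t m - E b m + D b m) {b..c}" using E by (simp add: lifts_def)
  qed (auto intro!: ext)
  show ?thesis
    unfolding lifts_def
  proof (intro ballI allI impI)
    fix t n assume t: "t \<in> {a..c}" and n: "g t \<in> chart_dom 1 n"
    show "\<forall>\<^sub>F s in at t within {a..c}. \<forall>m. ?F s m - ?F t m = (if m = n then chi (g s) - chi (g t) else 0)"
      by (rule eventually_at_within_interval_split[OF ab t liftsD[OF F1 _ n] liftsD[OF F2 _ n]])
  qed
qed

text \<open>On a piece inside chart \<open>n\<close> only the count of edge \<open>n\<close> varies,
  and bisection reduces the path to finitely many such pieces. Hence the finite set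
  \<open>M\<close>, even if some edge is met infinitely often.\<close>

lemma lifts_exist:
  assumes g: "pathin (punctured_surface 1) g"
  shows "\<exists>D M. lifts g D {0..1} \<and> finite M \<and> (\<forall>t\<in>{0..1}. \<forall>m. m \<notin> M \<longrightarrow> D t m = D 0 m)"
proof -
  have "0 \<le> (0::real) \<and> (1::real) \<le> 1 \<longrightarrow>
     (\<exists>D M. lifts g D {0..1} \<and> finite M \<and> (\<forall>t\<in>{0..1}. \<forall>m. m \<notin> M \<longrightarrow> D t m = D 0 m))"
  proof (rule Bolzano[where P = "\<lambda>a b. 0 \<le> a \<and> b \<le> 1 \<longrightarrow>
     (\<exists>D M. lifts g D {a..b} \<and> finite M \<and> (\<forall>t\<in>{a..b}. \<forall>m. m \<notin> M \<longrightarrow> D t m = D a m))", OF zero_le_one], goal_cases)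
    case (1 a b c)
    show ?case
    proof
      assume "0 \<le> a \<and> c \<le> 1"
      then have "0 \<le> a \<and> b \<le> 1" "0 \<le> b \<and> c \<le> 1" using 1(3,4) by auto
      then obtain D M E N where
        D: "lifts g D {a..b}" "finite M" "\<forall>t\<in>{a..b}. \<forall>m. m \<notin> M \<longrightarrow> D t m = D a m" and
        E: "lifts g E {b..c}" "finite N" "\<forall>t\<in>{b..c}. \<forall>m. m \<notin> N \<longrightarrow> E t m = E b m"
        using 1(1,2) by blast
      let ?F = "\<lambda>t m. if t \<le> b then D t m else E t m - E b m + D b m"
      have "lifts g ?F {a..c}" by (rule lifts_append[OF D(1) E(1) 1(3,4)])
      moreover have "\<forall>t\<in>{a..c}. \<forall>m. m \<notin> M \<union> N \<longrightarrow> ?F t m = ?F a m"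
      proof (intro ballI allI impI)
        fix t m assume t: "t \<in> {a..c}" and m: "m \<notin> M \<union> N"
        show "?F t m = ?F a m"
        proof (cases "t \<le> b")
          case True
          then have "t \<in> {a..b}" using t by simp
          then have "D t m = D a m" using D(3) m by blast
          then show ?thesis using True 1(3) by simp
        next
          case False
          then have "t \<in> {b..c}" "b \<in> {a..b}" using t 1(3) by simp_all
          then have "E t m = E b m" "D b m = D a m" using E(3) D(3) m by blast+
          moreover note False
          ultimately show ?thesis using False 1(3) by simp
        qed
      qed
      ultimately show "\<exists>D M. lifts g D {a..c} \<and> finite M \<and> (\<forall>t\<in>{a..c}. \<forall>m. m \<notin> M \<longrightarrow> D t m = D a m)"
        using D(2) E(2) by (intro exI[of _ ?F] exI[of _ "M \<union> N"] conjI finite_UnI)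
    qed
  next
    case (2 x)
    then have x: "x \<in> {0..1}" by simp
    obtain n where n: "g x \<in> chart_dom 1 n" using path_in_chart[OF g x] .
    then obtain d where d: "0 < d" "\<And>s. s \<in> {0..1} \<Longrightarrow> dist s x < d \<Longrightarrow> g s \<in> chart_dom 1 n"
      using pathin_eventually[OF g openin_chart_dom x n] unfolding eventually_at by metis
    show ?case
    proof (rule exI[of _ d], intro conjI allI impI)
      fix u v assume uv: "u \<le> x \<and> x \<le> v \<and> v - u < d" "0 \<le> u \<and> v \<le> 1"
      then have "lifts g (\<lambda>t m. if m = n then chi (g t) else 0) {u..v}"
        by (intro lifts_in_chart[OF g] d(2)) (auto simp: dist_real_def)
      then show "\<exists>D M. lifts g D {u..v} \<and> finite M \<and> (\<forall>t\<in>{u..v}. \<forall>m. m \<notin> M \<longrightarrow> D t m = D u m)"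
        by (intro exI[of _ "\<lambda>t m. if m = n then chi (g t) else 0"] exI[of _ "{n}"]) simp
    qed (rule d)
  qed
  then show ?thesis by simp
qed

text \<open>The normalization at time 0 and the finiteness are part of the choice, so that sums over
  all edges become sums over \<open>support g\<close>.\<close>

definition lift :: "(real \<Rightarrow> point) \<Rightarrow> real \<Rightarrow> int \<Rightarrow> real" where
  "lift g = (SOME D. lifts g D {0..1} \<and> D 0 = (\<lambda>_. 0) \<and> finite {m. \<exists>t\<in>{0..1}. D t m \<noteq> 0})"

definition support :: "(real \<Rightarrow> point) \<Rightarrow> int set" where
  "support g = {m. \<exists>t\<in>{0..1}. lift g t m \<noteq> 0}"

text \<open>For a closed path these are the numbers of signed crossings in the overview.\<close>

definition turns :: "(real \<Rightarrow> point) \<Rightarrow> int \<Rightarrow> real" where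
  "turns g = lift g 1"

lemma lift:
  assumes g: "pathin (punctured_surface 1) g"
  shows lifts_lift: "lifts g (lift g) {0..1}" and lift_0: "lift g 0 m = 0" and finite_support: "finite (support g)"
proof -
  obtain D M where D: "lifts g D {0..1}" "finite M" "\<forall>t\<in>{0..1}. \<forall>m. m \<notin> M \<longrightarrow> D t m = D 0 m"
    using lifts_exist[OF g] by blast
  let ?D = "\<lambda>t m. D t m - D 0 m"
  have "lifts g ?D {0..1}" using D(1) by (simp add: lifts_def)
  moreover have "{m. \<exists>t\<in>{0..1}. ?D t m \<noteq> 0} \<subseteq> M"
  proof
    fix m assume "m \<in> {m. \<exists>t\<in>{0..1}. ?D t m \<noteq> 0}"
    then obtain t where "t \<in> {0..1}" "D t m \<noteq> D 0 m" by auto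
    with D(3) show "m \<in> M" by blast
  qed
  then have "finite {m. \<exists>t\<in>{0..1}. ?D t m \<noteq> 0}" using D(2) finite_subset by blast
  ultimately have "\<exists>D. lifts g D {0..1} \<and> D 0 = (\<lambda>_. 0) \<and> finite {m. \<exists>t\<in>{0..1}. D t m \<noteq> 0}"
    by (intro exI[of _ ?D]) auto
  from someI_ex[OF this]
  have "lifts g (lift g) {0..1} \<and> lift g 0 = (\<lambda>_. 0) \<and> finite (support g)"
    unfolding lift_def[symmetric] support_def .
  then show "lifts g (lift g) {0..1}" "lift g 0 m = 0" "finite (support g)" by auto
qed

lemma turns_unique:
  assumes g: "pathin (punctured_surface 1) g" and D: "lifts g D {0..1}"
  shows "turns g m = D 1 m - D 0 m"
  using lifts_unique[OF g _ _ lifts_lift[OF g] D, of m] lift_0[OF g] by (simp add: turns_def)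

lemma turns_support: "m \<notin> support g \<Longrightarrow> turns g m = 0"
  by (auto simp: support_def turns_def)

text \<open>Used with \<open>v = edge_sum c\<close> for the holonomy and with the constant 1 for the
  total number of crossings.\<close>

lemma lift_sum:
  fixes v :: "int \<Rightarrow> 'v::real_vector"
  assumes g: "pathin (punctured_surface 1) g" and t: "t \<in> {0..1}" and n: "g t \<in> chart_dom 1 n"
    and M: "finite M" "support g \<subseteq> M"
  shows "\<forall>\<^sub>F s in at t within {0..1}.
    (\<Sum>m\<in>M. lift g s m *\<^sub>R v m) - (\<Sum>m\<in>M. lift g t m *\<^sub>R v m) = (chi (g s) - chi (g t)) *\<^sub>R v n"
proof -
  have "\<forall>\<^sub>F s in at t within {0..1}. s \<in> {0..1}" by (simp add: eventually_at_filter)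
  with liftsD[OF lifts_lift[OF g] t n] show ?thesis
  proof eventually_elim
    case (elim s)
    have "(\<Sum>m\<in>M. lift g s m *\<^sub>R v m) - (\<Sum>m\<in>M. lift g t m *\<^sub>R v m) =
        (\<Sum>m\<in>M. (lift g s m - lift g t m) *\<^sub>R v m)"
      by (simp add: sum_subtractf scaleR_diff_left)
    also have "\<dots> = (\<Sum>m\<in>M. if m = n then (chi (g s) - chi (g t)) *\<^sub>R v n else 0)"
      using elim(1) by (intro sum.cong) auto
    also have "\<dots> = (if n \<in> M then (chi (g s) - chi (g t)) *\<^sub>R v n else 0)"
      using M(1) by simp
    also have "\<dots> = (chi (g s) - chi (g t)) *\<^sub>R v n"
    \<comment> \<open>For \<open>n\<close> outside \<open>M\<close> the count of edge
      \<open>n\<close> stays 0, so \<open>chi\<close> does not change and both sides vanish.\<close>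
    proof (cases "n \<in> M")
      case False
      then have "lift g s n = 0" "lift g t n = 0" using M(2) elim(2) t unfolding support_def by blast+
      then have "chi (g s) - chi (g t) = 0" using elim(1) by (metis diff_self)
      then show ?thesis by simp
    qed simp
    finally show ?case .
  qed
qed

text \<open>Entering the negative polygon raises both the total count and \<open>chi\<close> by 1,
  whichever edge is used. Their difference is constant, and \<open>chi\<close> returns to its value
  along a closed path.\<close>

lemma sum_turns_closed:
  assumes g: "pathin (punctured_surface 1) g" and closed: "g 1 = g 0" and M: "finite M" "support g \<subseteq> M"
  shows "(\<Sum>m\<in>M. turns g m) = 0"
proof -
  have "(\<Sum>m\<in>M. lift g 1 m *\<^sub>R (1::real)) - chi (g 1) = (\<Sum>m\<in>M. lift g 0 m *\<^sub>R (1::real)) - chi (g 0)"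
  proof (rule locally_constant_on_interval[of 0 1 "\<lambda>t. (\<Sum>m\<in>M. lift g t m *\<^sub>R (1::real)) - chi (g t)"])
    fix t :: real assume t: "t \<in> {0..1}"
    then obtain n where n: "g t \<in> chart_dom 1 n" using path_in_chart[OF g] by blast
    from lift_sum[OF g t n M, of "\<lambda>_. 1::real"]
    show "\<forall>\<^sub>F s in at t within {0..1}. (\<Sum>m\<in>M. lift g s m *\<^sub>R (1::real)) - chi (g s) =
        (\<Sum>m\<in>M. lift g t m *\<^sub>R (1::real)) - chi (g t)"
      by eventually_elim simp
  qed simp
  then show ?thesis by (simp add: closed lift_0[OF g] turns_def)
qed

lemma lifts_reparametrize:
  assumes D: "lifts g D {0..1}" and p: "continuous_on {0..1} p" "p ` {0..1} \<subseteq> {0..1::real}"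
  shows "lifts (\<lambda>t. g (p t)) (\<lambda>t. D (p t)) {0..1}"
  unfolding lifts_def
proof (intro ballI allI impI)
  fix t :: real and n assume t: "t \<in> {0..1}" "g (p t) \<in> chart_dom 1 n"
  let ?R = "\<lambda>s. \<forall>m. D s m - D (p t) m = (if m = n then chi (g s) - chi (g (p t)) else 0)"
  have pt: "p t \<in> {0..1}" using p t by blast
  obtain d where d: "0 < d" "\<And>s. s \<in> {0..1} \<Longrightarrow> s \<noteq> p t \<Longrightarrow> dist s (p t) < d \<Longrightarrow> ?R s"
    using liftsD[OF D pt t(2)] unfolding eventually_at by metis
  have R: "?R s" if "s \<in> {0..1}" "dist s (p t) < d" for s
    using d(2)[OF that(1) _ that(2)] by (cases "s = p t") auto
  have "\<forall>\<^sub>F s in at t within {0..1}. dist (p s) (p t) < d"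
    using p(1) t(1) d(1) by (simp add: continuous_on_def tendsto_iff)
  moreover have "\<forall>\<^sub>F s in at t within {0..1}. s \<in> {0..1}" by (simp add: eventually_at_filter)
  ultimately show "\<forall>\<^sub>F s in at t within {0..1}. ?R (p s)"
    by eventually_elim (use R p(2) in blast)
qed

lemma turns_concat:
  assumes f: "pathin (punctured_surface 1) f" and g: "pathin (punctured_surface 1) g"
    and fg: "pathin (punctured_surface 1) (concat_paths f g)" and "f 1 = g 0"
  shows "turns (concat_paths f g) m = turns f m + turns g m"
proof -
  define D where "D = lift (concat_paths f g)"
  have D: "lifts (concat_paths f g) D {0..1}" "D 0 m = 0"
    using lifts_lift[OF fg] lift_0[OF fg] by (auto simp: D_def)
  have "lifts f (\<lambda>t. D (t / 2)) {0..1}"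
    by (rule lifts_cong[OF lifts_reparametrize[OF D(1), of "\<lambda>t. t / 2"]])
       (auto intro!: continuous_intros simp: concat_paths_def)
  from turns_unique[OF f this] have "turns f m = D (1/2) m" using D(2) by simp
  moreover have "lifts g (\<lambda>t. D ((t + 1) / 2)) {0..1}"
    by (rule lifts_cong[OF lifts_reparametrize[OF D(1), of "\<lambda>t. (t + 1) / 2"]])
       (use \<open>f 1 = g 0\<close> in \<open>auto intro!: continuous_intros simp: concat_paths_def field_simps\<close>)
  from turns_unique[OF g this] have "turns g m = D 1 m - D (1/2) m" by simp
  ultimately show ?thesis by (simp add: turns_def D_def)
qed

text \<open>The increments of the counts around the boundary of a small rectangle in the parameter square
  of the homotopy vanish, since its image lies in one chart. Two bisections, first in the path
  parameter and then in the homotopy parameter, extend this to the whole square.\<close>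

lemma turns_free_homotopy:
  assumes "freely_homotopic (punctured_surface 1) f g"
  shows "turns f m = turns g m"
proof -
  let ?X = "punctured_surface 1"
  obtain G :: "real \<times> real \<Rightarrow> point" where
    G: "continuous_map (prod_topology (top_of_set {0..1}) (top_of_set {0..1})) ?X G"
    "\<And>t. G (0, t) = f t" "\<And>t. G (1, t) = g t" "\<And>s. s \<in> {0..1} \<Longrightarrow> G (s, 1) = G (s, 0)"
    using assms unfolding freely_homotopic_def homotopic_with_def by blast
  have cG: "continuous_map (top_of_set ({0..1} \<times> {0..1})) ?X G"
    using G(1) by (simp add: prod_topology_subtopology_eu)
  have row: "pathin ?X (\<lambda>t. G (s, t))" if "s \<in> {0..1}" for s
    unfolding pathin_def using continuous_map_o_Pair[OF G(1), of s] that by (simp add: o_def)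
  have col: "pathin ?X (\<lambda>s. G (s, t))" if "t \<in> {0..1}" for t
  proof -
    have "continuous_map (top_of_set {0..1}) (prod_topology (top_of_set {0..1}) (top_of_set {0..1})) (\<lambda>s. (s, t))"
      using that by (intro continuous_map_pairedI) auto
    from continuous_map_compose[OF this G(1)] show ?thesis unfolding pathin_def by (simp only: o_def)
  qed
  define R where "R s = lift (\<lambda>t. G (s, t))" for s
  define C where "C t = lift (\<lambda>s. G (s, t))" for t
  \<comment> \<open>The signed sum of the increments along the four sides of a rectangle; it is
    additive under subdivision in either direction, since inner sides cancel.\<close>
  define rect where "rect s1 s2 t1 t2 = (R s1 t2 m - R s1 t1 m) + (C t2 s2 m - C t2 s1 m)
      - (R s2 t2 m - R s2 t1 m) - (C t1 s2 m - C t1 s1 m)" for s1 s2 t1 t2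
  have R: "lifts (\<lambda>t. G (s, t)) (R s) {0..1}" if "s \<in> {0..1}" for s
    using lifts_lift[OF row[OF that]] by (simp add: R_def)
  have C: "lifts (\<lambda>s. G (s, t)) (C t) {0..1}" if "t \<in> {0..1}" for t
    using lifts_lift[OF col[OF that]] by (simp add: C_def)
  have chart_rect: "rect s1 s2 t1 t2 = 0"
    if st: "0 \<le> s1" "s1 \<le> s2" "s2 \<le> 1" "0 \<le> t1" "t1 \<le> t2" "t2 \<le> 1"
      and n: "\<And>s t. s \<in> {s1..s2} \<Longrightarrow> t \<in> {t1..t2} \<Longrightarrow> G (s, t) \<in> chart_dom 1 n" for s1 s2 t1 t2 n
  proof -
    have r: "R s t2 m - R s t1 m = (if m = n then chi (G (s, t2)) - chi (G (s, t1)) else 0)"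
      if "s \<in> {s1..s2}" for s
      using st n that by (intro lifts_increment_chart[OF row _ _ R]) auto
    have c: "C t s2 m - C t s1 m = (if m = n then chi (G (s2, t)) - chi (G (s1, t)) else 0)"
      if "t \<in> {t1..t2}" for t
      using st n that by (intro lifts_increment_chart[OF col _ _ C]) auto
    show ?thesis using r[of s1] r[of s2] c[of t1] c[of t2] st by (simp add: rect_def)
  qed
  \<comment> \<open>The width \<open>d\<close> around \<open>s0\<close> may shrink as pieces in the
    path parameter are joined, but the bisection joins two pieces at a time and
    \<open>min d e\<close> stays positive.\<close>
  have strip: "\<exists>d>0. \<forall>s1 s2. 0 \<le> s1 \<and> s1 \<le> s2 \<and> s2 \<le> 1 \<and> dist s1 s0 < d \<and> dist s2 s0 < d \<longrightarrow> rect s1 s2 0 1 = 0"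
    if s0: "s0 \<in> {0..1}" for s0
  proof -
    have "0 \<le> (0::real) \<and> (1::real) \<le> 1 \<longrightarrow> (\<exists>d>0. \<forall>s1 s2. 0 \<le> s1 \<and> s1 \<le> s2 \<and> s2 \<le> 1 \<and>
        dist s1 s0 < d \<and> dist s2 s0 < d \<longrightarrow> rect s1 s2 0 1 = 0)"
    proof (rule Bolzano[where P = "\<lambda>a b. 0 \<le> a \<and> b \<le> 1 \<longrightarrow> (\<exists>d>0. \<forall>s1 s2. 0 \<le> s1 \<and> s1 \<le> s2 \<and> s2 \<le> 1 \<and>
        dist s1 s0 < d \<and> dist s2 s0 < d \<longrightarrow> rect s1 s2 a b = 0)", OF zero_le_one], goal_cases)
      case (1 a b c)
      show ?case
      proof
        assume "0 \<le> a \<and> c \<le> 1"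
        then have "0 \<le> a \<and> b \<le> 1" "0 \<le> b \<and> c \<le> 1" using 1(3,4) by auto
        then obtain d e where
          d: "0 < d" "\<And>s1 s2. 0 \<le> s1 \<and> s1 \<le> s2 \<and> s2 \<le> 1 \<and> dist s1 s0 < d \<and> dist s2 s0 < d \<Longrightarrow> rect s1 s2 a b = 0" and
          e: "0 < e" "\<And>s1 s2. 0 \<le> s1 \<and> s1 \<le> s2 \<and> s2 \<le> 1 \<and> dist s1 s0 < e \<and> dist s2 s0 < e \<Longrightarrow> rect s1 s2 b c = 0"
          using 1(1,2) by blast
        have add: "rect s1 s2 a c = rect s1 s2 a b + rect s1 s2 b c" for s1 s2
          by (simp add: rect_def)
        show "\<exists>d>0. \<forall>s1 s2. 0 \<le> s1 \<and> s1 \<le> s2 \<and> s2 \<le> 1 \<and> dist s1 s0 < d \<and> dist s2 s0 < d \<longrightarrow> rect s1 s2 a c = 0"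
          using d e by (intro exI[of _ "min d e"]) (simp add: add)
      qed
    next
      case (2 x)
      then have x: "x \<in> {0..1}" by simp
      obtain n where n: "G (s0, x) \<in> chart_dom 1 n" using path_in_chart[OF row[OF s0] x] .
      define Z where "Z = {z \<in> {0..1} \<times> {0..1}. G z \<in> chart_dom 1 n}"
      have "openin (top_of_set ({0..1} \<times> {0..1})) Z"
        unfolding Z_def using openin_continuous_map_preimage[OF cG openin_chart_dom] by simp
      then have "\<forall>y\<in>Z. \<exists>e>0. \<forall>z\<in>{0..1} \<times> {0..1}. dist z y < e \<longrightarrow> z \<in> Z"
        unfolding openin_euclidean_subtopology_iff by blast
      moreover have "(s0, x) \<in> Z" using n s0 x by (simp add: Z_def)
      ultimately obtain e where e: "0 < e" "\<And>z. z \<in> {0..1} \<times> {0..1} \<Longrightarrow> dist z (s0, x) < e \<Longrightarrow> z \<in> Z"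
        by meson
      have near: "G (s, t) \<in> chart_dom 1 n"
        if "s \<in> {0..1}" "t \<in> {0..1}" "dist s s0 < e / 2" "dist t x < e / 2" for s t
      proof -
        have "dist (s, t) (s0, x) < e"
          using that(3,4) sqrt_sum_squares_le_sum_abs[of "dist s s0" "dist t x"] by (simp add: dist_Pair_Pair)
        then have "(s, t) \<in> Z" using that(1,2) by (intro e(2)) simp_all
        then show ?thesis by (simp add: Z_def)
      qed
      show ?case
      proof (rule exI[of _ "e / 2"], intro conjI allI impI)
        fix u v assume uv: "u \<le> x \<and> x \<le> v \<and> v - u < e / 2" "0 \<le> u \<and> v \<le> 1"
        show "\<exists>d>0. \<forall>s1 s2. 0 \<le> s1 \<and> s1 \<le> s2 \<and> s2 \<le> 1 \<and> dist s1 s0 < d \<and> dist s2 s0 < d \<longrightarrow> rect s1 s2 u v = 0"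
        proof (rule exI[of _ "e / 2"], intro conjI allI impI)
          fix s1 s2 assume s: "0 \<le> s1 \<and> s1 \<le> s2 \<and> s2 \<le> 1 \<and> dist s1 s0 < e / 2 \<and> dist s2 s0 < e / 2"
          show "rect s1 s2 u v = 0"
          proof (rule chart_rect)
            fix s t assume "s \<in> {s1..s2}" "t \<in> {u..v}"
            then show "G (s, t) \<in> chart_dom 1 n"
              using s uv unfolding dist_real_def atLeastAtMost_iff
              by (intro near; simp only: dist_real_def atLeastAtMost_iff; linarith)
          qed (use s uv in auto)
        qed (use e in simp)
      qed (use e in simp)
    qed
    then show ?thesis by simp
  qed
  have "0 \<le> (0::real) \<and> (1::real) \<le> 1 \<longrightarrow> rect 0 1 0 1 = 0"
  proof (rule Bolzano[where P = "\<lambda>a b. 0 \<le> a \<and> b \<le> 1 \<longrightarrow> rect a b 0 1 = 0", OF zero_le_one], goal_cases)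
    case (1 a b c)
    have "rect a c 0 1 = rect a b 0 1 + rect b c 0 1" by (simp add: rect_def)
    then show ?case using 1 by auto
  next
    case (2 x)
    then obtain d where d: "0 < d" "\<forall>s1 s2. 0 \<le> s1 \<and> s1 \<le> s2 \<and> s2 \<le> 1 \<and> dist s1 x < d \<and> dist s2 x < d \<longrightarrow> rect s1 s2 0 1 = 0"
      using strip[of x] by auto
    then show ?case by (intro exI[of _ d]) (auto simp: dist_real_def)
  qed
  then have "rect 0 1 0 1 = 0" by simp
  \<comment> \<open>The homotopy is free, so the sides at path parameters 0 and 1 are the same path
    and their increments cancel.\<close>
  moreover have "lifts (\<lambda>s. G (s, 1)) (C 0) {0..1}"
    by (rule lifts_cong[OF C]) (auto simp: G(4))
  then have "C 1 1 m - C 1 0 m = C 0 1 m - C 0 0 m"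
    using lifts_unique[OF col _ _ C] by simp
  ultimately have "R 0 1 m - R 0 0 m = R 1 1 m - R 1 0 m"
    by (simp add: rect_def)
  then show ?thesis
    using lift_0[OF row[of 0]] lift_0[OF row[of 1]] by (simp add: R_def turns_def G(2,3))
qed

section \<open>The abelianized fundamental group\<close>

definition path_homotopic :: "'a topology \<Rightarrow> 'a \<Rightarrow> 'a \<Rightarrow> (real \<Rightarrow> 'a) \<Rightarrow> (real \<Rightarrow> 'a) \<Rightarrow> bool" where
  "path_homotopic X x y = homotopic_with (\<lambda>r. r 0 = x \<and> r 1 = y) (top_of_set {0..1}) X"

lemma path_homotopic_sym: "path_homotopic X x y f g \<Longrightarrow> path_homotopic X x y g f"
  unfolding path_homotopic_def by (rule homotopic_with_symD)

lemma path_homotopic_trans: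
  "path_homotopic X x y f g \<Longrightarrow> path_homotopic X x y g h \<Longrightarrow> path_homotopic X x y f h"
  unfolding path_homotopic_def by (rule homotopic_with_trans)

lemma path_homotopic_imp:
  assumes "path_homotopic X x y f g"
  shows "pathin X f" "pathin X g" "f 0 = x" "f 1 = y" "g 0 = x" "g 1 = y"
  using assms homotopic_with_imp_continuous_maps homotopic_with_imp_property
  unfolding path_homotopic_def pathin_def by blast+

lemma path_homotopic_eq:
  assumes "pathin X f" "\<And>t. t \<in> {0..1} \<Longrightarrow> f t = g t" "f 0 = x" "f 1 = y"
  shows "path_homotopic X x y f g"
  unfolding path_homotopic_def using assms
  by (intro homotopic_with_equal) (auto simp: pathin_def)

lemma pathin_reparametrize:
  assumes f: "pathin X f" and p: "continuous_on {0..1} p" "p ` {0..1} \<subseteq> {0..1::real}"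
  shows "pathin X (\<lambda>t. f (p t))"
proof -
  have "continuous_map (top_of_set {0..1}) (top_of_set {0..1}) p" using p by auto
  from continuous_map_compose[OF this f[unfolded pathin_def]] show ?thesis
    by (simp add: pathin_def o_def)
qed

lemma convex_reparametrization:
  fixes p q :: "real \<Rightarrow> real"
  assumes p: "continuous_on {0..1} p" "p ` {0..1} \<subseteq> {0..1::real}"
    and q: "continuous_on {0..1} q" "q ` {0..1} \<subseteq> {0..1::real}"
  shows "continuous_map (prod_topology (top_of_set {0..1}) (top_of_set {0..1})) (top_of_set {0..1})
    (\<lambda>z. (1 - fst z) * p (snd z) + fst z * q (snd z))"
proof -
  have "continuous_on ({0..1} \<times> {0..1}) (\<lambda>z. (1 - fst z) * p (snd z) + fst z * q (snd z))"
    by (intro continuous_intros continuous_on_compose2[OF p(1)] continuous_on_compose2[OF q(1)]) auto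
  moreover have "(1 - s) * p t + s * q t \<in> {0..1}" if "s \<in> {0..1}" "t \<in> {0..1}" for s t
  proof -
    have "p t \<in> {0..1}" "q t \<in> {0..1}" using p q that by blast+
    then show ?thesis using convexD_alt[of "{0..1::real}" "p t" "q t" s] that by simp
  qed
  ultimately show ?thesis by auto
qed

text \<open>The homotopy interpolates linearly between the two parameter changes. Associativity, the
  unit law and inverses below are all instances of it.\<close>

lemma path_homotopic_reparametrize:
  assumes f: "pathin X f"
    and p: "continuous_on {0..1} p" "p ` {0..1} \<subseteq> {0..1::real}"
    and q: "continuous_on {0..1} q" "q ` {0..1} \<subseteq> {0..1::real}"
    and "p 0 = q 0" "p 1 = q 1" "f (p 0) = x" "f (p 1) = y"
  shows "path_homotopic X x y (\<lambda>t. f (p t)) (\<lambda>t. f (q t))"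
  unfolding path_homotopic_def homotopic_with_def
proof (intro exI conjI allI ballI)
  show "continuous_map (prod_topology (top_of_set {0..1}) (top_of_set {0..1})) X
     (f \<circ> (\<lambda>z. (1 - fst z) * p (snd z) + fst z * q (snd z)))"
    by (rule continuous_map_compose[OF convex_reparametrization[OF p q] f[unfolded pathin_def]])
qed (use assms in \<open>auto simp: algebra_simps\<close>)

lemma continuous_map_halves:
  fixes A :: "'b::topological_space set" and \<tau> :: "'b \<Rightarrow> real"
  assumes \<tau>: "continuous_on A \<tau>"
    and f: "continuous_map (top_of_set {z \<in> A. \<tau> z \<le> 1/2}) X f"
    and g: "continuous_map (top_of_set {z \<in> A. 1/2 \<le> \<tau> z}) X g"
    and eq: "\<And>z. z \<in> A \<Longrightarrow> \<tau> z = 1/2 \<Longrightarrow> f z = g z"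
  shows "continuous_map (top_of_set A) X (\<lambda>z. if \<tau> z \<le> 1/2 then f z else g z)"
proof (rule continuous_map_cases_le)
  show "continuous_map (subtopology (top_of_set A) {x \<in> topspace (top_of_set A). \<tau> x \<le> 1/2}) X f"
    using f by (simp add: subtopology_subtopology Int_absorb1 Collect_mono_iff subset_iff flip: Int_def)
  show "continuous_map (subtopology (top_of_set A) {x \<in> topspace (top_of_set A). 1/2 \<le> \<tau> x}) X g"
    using g by (simp add: subtopology_subtopology Int_absorb1 Collect_mono_iff subset_iff flip: Int_def)
qed (use \<tau> eq in auto)

lemma pathin_concat:
  assumes f: "pathin X f" and g: "pathin X g" and fg: "f 1 = g 0"
  shows "pathin X (concat_paths f g)"
  unfolding pathin_def concat_paths_def
proof (rule continuous_map_halves)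
  have "continuous_map (top_of_set {z \<in> {0..1::real}. z \<le> 1/2}) (top_of_set {0..1}) (\<lambda>t. 2 * t)"
    by (auto intro!: continuous_intros)
  from continuous_map_compose[OF this f[unfolded pathin_def]]
  show "continuous_map (top_of_set {z \<in> {0..1::real}. z \<le> 1/2}) X (\<lambda>t. f (2 * t))"
    by (simp add: o_def)
  have "continuous_map (top_of_set {z \<in> {0..1::real}. 1/2 \<le> z}) (top_of_set {0..1}) (\<lambda>t. 2 * t - 1)"
    by (auto intro!: continuous_intros)
  from continuous_map_compose[OF this g[unfolded pathin_def]]
  show "continuous_map (top_of_set {z \<in> {0..1::real}. 1/2 \<le> z}) X (\<lambda>t. g (2 * t - 1))"
    by (simp add: o_def)
  fix z :: real assume "z = 1/2"
  show "f (2 * z) = g (2 * z - 1)" unfolding \<open>z = 1/2\<close> by (simp add: fg)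
qed auto

lemma concat_paths_ends [simp]: "concat_paths f g 0 = f 0" "concat_paths f g 1 = g 1"
  by (simp_all add: concat_paths_def)

lemma path_homotopic_concat:
  assumes f: "path_homotopic X x y f f'" and g: "path_homotopic X y z g g'"
  shows "path_homotopic X x z (concat_paths f g) (concat_paths f' g')"
proof -
  let ?I = "{0..1} \<times> {0..1} :: (real \<times> real) set"
  obtain F where F: "continuous_map (top_of_set ?I) X F" "\<And>t. F (0, t) = f t" "\<And>t. F (1, t) = f' t"
    "\<And>s. s \<in> {0..1} \<Longrightarrow> F (s, 0) = x \<and> F (s, 1) = y"
    using f unfolding path_homotopic_def homotopic_with_def prod_topology_subtopology_eu by blast
  obtain G where G: "continuous_map (top_of_set ?I) X G" "\<And>t. G (0, t) = g t" "\<And>t. G (1, t) = g' t"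
    "\<And>s. s \<in> {0..1} \<Longrightarrow> G (s, 0) = y \<and> G (s, 1) = z"
    using g unfolding path_homotopic_def homotopic_with_def prod_topology_subtopology_eu by blast
  let ?H = "\<lambda>w. if snd w \<le> 1/2 then F (fst w, 2 * snd w) else G (fst w, 2 * snd w - 1)"
  have "continuous_map (top_of_set ?I) X ?H"
  proof (rule continuous_map_halves)
    have "continuous_map (top_of_set {w \<in> ?I. snd w \<le> 1/2}) (top_of_set ?I) (\<lambda>w. (fst w, 2 * snd w))"
      by (auto intro!: continuous_intros)
    from continuous_map_compose[OF this F(1)]
    show "continuous_map (top_of_set {w \<in> ?I. snd w \<le> 1/2}) X (\<lambda>w. F (fst w, 2 * snd w))"
      by (simp add: o_def)
    have "continuous_map (top_of_set {w \<in> ?I. 1/2 \<le> snd w}) (top_of_set ?I) (\<lambda>w. (fst w, 2 * snd w - 1))"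
      by (auto intro!: continuous_intros)
    from continuous_map_compose[OF this G(1)]
    show "continuous_map (top_of_set {w \<in> ?I. 1/2 \<le> snd w}) X (\<lambda>w. G (fst w, 2 * snd w - 1))"
      by (simp add: o_def)
    fix w :: "real \<times> real" assume w: "w \<in> ?I" "snd w = 1/2"
    show "F (fst w, 2 * snd w) = G (fst w, 2 * snd w - 1)"
      unfolding w(2) using F(4)[of "fst w"] G(4)[of "fst w"] w(1) by auto
  qed (auto intro!: continuous_intros)
  then show ?thesis
    unfolding path_homotopic_def homotopic_with_def prod_topology_subtopology_eu
    by (intro exI[of _ ?H]) (use F G in \<open>auto simp: concat_paths_def\<close>)
qed

lemma path_homotopic_assoc:
  assumes f: "pathin X f" and g: "pathin X g" and h: "pathin X h" and fg: "f 1 = g 0" "g 1 = h 0"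
  shows "path_homotopic X (f 0) (h 1) (concat_paths (concat_paths f g) h) (concat_paths f (concat_paths g h))"
proof -
  let ?F = "concat_paths f (concat_paths g h)"
  \<comment> \<open>The parameter change from \<open>(f g) h\<close> to \<open>f (g h)\<close>: it
    maps the breaks 1/4 and 1/2 to 1/2 and 3/4. Its slopes 2, 1, 1/2 decrease, so it is the minimum
    of its three affine pieces.\<close>
  let ?p = "\<lambda>t::real. min (2 * t) (min (t + 1/4) (t / 2 + 1/2))"
  have F: "pathin X ?F" using assms by (intro pathin_concat) auto
  have "path_homotopic X (f 0) (h 1) (\<lambda>t. ?F (?p t)) (\<lambda>t. ?F t)"
    by (rule path_homotopic_reparametrize[OF F])
       (auto intro!: continuous_intros simp: min.bounded_iff min_le_iff_disj)
  moreover have "path_homotopic X (f 0) (h 1) (\<lambda>t. ?F (?p t)) (concat_paths (concat_paths f g) h)"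
  proof (rule path_homotopic_eq)
    show "pathin X (\<lambda>t. ?F (?p t))"
      by (rule pathin_reparametrize[OF F])
         (auto intro!: continuous_intros simp: min.bounded_iff min_le_iff_disj)
    fix t :: real assume t: "t \<in> {0..1}"
    consider "t \<le> 1/4" | "1/4 < t" "t \<le> 1/2" | "1/2 < t" by linarith
    then show "?F (?p t) = concat_paths (concat_paths f g) h t"
    proof cases
      case 1
      then have "?p t = 2 * t" using t by (simp add: min_def)
      then show ?thesis using 1 by (simp add: concat_paths_def)
    next
      case 2
      then have "?p t = t + 1/4" by (simp add: min_def)
      then show ?thesis using 2 fg by (simp add: concat_paths_def algebra_simps)
    next
      case 3
      then have "?p t = t / 2 + 1/2" by (simp add: min_def)
      then show ?thesis using 3 fg t by (auto simp: concat_paths_def algebra_simps)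
    qed
  qed simp_all
  ultimately show ?thesis by (metis path_homotopic_sym path_homotopic_trans)
qed

lemma path_homotopic_unit_left:
  assumes f: "pathin X f"
  shows "path_homotopic X (f 0) (f 1) (concat_paths (\<lambda>_. f 0) f) f"
proof -
  have "path_homotopic X (f 0) (f 1) (\<lambda>t. f (max 0 (2 * t - 1))) (\<lambda>t. f t)"
    by (rule path_homotopic_reparametrize[OF f]) (auto intro!: continuous_intros)
  moreover have "(\<lambda>t. f (max 0 (2 * t - 1))) = concat_paths (\<lambda>_. f 0) f"
  proof
    fix t :: real
    have "t \<le> 1/2 \<Longrightarrow> max 0 (2 * t - 1) = 0" "\<not> t \<le> 1/2 \<Longrightarrow> max 0 (2 * t - 1) = 2 * t - 1" by simp_all
    then show "f (max 0 (2 * t - 1)) = concat_paths (\<lambda>_. f 0) f t" by (simp add: concat_paths_def)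
  qed
  ultimately show ?thesis by simp
qed

lemma path_homotopic_inverse:
  assumes f: "pathin X f"
  shows "path_homotopic X (f 1) (f 1) (concat_paths (\<lambda>t. f (1 - t)) f) (\<lambda>_. f 1)"
proof -
  have "path_homotopic X (f 1) (f 1) (\<lambda>t. f (max (1 - 2 * t) (2 * t - 1))) (\<lambda>t. f 1)"
    by (rule path_homotopic_reparametrize[OF f, where q = "\<lambda>_. 1"])
       (auto intro!: continuous_intros simp: le_max_iff_disj)
  moreover have "(\<lambda>t. f (max (1 - 2 * t) (2 * t - 1))) = concat_paths (\<lambda>t. f (1 - t)) f"
  proof
    fix t :: real
    have "t \<le> 1/2 \<Longrightarrow> max (1 - 2 * t) (2 * t - 1) = 1 - 2 * t"
      "\<not> t \<le> 1/2 \<Longrightarrow> max (1 - 2 * t) (2 * t - 1) = 2 * t - 1" by simp_all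
    then show "f (max (1 - 2 * t) (2 * t - 1)) = concat_paths (\<lambda>t. f (1 - t)) f t"
      by (simp add: concat_paths_def)
  qed
  ultimately show ?thesis by simp
qed

lemma pathin_reverse: "pathin X f \<Longrightarrow> pathin X (\<lambda>t. f (1 - t))"
  by (rule pathin_reparametrize) (auto intro!: continuous_intros)

section \<open>The fundamental group\<close>

lemma based_homotopy_iff: "(f, g) \<in> based_homotopy X b \<longleftrightarrow> path_homotopic X b b f g"
  by (simp add: based_homotopy_def path_homotopic_def)

lemma based_loops_iff: "f \<in> based_loops X b \<longleftrightarrow> path_homotopic X b b f f"
  unfolding path_homotopic_def homotopic_with_refl based_loops_def pathin_def by auto

lemma equiv_based_homotopy: "equiv (based_loops X b) (based_homotopy X b)"
proof (rule equivI)
  show "based_homotopy X b \<subseteq> based_loops X b \<times> based_loops X b"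
    using path_homotopic_imp unfolding based_homotopy_iff based_loops_def by (fastforce simp: based_homotopy_iff)
  show "refl_on (based_loops X b) (based_homotopy X b)"
    by (rule refl_onI) (simp add: based_homotopy_iff based_loops_iff)
  show "sym (based_homotopy X b)"
    by (rule symI) (simp add: based_homotopy_iff path_homotopic_sym)
  show "trans (based_homotopy X b)"
    by (rule transI) (metis based_homotopy_iff path_homotopic_trans)
qed

definition loop_class :: "'a topology \<Rightarrow> 'a \<Rightarrow> (real \<Rightarrow> 'a) \<Rightarrow> (real \<Rightarrow> 'a) set" where
  "loop_class X b f = based_homotopy X b `` {f}"

lemma in_loop_class: "g \<in> loop_class X b f \<longleftrightarrow> path_homotopic X b b f g"
  by (simp add: loop_class_def based_homotopy_iff)

lemma loop_class_eq: "path_homotopic X b b f g \<Longrightarrow> loop_class X b f = loop_class X b g"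
  unfolding loop_class_def using equiv_class_eq[OF equiv_based_homotopy] by (metis based_homotopy_iff)

lemma carrier_fundamental_group:
  "carrier (fundamental_group X b) = loop_class X b ` based_loops X b"
  by (auto simp: fundamental_group_def quotient_def loop_class_def)

lemma one_fundamental_group: "\<one>\<^bsub>fundamental_group X b\<^esub> = loop_class X b (\<lambda>_. b)"
  by (simp add: fundamental_group_def loop_class_def)

lemma concat_based_loops: "f \<in> based_loops X b \<Longrightarrow> g \<in> based_loops X b \<Longrightarrow> concat_paths f g \<in> based_loops X b"
  by (auto simp: based_loops_def intro!: pathin_concat)

lemma mult_fundamental_group:
  assumes "f \<in> based_loops X b" "g \<in> based_loops X b"
  shows "loop_class X b f \<otimes>\<^bsub>fundamental_group X b\<^esub> loop_class X b g = loop_class X b (concat_paths f g)"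
proof -
  have "loop_class X b f \<otimes>\<^bsub>fundamental_group X b\<^esub> loop_class X b g =
      based_homotopy X b `` {concat_paths f' g' |f' g'. path_homotopic X b b f f' \<and> path_homotopic X b b g g'}"
    by (simp add: fundamental_group_def in_loop_class)
  also have "\<dots> = loop_class X b (concat_paths f g)"
  proof (intro equalityI subsetI)
    fix k assume "k \<in> based_homotopy X b `` {concat_paths f' g' |f' g'. path_homotopic X b b f f' \<and> path_homotopic X b b g g'}"
    then obtain f' g' where "path_homotopic X b b f f'" "path_homotopic X b b g g'"
      "path_homotopic X b b (concat_paths f' g') k"
      by (auto simp: based_homotopy_iff)
    then show "k \<in> loop_class X b (concat_paths f g)"
      unfolding in_loop_class using path_homotopic_concat path_homotopic_trans by metis
  next
    fix k assume "k \<in> loop_class X b (concat_paths f g)"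
    then show "k \<in> based_homotopy X b `` {concat_paths f' g' |f' g'. path_homotopic X b b f f' \<and> path_homotopic X b b g g'}"
      using assms by (intro ImageI[of "concat_paths f g"]) (auto simp: in_loop_class based_homotopy_iff based_loops_iff)
  qed
  finally show ?thesis .
qed

lemma group_fundamental_group:
  assumes b: "b \<in> topspace X"
  shows "group (fundamental_group X b)"
proof (rule groupI)
  let ?G = "fundamental_group X b"
  have cb: "(\<lambda>_. b) \<in> based_loops X b" using b by (simp add: based_loops_def)
  then show "\<one>\<^bsub>?G\<^esub> \<in> carrier ?G"
    by (simp add: one_fundamental_group carrier_fundamental_group)
  fix x assume "x \<in> carrier ?G"
  then obtain f where f: "f \<in> based_loops X b" "x = loop_class X b f"
    by (auto simp: carrier_fundamental_group)
  then have f': "pathin X f" "f 0 = b" "f 1 = b" by (auto simp: based_loops_def)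
  have "loop_class X b (concat_paths (\<lambda>_. b) f) = loop_class X b f"
    using path_homotopic_unit_left[OF f'(1)] f' by (intro loop_class_eq) simp
  then show "\<one>\<^bsub>?G\<^esub> \<otimes>\<^bsub>?G\<^esub> x = x"
    using f cb by (simp add: one_fundamental_group mult_fundamental_group)
  have r: "(\<lambda>t. f (1 - t)) \<in> based_loops X b"
    using f' pathin_reverse by (auto simp: based_loops_def)
  have "loop_class X b (concat_paths (\<lambda>t. f (1 - t)) f) = loop_class X b (\<lambda>_. b)"
    using path_homotopic_inverse[OF f'(1)] f' by (intro loop_class_eq) simp
  then show "\<exists>y\<in>carrier ?G. y \<otimes>\<^bsub>?G\<^esub> x = \<one>\<^bsub>?G\<^esub>"
    using f r by (intro bexI[of _ "loop_class X b (\<lambda>t. f (1 - t))"])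
      (auto simp: one_fundamental_group mult_fundamental_group carrier_fundamental_group)
  fix y assume "y \<in> carrier ?G"
  then obtain g where g: "g \<in> based_loops X b" "y = loop_class X b g"
    by (auto simp: carrier_fundamental_group)
  then show "x \<otimes>\<^bsub>?G\<^esub> y \<in> carrier ?G"
    using f by (auto simp: mult_fundamental_group carrier_fundamental_group concat_based_loops)
  fix z assume "z \<in> carrier ?G"
  then obtain h where h: "h \<in> based_loops X b" "z = loop_class X b h"
    by (auto simp: carrier_fundamental_group)
  have "loop_class X b (concat_paths (concat_paths f g) h) = loop_class X b (concat_paths f (concat_paths g h))"
    using path_homotopic_assoc[of X f g h] f g h by (intro loop_class_eq) (auto simp: based_loops_def)
  then show "x \<otimes>\<^bsub>?G\<^esub> y \<otimes>\<^bsub>?G\<^esub> z = x \<otimes>\<^bsub>?G\<^esub> (y \<otimes>\<^bsub>?G\<^esub> z)"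
    using f g h by (simp add: mult_fundamental_group concat_based_loops)
qed

text \<open>The functions on loops that induce a homomorphism from the fundamental group to an
  abelian group. They are kept as functions on loops because holonomy and counts are defined
  there.\<close>

definition loop_hom :: "'a topology \<Rightarrow> 'a \<Rightarrow> ((real \<Rightarrow> 'a) \<Rightarrow> 'v::ab_group_add) \<Rightarrow> bool" where
  "loop_hom X b F \<longleftrightarrow> (\<forall>f g. path_homotopic X b b f g \<longrightarrow> F f = F g) \<and>
     (\<forall>f\<in>based_loops X b. \<forall>g\<in>based_loops X b. F (concat_paths f g) = F f + F g)"

context
  fixes X :: "'a topology" and b :: 'a
  assumes b: "b \<in> topspace X"
begin

text \<open>The induced map \<open>\<phi>\<close> on homotopy classes is a homomorphism into an
  abelian group; it kills commutators and hence the subgroup that they generate.\<close>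

lemma loop_hom_derived:
  fixes F :: "(real \<Rightarrow> 'a) \<Rightarrow> 'v::ab_group_add"
  assumes F: "loop_hom X b F"
    and C: "C \<in> derived (fundamental_group X b) (carrier (fundamental_group X b))"
  shows "C \<in> carrier (fundamental_group X b)" "\<forall>f\<in>C. F f = 0"
proof -
  let ?G = "fundamental_group X b"
  interpret G: group ?G by (rule group_fundamental_group[OF b])
  define \<phi> where "\<phi> C = F (SOME f. f \<in> C)" for C
  have \<phi>: "\<phi> C = F f" if C: "C \<in> carrier ?G" "f \<in> C" for C f
  proof -
    obtain k where k: "k \<in> based_loops X b" "C = loop_class X b k" using C(1) by (auto simp: carrier_fundamental_group)
    have "F g = F k" if "g \<in> C" for g
      using F that unfolding k(2) in_loop_class loop_hom_def by metis
    then show ?thesis unfolding \<phi>_def using C(2) by (metis someI)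
  qed
  have mult: "\<phi> (C \<otimes>\<^bsub>?G\<^esub> D) = \<phi> C + \<phi> D" if CD: "C \<in> carrier ?G" "D \<in> carrier ?G" for C D
  proof -
    obtain f g where f: "f \<in> based_loops X b" "C = loop_class X b f" and g: "g \<in> based_loops X b" "D = loop_class X b g"
      using CD by (auto simp: carrier_fundamental_group)
    have "f \<in> C" "g \<in> D" "concat_paths f g \<in> C \<otimes>\<^bsub>?G\<^esub> D"
      using f g concat_based_loops[OF f(1) g(1)] by (auto simp: mult_fundamental_group in_loop_class based_loops_iff)
    then show ?thesis
      using \<phi> CD G.m_closed[OF CD] F f(1) g(1) unfolding loop_hom_def by metis
  qed
  have "\<phi> \<one>\<^bsub>?G\<^esub> + \<phi> \<one>\<^bsub>?G\<^esub> = \<phi> \<one>\<^bsub>?G\<^esub>"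
    using mult[OF G.one_closed G.one_closed] unfolding G.l_one[OF G.one_closed] by (rule sym)
  then have phi_one: "\<phi> \<one>\<^bsub>?G\<^esub> = 0" by simp
  have inv: "\<phi> (inv\<^bsub>?G\<^esub> C) = - \<phi> C" if "C \<in> carrier ?G" for C
    using mult[of "inv\<^bsub>?G\<^esub> C" C] that phi_one by (simp add: eq_neg_iff_add_eq_0)
  have set0: "C \<in> carrier ?G \<and> \<phi> C = 0" if "C \<in> derived_set ?G (carrier ?G)" for C
    using that by (auto simp: mult inv)
  have "C \<in> carrier ?G \<and> \<phi> C = 0"
    using C unfolding derived_def
  proof (induction rule: generate.induct)
    case one
    then show ?case by (simp add: phi_one)
  next
    case (incl h)
    then show ?case by (rule set0)
  next
    case (inv h)
    then show ?case using set0[OF inv] \<open>\<And>C. C \<in> carrier ?G \<Longrightarrow> \<phi> (inv\<^bsub>?G\<^esub> C) = - \<phi> C\<close> by simp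
  next
    case (eng h1 h2)
    then show ?case by (simp add: mult)
  qed
  then show "C \<in> carrier (fundamental_group X b)" "\<forall>f\<in>C. F f = 0"
    using \<phi> by auto
qed

text \<open>One loop represents a class of the abelianization simultaneously for all homomorphisms.\<close>

lemma abelianization_representative:
  assumes "A \<in> carrier (abelianization (fundamental_group X b))"
  shows "\<exists>g\<in>based_loops X b. g \<in> \<Union>A \<and>
    (\<forall>(F :: (real \<Rightarrow> 'a) \<Rightarrow> 'v::ab_group_add) f. loop_hom X b F \<longrightarrow> f \<in> \<Union>A \<longrightarrow> F f = F g)"
proof -
  let ?G = "fundamental_group X b"
  interpret G: group ?G by (rule group_fundamental_group[OF b])
  define N where "N = derived ?G (carrier ?G)"
  obtain x where x: "x \<in> carrier ?G" "A = N #>\<^bsub>?G\<^esub> x"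
    using assms by (auto simp: abelianization_def FactGroup_def RCOSETS_def N_def)
  obtain g where g: "g \<in> based_loops X b" "x = loop_class X b g"
    using x(1) by (auto simp: carrier_fundamental_group)
  have *: "F f = F g" if F: "loop_hom X b F" and f: "f \<in> \<Union>A" for F :: "(real \<Rightarrow> 'a) \<Rightarrow> 'v" and f
  proof -
    obtain C where C: "C \<in> N" "f \<in> C \<otimes>\<^bsub>?G\<^esub> x"
      using f x(2) by (auto simp: r_coset_def)
    then have "C \<in> carrier ?G" "\<forall>f\<in>C. F f = 0"
      using loop_hom_derived[OF F] by (auto simp: N_def)
    then obtain k where k: "k \<in> based_loops X b" "C = loop_class X b k"
      by (auto simp: carrier_fundamental_group)
    then have "F k = 0" using \<open>\<forall>f\<in>C. F f = 0\<close> by (simp add: in_loop_class based_loops_iff)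
    have "path_homotopic X b b (concat_paths k g) f"
      using C(2) k g by (simp add: mult_fundamental_group in_loop_class)
    then have "F f = F (concat_paths k g)" using F unfolding loop_hom_def by metis
    also have "\<dots> = F g" using F k(1) g(1) \<open>F k = 0\<close> by (simp add: loop_hom_def)
    finally show ?thesis .
  qed
  have "\<one>\<^bsub>?G\<^esub> \<otimes>\<^bsub>?G\<^esub> x \<in> A"
    using x(2) generate.one[of ?G] unfolding N_def derived_def r_coset_def by blast
  then have "x \<in> A" using x(1) by simp
  moreover have "g \<in> x" using g by (simp add: in_loop_class based_loops_iff)
  ultimately show ?thesis using g(1) * by blast
qed

lemma abelianization_mult_representative:
  assumes A: "A \<in> carrier (abelianization (fundamental_group X b))"
    and B: "B \<in> carrier (abelianization (fundamental_group X b))"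
    and F: "loop_hom X b (F :: (real \<Rightarrow> 'a) \<Rightarrow> 'v::ab_group_add)"
    and f: "f \<in> \<Union>A" and g: "g \<in> \<Union>B"
  shows "\<Union>(A \<otimes>\<^bsub>abelianization (fundamental_group X b)\<^esub> B) \<noteq> {}"
    and "k \<in> \<Union>(A \<otimes>\<^bsub>abelianization (fundamental_group X b)\<^esub> B) \<Longrightarrow> F k = F f + F g"
proof -
  let ?G = "fundamental_group X b"
  interpret G: group ?G by (rule group_fundamental_group[OF b])
  have carr: "C \<in> carrier ?G" if "C \<in> D" "D \<in> carrier (abelianization ?G)" for C D
    using that G.derived_in_carrier[of "carrier ?G"]
    by (auto simp: abelianization_def FactGroup_def RCOSETS_def r_coset_def)
  have prod: "A \<otimes>\<^bsub>abelianization ?G\<^esub> B = {C \<otimes>\<^bsub>?G\<^esub> D |C D. C \<in> A \<and> D \<in> B}"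
    by (auto simp: abelianization_def FactGroup_def set_mult_def)
  have const: "F k = F l" if "D \<in> carrier (abelianization ?G)" "k \<in> \<Union>D" "l \<in> \<Union>D" for D k l
    using abelianization_representative[OF that(1), where ?'v = 'v] F that(2,3) by metis
  have elem: "\<exists>p q. p \<in> based_loops X b \<and> q \<in> based_loops X b \<and> p \<in> \<Union>A \<and> q \<in> \<Union>B \<and>
      C \<otimes>\<^bsub>?G\<^esub> D = loop_class X b (concat_paths p q)" if CD: "C \<in> A" "D \<in> B" for C D
  proof -
    obtain p q where p: "p \<in> based_loops X b" "C = loop_class X b p"
      and q: "q \<in> based_loops X b" "D = loop_class X b q"
      using carr[OF CD(1) A] carr[OF CD(2) B] by (auto simp: carrier_fundamental_group)
    moreover have "p \<in> C" "q \<in> D" using p q by (simp_all add: in_loop_class based_loops_iff)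
    ultimately show ?thesis using CD by (metis UnionI mult_fundamental_group)
  qed
  obtain C D where CD: "C \<in> A" "D \<in> B" using f g by blast
  from elem[OF CD] obtain p q where pq: "p \<in> based_loops X b" "q \<in> based_loops X b"
    "C \<otimes>\<^bsub>?G\<^esub> D = loop_class X b (concat_paths p q)" by blast
  then have "concat_paths p q \<in> C \<otimes>\<^bsub>?G\<^esub> D"
    using concat_based_loops[OF pq(1,2)] by (simp add: in_loop_class based_loops_iff)
  then show "\<Union>(A \<otimes>\<^bsub>abelianization ?G\<^esub> B) \<noteq> {}"
    unfolding prod using CD by blast
  assume "k \<in> \<Union>(A \<otimes>\<^bsub>abelianization ?G\<^esub> B)"
  then obtain C D where CD: "C \<in> A" "D \<in> B" "k \<in> C \<otimes>\<^bsub>?G\<^esub> D" unfolding prod by blast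
  obtain p q where pq: "p \<in> based_loops X b" "q \<in> based_loops X b" "p \<in> \<Union>A" "q \<in> \<Union>B"
    "C \<otimes>\<^bsub>?G\<^esub> D = loop_class X b (concat_paths p q)" using elem[OF CD(1,2)] by blast
  have "F k = F (concat_paths p q)"
    using CD(3) F unfolding pq(5) in_loop_class loop_hom_def by metis
  also have "\<dots> = F p + F q" using F pq(1,2) by (simp add: loop_hom_def)
  also have "\<dots> = F f + F g"
    using const[OF A pq(3) f] const[OF B pq(4) g] by simp
  finally show "F k = F f + F g" .
qed

end

section \<open>Holonomy\<close>

lemma pathin_punctured_surface: "pathin (punctured_surface 1) g \<Longrightarrow> pathin (surface 1) g"
  unfolding punctured_surface_def pathin_subtopology by blast

lemma pathin_eventually_at:
  assumes "pathin X g" "openin X U" "t \<in> {0<..<1}" "g t \<in> U"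
  shows "\<forall>\<^sub>F s in at t. g s \<in> U"
proof -
  have "t \<in> interior {0..1}" using assms(3) by simp
  then have "at t within {0..1} = at t" by (rule at_within_interior)
  moreover have "\<forall>\<^sub>F s in at t within {0..1}. g s \<in> U"
    using assms by (intro pathin_eventually) auto
  ultimately show ?thesis by simp
qed

text \<open>A segment between neighbouring vertices is an edge. Any other one runs inside the
  polygon: at a point on edge \<open>k\<close> the nonnegative heights of its two ends over this
  edge would average to 0, so both ends would be ends of edge \<open>k\<close>. Hence one chart
  suffices for the whole open segment.\<close>

lemma segment_in_chart_zone:
  assumes "a \<noteq> b"
  shows "\<exists>n. \<forall>t\<in>{0<..<1}. (1 - t) *\<^sub>R vtx 1 a + t *\<^sub>R vtx 1 b \<in> chart_zone 1 n"
proof (cases "b = a + 1 \<or> a = b + 1")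
  case True
  then show ?thesis
  proof
    assume b: "b = a + 1"
    have "(1 - t) *\<^sub>R vtx 1 a + t *\<^sub>R vtx 1 b \<in> open_edge 1 a" if "t \<in> {0<..<1}" for t
      using that assms b by (auto simp: in_segment)
    then show ?thesis unfolding chart_zone_def by blast
  next
    assume a: "a = b + 1"
    have "(1 - t) *\<^sub>R vtx 1 a + t *\<^sub>R vtx 1 b \<in> open_edge 1 b" if "t \<in> {0<..<1}" for t
    proof -
      have "(1 - t) *\<^sub>R vtx 1 a + t *\<^sub>R vtx 1 b = (1 - (1 - t)) *\<^sub>R vtx 1 b + (1 - t) *\<^sub>R vtx 1 a"
        by simp
      then show ?thesis using that assms a unfolding in_segment by (intro conjI exI[of _ "1 - t"]) auto
    qed
    then show ?thesis unfolding chart_zone_def by blast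
  qed
next
  case False
  have "(1 - t) *\<^sub>R vtx 1 a + t *\<^sub>R vtx 1 b \<in> interior (polygon 1 Pos)" if t: "t \<in> {0<..<1}" for t
  proof (rule not_edge_interior[OF order_refl])
    show "(1 - t) *\<^sub>R vtx 1 a + t *\<^sub>R vtx 1 b \<in> polygon 1 Pos"
      using t by (intro convexD_alt[OF convex_polygon]) (auto intro: vtx_in_polygon)
    fix k
    show "(1 - t) *\<^sub>R vtx 1 a + t *\<^sub>R vtx 1 b \<notin> edge_seg 1 k"
    proof
      assume "(1 - t) *\<^sub>R vtx 1 a + t *\<^sub>R vtx 1 b \<in> edge_seg 1 k"
      from height_edge_seg[OF this]
      have 0: "(1 - t) * height 1 k (k + 1) (vtx 1 a) + t * height 1 k (k + 1) (vtx 1 b) = 0"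
        by (simp add: height_convex_comb)
      have nn: "0 \<le> height 1 k (k + 1) (vtx 1 m)" for m
        by (rule height_edge(1)[OF order_refl vtx_in_polygon])
      have "0 \<le> (1 - t) * height 1 k (k + 1) (vtx 1 a)" "0 \<le> t * height 1 k (k + 1) (vtx 1 b)"
        using nn t by simp_all
      with 0 have "(1 - t) * height 1 k (k + 1) (vtx 1 a) = 0" "t * height 1 k (k + 1) (vtx 1 b) = 0"
        by linarith+
      then have "height 1 k (k + 1) (vtx 1 a) = 0" "height 1 k (k + 1) (vtx 1 b) = 0"
        using t by auto
      then have "a = k \<or> a = k + 1" "b = k \<or> b = k + 1"
        using height_vtx_edge(1)[OF order_refl, of a k] height_vtx_edge(1)[OF order_refl, of b k] by force+
      with False assms show False by auto
    qed
  qed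
  then show ?thesis unfolding chart_zone_def by blast
qed

section \<open>Straight segments between vertices as paths in the surface\<close>

definition segment_point :: "side \<Rightarrow> int \<Rightarrow> int \<Rightarrow> real \<Rightarrow> side \<times> (real \<times> real)" where
  "segment_point s a b t = (s, (1 - t) *\<^sub>R vertex 1 s a + t *\<^sub>R vertex 1 s b)"

lemma upright_segment_point: "upright (segment_point s a b t) = (1 - t) *\<^sub>R vtx 1 a + t *\<^sub>R vtx 1 b"
  by (simp add: segment_point_def upright_def vertex_sgn algebra_simps)

lemma edge_path_eq: "t \<in> {0..1} \<Longrightarrow> edge_path s a b t = proj 1 (segment_point s a b t)"
  by (simp add: edge_path_def segment_point_def)

lemma segment_point_in: "t \<in> {0..1} \<Longrightarrow> segment_point s a b t \<in> topspace (polygons 1)"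
  unfolding topspace_polygons upright_segment_point
  by (intro convexD_alt[OF convex_polygon]) (auto intro: vtx_in_polygon)

lemma continuous_map_segment_point:
  "continuous_map (top_of_set {0..1}) (polygons 1) (segment_point s a b)"
proof -
  have "continuous_map (top_of_set {0..1}) (top_of_set (polygon 1 s)) (\<lambda>t. snd (segment_point s a b t))"
    using segment_point_in[of _ s a b] in_polygon_iff[of "segment_point s a b _" 1]
    by (auto simp: segment_point_def topspace_polygons intro!: continuous_intros)
  from continuous_map_compose[OF this continuous_map_polygons_side]
  show ?thesis by (simp add: o_def segment_point_def[abs_def])
qed

lemma pathin_edge_path: "pathin (surface 1) (edge_path s a b)"
proof -
  have "continuous_map (top_of_set {0..1}) (surface 1) (proj 1 \<circ> segment_point s a b)"
    by (rule continuous_map_compose[OF continuous_map_segment_point continuous_map_proj])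
  then show ?thesis
    unfolding pathin_def by (rule continuous_map_eq) (simp add: edge_path_eq)
qed

context canonical_lift
begin

text \<open>The difference of two developments is locally constant on the open interval: where they
  use different charts the curve is in a face, and there the charts differ by a translation.
  Continuity extends this to the endpoints, which may be singular.\<close>

lemma developing_unique:
  assumes f: "pathin (surface 1) f" and d: "developing c (h \<circ> f) d" and d': "developing c (h \<circ> f) d'"
  shows "d 1 - d 0 = d' 1 - d' 0"
proof -
  define F where "F t = d t - d' t" for t
  have cont: "continuous_on {0..1} F"
    using d d' by (auto simp: F_def developing_def intro: continuous_intros)
  have loc: "\<forall>\<^sub>F s in at t. F s = F t" if t: "t \<in> {0<..<1}" for t
  proof -
    obtain m where m: "h (f t) \<in> chart_dom c m"
      "\<forall>\<^sub>F s in at t. h (f s) \<in> chart_dom c m \<and> d s - d t = chart c m (h (f s)) - chart c m (h (f t))"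
      using d t unfolding developing_def o_def by blast
    obtain n where n: "h (f t) \<in> chart_dom c n"
      "\<forall>\<^sub>F s in at t. h (f s) \<in> chart_dom c n \<and> d' s - d' t = chart c n (h (f s)) - chart c n (h (f t))"
      using d' t unfolding developing_def o_def by blast
    have "f t \<in> topspace (surface 1)"
      using path_image_subset_topspace[OF f] t by auto
    then have mn: "f t \<in> chart_dom 1 m" "f t \<in> chart_dom 1 n"
      using h_chart_dom m(1) n(1) by blast+
    show ?thesis
    proof (cases "m = n")
      case True
      from m(2) n(2) show ?thesis
      proof eventually_elim
        case (elim s)
        then have "d s - d t = d' s - d' t" using True by simp
        then show ?case by (simp add: F_def algebra_simps)
      qed
    next
      case False
      then obtain r where r: "f t \<in> face r" using chart_dom_Int mn by blast
      have "\<forall>\<^sub>F s in at t. f s \<in> face r"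
        by (rule pathin_eventually_at[OF f openin_surface_face t r])
      with m(2) n(2) show ?thesis
      proof eventually_elim
        case (elim s)
        have s: "f s \<in> chart_dom 1 m" "f s \<in> chart_dom 1 n"
          using elim face_subset_chart_dom by blast+
        have "chi (f s) = chi (f t)" using elim r chi_face by blast
        then have "chart c m (h (f s)) = chart c n (h (f s)) + chi (f t) *\<^sub>R (edge_sum c m - edge_sum c n)"
          using chart_h_change[OF s] by (simp add: algebra_simps)
        moreover have "chart c m (h (f t)) = chart c n (h (f t)) + chi (f t) *\<^sub>R (edge_sum c m - edge_sum c n)"
          using chart_h_change[OF mn] by (simp add: algebra_simps)
        ultimately have "chart c m (h (f s)) - chart c m (h (f t)) = chart c n (h (f s)) - chart c n (h (f t))"
          by simp
        then have "d s - d t = d' s - d' t" using elim by simp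
        then show ?case by (simp add: F_def algebra_simps)
      qed
    qed
  qed
  have const: "F b = F a" if "a \<in> {0<..<1}" "b \<in> {0<..<1}" "a \<le> b" for a b
  proof (rule locally_constant_on_interval[OF _ that(3)])
    fix t assume "t \<in> {a..b}"
    then have "\<forall>\<^sub>F s in at t. F s = F t" using that by (intro loc) auto
    then show "\<forall>\<^sub>F s in at t within {a..b}. F s = F t"
      by (rule filter_leD[OF at_le[OF subset_UNIV], rotated])
  qed
  have half: "F t = F (1/2)" if "t \<in> {0<..<1}" for t
    using const[of t "1/2"] const[of "1/2" t] that by (cases "t \<le> 1/2") auto
  have "F ` closure {0<..<1} \<subseteq> {F (1/2)}"
  proof (rule image_closure_subset)
    show "F ` {0<..<1} \<subseteq> {F (1/2)}" using half by blast
  qed (use cont in simp_all)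
  moreover have "closure {0<..<1} = {0..1::real}" by simp
  ultimately have ends: "F t = F (1/2)" if "t \<in> {0..1}" for t using that by blast
  have "F 0 = F (1/2)" by (rule ends) simp
  also have "F (1/2) = F 1" by (rule ends[symmetric]) simp
  finally show ?thesis by (simp add: F_def algebra_simps)
qed

lemma holonomyI:
  assumes f: "pathin (surface 1) f" and d: "developing c (h \<circ> f) d"
  shows "holonomy c (h \<circ> f) = d 1 - d 0"
  unfolding holonomy_def using developing_unique[OF f] d by (intro the_equality) blast+

lemma chart_h_tendsto:
  assumes f: "pathin (surface 1) f" and t: "t \<in> {0..1}" "f t \<in> chart_dom 1 n"
  shows "((\<lambda>s. chart c n (h (f s))) \<longlongrightarrow> chart c n (h (f t))) (at t within {0..1})"
proof (rule topological_tendstoI)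
  fix V assume V: "open V" "chart c n (h (f t)) \<in> V"
  let ?S = "{x \<in> topspace (subtopology (surface 1) (chart_dom 1 n)). chart c n (h x) \<in> V}"
  have "openin (subtopology (surface 1) (chart_dom 1 n)) ?S"
    using openin_continuous_map_preimage[OF continuous_map_chart_h, of V n] V by simp
  then have "openin (surface 1) ?S"
    using openin_open_subtopology[OF openin_surface_chart_dom[of 1 n]] by simp
  moreover have "f t \<in> ?S"
    using V t path_image_subset_topspace[OF f] by auto
  ultimately have "\<forall>\<^sub>F s in at t within {0..1}. f s \<in> ?S"
    using pathin_eventually[OF f _ t(1)] by blast
  then show "\<forall>\<^sub>F s in at t within {0..1}. chart c n (h (f s)) \<in> V"
    by eventually_elim simp
qed

text \<open>The position of the image within its own polygon, edge points being read in the positive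
  one. It is the same for every chart by \<open>chart_h_change\<close>, but jumps when a curve
  crosses an edge.\<close>

definition local_position :: "point \<Rightarrow> real \<times> real" where
  "local_position x = (let n = SOME n. x \<in> chart_dom 1 n in chart c n (h x) - chi x *\<^sub>R edge_sum c n)"

lemma local_position: "x \<in> chart_dom 1 n \<Longrightarrow> local_position x = chart c n (h x) - chi x *\<^sub>R edge_sum c n"
  unfolding local_position_def Let_def by (rule chart_h_change) (rule someI)

text \<open>On entering the negative polygon over edge \<open>m\<close>,
  \<open>local_position\<close> jumps by \<open>- edge_sum c m\<close> while the count of
  \<open>m\<close> rises by 1. The sum \<open>d\<close> therefore develops the curve, and for a
  closed curve the local positions at the two ends cancel.\<close>

lemma holonomy_loop:
  assumes g: "pathin (punctured_surface 1) g" and closed: "g 1 = g 0" and M: "finite M" "support g \<subseteq> M"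
  shows "holonomy c (h \<circ> g) = (\<Sum>m\<in>M. turns g m *\<^sub>R edge_sum c m)"
proof -
  note gs = pathin_punctured_surface[OF g]
  define d where "d t = local_position (g t) + (\<Sum>m\<in>M. lift g t m *\<^sub>R edge_sum c m)" for t
  have loc: "\<forall>\<^sub>F s in at t within {0..1}. g s \<in> chart_dom 1 n \<and> d s - d t = chart c n (h (g s)) - chart c n (h (g t))"
    if t: "t \<in> {0..1}" "g t \<in> chart_dom 1 n" for t n
    using lift_sum[OF g t M, of "edge_sum c"] pathin_eventually[OF g openin_chart_dom t]
  proof eventually_elim
    case (elim s)
    then show ?case using t(2) by (simp add: d_def local_position algebra_simps)
  qed
  have "continuous_on {0..1} d"
    unfolding continuous_on_def
  proof
    fix t :: real assume t: "t \<in> {0..1}"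
    then obtain n where n: "g t \<in> chart_dom 1 n" using path_in_chart[OF g] by blast
    have "((\<lambda>s. d t - chart c n (h (g t)) + chart c n (h (g s))) \<longlongrightarrow> d t - chart c n (h (g t)) + chart c n (h (g t))) (at t within {0..1})"
      by (intro tendsto_intros chart_h_tendsto[OF gs t n])
    then have *: "((\<lambda>s. d t - chart c n (h (g t)) + chart c n (h (g s))) \<longlongrightarrow> d t) (at t within {0..1})" by simp
    show "(d \<longlongrightarrow> d t) (at t within {0..1})"
      using loc[OF t n] by (intro Lim_transform_eventually[OF *]) (auto elim!: eventually_mono simp: algebra_simps)
  qed
  moreover have "\<exists>n. h (g t) \<in> chart_dom c n \<and> (\<forall>\<^sub>F s in at t. h (g s) \<in> chart_dom c n \<and>
      d s - d t = chart c n (h (g s)) - chart c n (h (g t)))" if t: "t \<in> {0<..<1}" for t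
  proof -
    have t': "t \<in> {0..1}" using t by auto
    then obtain n where n: "g t \<in> chart_dom 1 n" using path_in_chart[OF g] by blast
    have "t \<in> interior {0..1}" using t by simp
    then have at: "at t within {0..1} = at t" by (rule at_within_interior)
    have h: "h x \<in> chart_dom c n" if "x \<in> chart_dom 1 n" for x
      using h_chart_dom that chart_dom_subset_surface[of 1] by blast
    show ?thesis
      using loc[OF t' n] h n unfolding at by (intro exI[of _ n]) (auto elim!: eventually_mono)
  qed
  ultimately have "developing c (h \<circ> g) d" by (simp add: developing_def)
  from holonomyI[OF gs this] show ?thesis
    by (simp add: d_def closed turns_def lift_0[OF g])
qed

text \<open>The image of a segment under \<open>h\<close> need not be straight, but between its ends
  it stays in one chart. There the lift \<open>H\<close> develops it, and only the images of the two
  end vertices enter.\<close>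

lemma holonomy_edge:
  assumes ab: "a \<noteq> b"
  shows "holonomy c (h \<circ> edge_path s a b) = vertex c s b - vertex c s a"
proof -
  let ?x = "segment_point s a b"
  define d where "d t = snd (H (?x t))" for t
  have "continuous_map (top_of_set {0..1}) euclidean (snd \<circ> (H \<circ> ?x))"
    using continuous_map_compose[OF continuous_map_compose[OF continuous_map_segment_point
        homeomorphic_imp_continuous_map[OF H]] continuous_map_polygons_snd] .
  then have "continuous_on {0..1} d" by (simp add: d_def o_def)
  moreover obtain n where n: "\<And>t. t \<in> {0<..<1} \<Longrightarrow> upright (?x t) \<in> chart_zone 1 n"
    using segment_in_chart_zone[OF ab] unfolding upright_segment_point by blast
  have chart: "h (edge_path s a b t) \<in> chart_dom c n \<and> chart c n (h (edge_path s a b t)) = d t + shift c n s"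
    if t: "t \<in> {0<..<1}" for t
  proof -
    have e: "edge_path s a b t = proj 1 (?x t)" using t by (simp add: edge_path_eq)
    have x: "?x t \<in> topspace (polygons 1)" using t by (intro segment_point_in) simp
    then have "proj 1 (?x t) \<in> topspace (surface 1)" by (simp add: topspace_surface)
    moreover have "proj 1 (?x t) \<in> chart_dom 1 n" using n[OF t] by (simp add: proj_in_chart_dom)
    ultimately have "h (proj 1 (?x t)) \<in> chart_dom c n" using h_chart_dom by blast
    moreover have "fst (?x t) = s" by (simp add: segment_point_def)
    ultimately show ?thesis unfolding e using chart_h_proj[OF n[OF t]] by (simp add: d_def)
  qed
  have loc: "\<forall>\<^sub>F r in at t. h (edge_path s a b r) \<in> chart_dom c n \<and>
      d r - d t = chart c n (h (edge_path s a b r)) - chart c n (h (edge_path s a b t))" if t: "t \<in> {0<..<1}" for t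
  proof -
    have "\<forall>\<^sub>F r in at t. r \<in> {0<..<1}" using t by (intro eventually_at_in_open') auto
    then show ?thesis by eventually_elim (use chart t in simp)
  qed
  have "\<exists>n. h (edge_path s a b t) \<in> chart_dom c n \<and> (\<forall>\<^sub>F r in at t. h (edge_path s a b r) \<in> chart_dom c n \<and>
      d r - d t = chart c n (h (edge_path s a b r)) - chart c n (h (edge_path s a b t)))" if t: "t \<in> {0<..<1}" for t
    using chart[OF t] loc[OF t] by blast
  ultimately have "developing c (h \<circ> edge_path s a b) d"
    unfolding developing_def o_def by blast
  from holonomyI[OF pathin_edge_path this] show ?thesis
    by (simp add: d_def segment_point_def H_vertex)
qed

end

lemma holonomy_edge_1: "a \<noteq> b \<Longrightarrow> holonomy 1 (edge_path s a b) = vertex 1 s b - vertex 1 s a"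
  using canonical_lift.holonomy_edge[OF canonical_lift_id, of a b s] by simp

section \<open>Signed crossings of a transverse curve with an edge\<close>

text \<open>Subtracting the jumps already passed makes the function locally constant.\<close>

lemma sum_of_jumps:
  fixes D :: "real \<Rightarrow> real"
  assumes C: "finite C" "C \<subseteq> {0<..<1}"
    and const: "\<And>t. t \<in> {0..1} - C \<Longrightarrow> \<forall>\<^sub>F r in at t within {0..1}. D r = D t"
    and jump: "\<And>t. t \<in> C \<Longrightarrow> \<exists>a. (\<forall>\<^sub>F r in at_left t. D r = a) \<and> (\<forall>\<^sub>F r in at_right t. D r = a + j t)"
  shows "(\<Sum>t\<in>C. j t) = D 1 - D 0"
proof -
  obtain a where a: "\<And>t. t \<in> C \<Longrightarrow> \<forall>\<^sub>F r in at_left t. D r = a t"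
    "\<And>t. t \<in> C \<Longrightarrow> \<forall>\<^sub>F r in at_right t. D r = a t + j t"
    using jump by metis
  \<comment> \<open>Nothing is known about \<open>D\<close> at a jump itself, so its left limit is
    put there; accordingly the sum counts only the jumps strictly before \<open>t\<close>.\<close>
  define E where "E t = (if t \<in> C then a t else D t) - (\<Sum>u\<in>{u \<in> C. u < t}. j u)" for t
  have "E 1 = E 0"
  proof (rule locally_constant_on_interval[OF _ zero_le_one])
    fix t :: real assume t: "t \<in> {0..1}"
    obtain d where d: "0 < d" "\<And>u. u \<in> C \<Longrightarrow> u \<noteq> t \<Longrightarrow> d \<le> dist t u"
      using finite_set_avoid[OF C(1)] by metis
    have near: "\<forall>\<^sub>F r in at t within {0..1}. dist r t < d \<and> r \<noteq> t"
      using d(1) by (auto simp: eventually_at)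
    show "\<forall>\<^sub>F r in at t within {0..1}. E r = E t"
    proof (cases "t \<in> C")
      case False
      then have "\<forall>\<^sub>F r in at t within {0..1}. D r = D t" using const t by simp
      with near show ?thesis
      proof eventually_elim
        case (elim r)
        have "u < r \<longleftrightarrow> u < t" if "u \<in> C" for u
          using d(2)[OF that] elim that False by (cases "u = t") (auto simp: dist_real_def)
        then have "{u \<in> C. u < r} = {u \<in> C. u < t}" by blast
        moreover have "r \<notin> C" using d(2)[of r] elim by (auto simp: dist_commute)
        ultimately show ?case using False elim by (simp add: E_def)
      qed
    next
      case True
      have "\<forall>\<^sub>F r in at t. (r < t \<longrightarrow> D r = a t) \<and> (t < r \<longrightarrow> D r = a t + j t)"
        unfolding eventually_at_split using a[OF True]
        by (auto simp: eventually_at_filter elim: eventually_mono)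
      then have "\<forall>\<^sub>F r in at t within {0..1}. (r < t \<longrightarrow> D r = a t) \<and> (t < r \<longrightarrow> D r = a t + j t)"
        by (rule filter_leD[OF at_le[OF subset_UNIV]])
      with near have "\<forall>\<^sub>F r in at t within {0..1}. (dist r t < d \<and> r \<noteq> t) \<and>
          ((r < t \<longrightarrow> D r = a t) \<and> (t < r \<longrightarrow> D r = a t + j t))"
        by (rule eventually_conj)
      then show ?thesis
      proof eventually_elim
        case (elim r)
        have rC: "r \<notin> C" using d(2)[of r] elim by (auto simp: dist_commute)
        show ?case
        proof (cases "r < t")
          case True
          then have "u < r \<longleftrightarrow> u < t" if "u \<in> C" for u
            using d(2)[OF that] elim that by (cases "u = t") (auto simp: dist_real_def)
          then have "{u \<in> C. u < r} = {u \<in> C. u < t}" by blast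
          then show ?thesis using True \<open>t \<in> C\<close> rC elim by (simp add: E_def)
        next
          case False
          then have "u < r \<longleftrightarrow> u < t \<or> u = t" if "u \<in> C" for u
            using d(2)[OF that] elim that by (cases "u = t") (auto simp: dist_real_def)
          then have "{u \<in> C. u < r} = insert t {u \<in> C. u < t}" using True by blast
          then have "(\<Sum>u\<in>{u \<in> C. u < r}. j u) = j t + (\<Sum>u\<in>{u \<in> C. u < t}. j u)"
            using C(1) by simp
          then show ?thesis using False True rC elim by (auto simp: E_def)
        qed
      qed
    qed
  qed
  moreover have "{u \<in> C. u < 1} = C" "{u \<in> C. u < 0} = {}" "0 \<notin> C" "1 \<notin> C"
    using C(2) by auto
  ultimately show ?thesis by (simp add: E_def)
qed

text \<open>At \<open>c = 1\<close> the vertices lie on the parabola \<open>y = x^2\<close>, and the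
  region above it is convex.\<close>

lemma polygon_parabola: "p \<in> polygon 1 Pos \<Longrightarrow> (fst p)\<^sup>2 \<le> snd p"
proof -
  have "convex {p :: real \<times> real. (fst p)\<^sup>2 \<le> snd p}"
  proof (rule convexI)
    fix p q :: "real \<times> real" and u v :: real
    assume pq: "p \<in> {p. (fst p)\<^sup>2 \<le> snd p}" "q \<in> {p. (fst p)\<^sup>2 \<le> snd p}" and uv: "0 \<le> u" "0 \<le> v" "u + v = 1"
    have v: "v = 1 - u" using uv by simp
    have "u * (fst p)\<^sup>2 + v * (fst q)\<^sup>2 - (u * fst p + v * fst q)\<^sup>2 = u * v * (fst p - fst q)\<^sup>2"
      unfolding v by (simp add: power2_eq_square algebra_simps)
    moreover have "0 \<le> u * v * (fst p - fst q)\<^sup>2" using uv by simp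
    moreover have "u * (fst p)\<^sup>2 \<le> u * snd p" "v * (fst q)\<^sup>2 \<le> v * snd q"
      using pq uv by (auto intro: mult_left_mono)
    ultimately show "u *\<^sub>R p + v *\<^sub>R q \<in> {p. (fst p)\<^sup>2 \<le> snd p}" by simp
  qed
  moreover have "range (vtx 1) \<subseteq> {p. (fst p)\<^sup>2 \<le> snd p}" by (auto simp: vtx_1)
  ultimately have "polygon 1 Pos \<subseteq> {p. (fst p)\<^sup>2 \<le> snd p}"
    unfolding polygon.simps by (rule hull_minimal[rotated])
  then show "p \<in> polygon 1 Pos \<Longrightarrow> (fst p)\<^sup>2 \<le> snd p" by blast
qed

lemma height_1: "height 1 i j p = of_int (j - i) * (snd p - of_int (i + j) * fst p + of_int (i * j))"
  by (simp add: height_def wedge_def vtx_1 power2_eq_square algebra_simps)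

text \<open>On the line \<open>y = (i + j) * x - i * j\<close> the inequality
  \<open>x^2 <= y\<close> becomes \<open>(x - i) * (x - j) <= 0\<close>, which bounds
  \<open>x\<close> between \<open>i\<close> and \<open>j\<close>.\<close>

lemma height_eq_0_segment:
  assumes "i < j" and p: "p \<in> polygon 1 Pos" "height 1 i j p = 0"
  shows "p \<in> closed_segment (vtx 1 i) (vtx 1 j)"
proof -
  let ?x = "fst p" and ?i = "real_of_int i" and ?j = "real_of_int j"
  have y: "snd p = (?i + ?j) * ?x - ?i * ?j"
    using p(2) \<open>i < j\<close> by (auto simp: height_1)
  have "?x\<^sup>2 \<le> (?i + ?j) * ?x - ?i * ?j" using polygon_parabola[OF p(1)] y by simp
  then have "(?x - ?i) * (?x - ?j) \<le> 0" by (simp add: power2_eq_square algebra_simps)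
  then have x: "?i \<le> ?x" "?x \<le> ?j" using \<open>i < j\<close> by (auto simp: mult_le_0_iff)
  define u where "u = (?x - ?i) / (?j - ?i)"
  have ij: "?j - ?i \<noteq> 0" using \<open>i < j\<close> by simp
  have ux: "u * (?j - ?i) = ?x - ?i" using ij by (simp add: u_def)
  have "0 \<le> u" "u \<le> 1" using x \<open>i < j\<close> by (auto simp: u_def field_simps)
  moreover have "?x = (1 - u) * ?i + u * ?j" using ux by (simp add: algebra_simps)
  moreover have "snd p = (1 - u) * ?i\<^sup>2 + u * ?j\<^sup>2"
  proof -
    have "(1 - u) * ?i\<^sup>2 + u * ?j\<^sup>2 = ?i\<^sup>2 + u * (?j - ?i) * (?i + ?j)"
      by (simp add: power2_eq_square algebra_simps)
    then show ?thesis unfolding ux y by (simp add: power2_eq_square algebra_simps)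
  qed
  ultimately show ?thesis
    unfolding in_segment by (intro exI[of _ u]) (simp add: vtx_1 prod_eq_iff)
qed

text \<open>An edge with index in \<open>{i..<j}\<close> has both ends among the vertices from
  \<open>i\<close> to \<open>j\<close>, where the Vandermonde product is at most 0; for other
  indices it is nonnegative at both ends and positive at one. Zero occurs in the first case when the
  edge is the chord itself.\<close>

lemma height_open_edge:
  assumes "i < j" and p: "p \<in> open_edge 1 n"
  shows "n \<in> {i..<j} \<Longrightarrow> height 1 i j p \<le> 0" and "n \<notin> {i..<j} \<Longrightarrow> 0 < height 1 i j p"
proof -
  obtain u where u: "0 < u" "u < 1" "p = (1 - u) *\<^sub>R vtx 1 n + u *\<^sub>R vtx 1 (n + 1)"
    using p by (auto simp: in_segment)
  have h: "height 1 i j p = (1 - u) * height 1 i j (vtx 1 n) + u * height 1 i j (vtx 1 (n + 1))"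
    unfolding u(3) by (rule height_convex_comb)
  show "height 1 i j p \<le> 0" if n: "n \<in> {i..<j}"
  proof -
    have "(j - i) * (n - i) * (n - j) \<le> 0" "(j - i) * (n + 1 - i) * (n + 1 - j) \<le> 0"
      using n by (auto intro!: mult_nonneg_nonpos)
    then have "height 1 i j (vtx 1 n) \<le> 0" "height 1 i j (vtx 1 (n + 1)) \<le> 0"
      unfolding height_vtx_1 by (simp_all only: of_int_le_0_iff)
    then show ?thesis unfolding h using u by (simp add: add_nonpos_nonpos mult_nonneg_nonpos)
  qed
  show "0 < height 1 i j p" if n: "n \<notin> {i..<j}"
  proof (cases "n < i")
    case True
    have "(j - i) * (n - i) < 0" "(j - i) * (n + 1 - i) \<le> 0"
      using True \<open>i < j\<close> by (simp_all add: mult_pos_neg mult_nonneg_nonpos)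
    then have "0 < (j - i) * (n - i) * (n - j)" "0 \<le> (j - i) * (n + 1 - i) * (n + 1 - j)"
      using True \<open>i < j\<close> by (simp_all add: mult_neg_neg mult_nonpos_nonpos)
    then have "0 < height 1 i j (vtx 1 n)" "0 \<le> height 1 i j (vtx 1 (n + 1))"
      unfolding height_vtx_1 by (simp_all only: of_int_0_less_iff of_int_0_le_iff)
    then show ?thesis unfolding h using u by (simp add: add_pos_nonneg)
  next
    case False
    then have "j \<le> n" using n by simp
    then have "0 \<le> (j - i) * (n - i) * (n - j)" "0 < (j - i) * (n + 1 - i) * (n + 1 - j)"
      using \<open>i < j\<close> by simp_all
    then have "0 \<le> height 1 i j (vtx 1 n)" "0 < height 1 i j (vtx 1 (n + 1))"
      unfolding height_vtx_1 by (simp_all only: of_int_0_less_iff of_int_0_le_iff)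
    then show ?thesis unfolding h using u by (simp add: add_nonneg_pos)
  qed
qed

interpretation id_lift: canonical_lift 1 id id
  by (rule canonical_lift_id)

section \<open>Counting relative to a chord\<close>

definition side_chi :: "side \<Rightarrow> real" where
  "side_chi s = (if s = Neg then 1 else 0)"

text \<open>The position of a point of chart \<open>n\<close> relative to the polygon \<open>s\<close>, rotated so that this polygon
  becomes the positive one.\<close>

definition relative_position :: "side \<Rightarrow> int \<Rightarrow> point \<Rightarrow> real \<times> real" where
  "relative_position s n x = (if s = Pos then chart 1 n x else edge_sum 1 n - chart 1 n x)"

lemma relative_position_proj:
  "upright y \<in> chart_zone 1 n \<Longrightarrow> relative_position (fst y) n (proj 1 y) = upright y"
  by (cases "fst y") (auto simp: relative_position_def chart_proj shift_def upright_def)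

lemma chart_dom_cases:
  assumes "x \<in> chart_dom 1 n"
  obtains (face) y where "x = proj 1 y" "x \<in> face (fst y)" "chi x = side_chi (fst y)"
      "relative_position (fst y) n x = upright y" "upright y \<in> interior (polygon 1 Pos)"
    | (edge) "chi x = 0" "\<And>s. \<exists>y. fst y = s \<and> x = proj 1 y \<and> upright y = relative_position s n x"
      "\<And>s. relative_position s n x \<in> open_edge 1 n"
proof -
  obtain y where y: "x = proj 1 y" "upright y \<in> chart_zone 1 n"
    using in_chart_domE[OF order_refl assms] by metis
  show ?thesis
  proof (cases "upright y \<in> interior (polygon 1 Pos)")
    case True
    then show ?thesis
      using y by (intro face[of y]) (auto simp: proj_in_face chi_proj side_chi_def relative_position_proj)
  next
    case False
    then have e: "upright y \<in> open_edge 1 n" using y by (simp add: chart_zone_def)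
    have ex: "\<exists>z. fst z = s \<and> x = proj 1 z \<and> upright z \<in> open_edge 1 n" for s
    proof (cases "fst y = s")
      case True
      then show ?thesis using y e by blast
    next
      case False
      then have "fst (partner 1 n y) = s" by (cases "fst y"; cases s) auto
      moreover have "x = proj 1 (partner 1 n y)"
        using proj_partner[of y 1 n] open_closed_segment[OF e] y by simp
      moreover have "upright (partner 1 n y) \<in> open_edge 1 n"
        unfolding upright_partner by (rule open_edge_reflect[OF e])
      ultimately show ?thesis by blast
    qed
    have rep: "\<exists>y. fst y = s \<and> x = proj 1 y \<and> upright y = relative_position s n x \<and> upright y \<in> open_edge 1 n" for s
    proof -
      obtain z where z: "fst z = s" "x = proj 1 z" "upright z \<in> open_edge 1 n" using ex by blast
      then have "relative_position s n x = upright z"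
        using relative_position_proj[of z n] by (simp add: chart_zone_def)
      with z show ?thesis by metis
    qed
    show ?thesis
    proof (rule edge)
      show "chi x = 0" using False y by (simp add: chi_proj)
      show "\<exists>y. fst y = s \<and> x = proj 1 y \<and> upright y = relative_position s n x" for s using rep by blast
      show "relative_position s n x \<in> open_edge 1 n" for s using rep by metis
    qed
  qed
qed

text \<open>The indicator of the part of polygon \<open>s\<close> that the chord cuts off, on the
  side of the edges with index in \<open>{i..<j}\<close>. The inequality is strict: points of the
  chord do not count.\<close>

definition below :: "side \<Rightarrow> int \<Rightarrow> int \<Rightarrow> point \<Rightarrow> real" where
  "below s i j x = (if chi x = side_chi s \<and>
     height 1 i j (sgn_side s *\<^sub>R id_lift.local_position x) < 0 then 1 else 0)"

lemma below_chart:
  assumes "x \<in> chart_dom 1 n"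
  shows "below s i j x = (if chi x = side_chi s \<and> height 1 i j (relative_position s n x) < 0 then 1 else 0)"
proof -
  have "sgn_side s *\<^sub>R id_lift.local_position x = relative_position s n x" if "chi x = side_chi s"
    using id_lift.local_position[OF assms] that
    by (cases s) (auto simp: relative_position_def side_chi_def)
  then show ?thesis by (auto simp: below_def)
qed

lemma wedge_relative_position:
  "wedge (vertex 1 s j - vertex 1 s i) (chart 1 n y - chart 1 n x) =
     height 1 i j (relative_position s n y) - height 1 i j (relative_position s n x)"
  by (cases s) (simp_all add: relative_position_def height_def wedge_def algebra_simps)

lemma relative_position_tendsto:
  assumes "pathin (surface 1) f" "t \<in> {0..1}" "f t \<in> chart_dom 1 n"
  shows "((\<lambda>r. height 1 i j (relative_position s n (f r))) \<longlongrightarrow> height 1 i j (relative_position s n (f t)))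
    (at t within {0..1})"
proof -
  have "((\<lambda>r. relative_position s n (f r)) \<longlongrightarrow> relative_position s n (f t)) (at t within {0..1})"
    using id_lift.chart_h_tendsto[OF assms] unfolding relative_position_def
    by (cases s) (auto intro!: tendsto_intros)
  then show ?thesis unfolding height_inner by (intro tendsto_intros)
qed

text \<open>This function of the parameter is locally constant away from the segment joining the vertices \<open>i\<close> and
  \<open>j\<close> of the polygon \<open>s\<close>: the jump of \<open>lift\<close> when the curve leaves that polygon through
  one of the edges cut off by the segment is compensated by the jump of \<open>below\<close>.\<close>

definition side_count :: "side \<Rightarrow> int \<Rightarrow> int \<Rightarrow> (real \<Rightarrow> point) \<Rightarrow> real \<Rightarrow> real" where
  "side_count s i j f t = sgn_side s * (\<Sum>n\<in>{i..<j}. lift f t n) + below s i j (f t)"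

lemma side_count_increment:
  assumes f: "pathin (punctured_surface 1) f" and t: "t \<in> {0..1}" "f t \<in> chart_dom 1 n"
  shows "\<forall>\<^sub>F r in at t within {0..1}. f r \<in> chart_dom 1 n \<and>
    side_count s i j f r - side_count s i j f t =
      (if n \<in> {i..<j} then sgn_side s * (chi (f r) - chi (f t)) else 0) + below s i j (f r) - below s i j (f t)"
  using liftsD[OF lifts_lift[OF f] t] pathin_eventually[OF f openin_chart_dom t]
proof eventually_elim
  case (elim r)
  have "(\<Sum>m\<in>{i..<j}. lift f r m) - (\<Sum>m\<in>{i..<j}. lift f t m) =
      (\<Sum>m\<in>{i..<j}. if m = n then chi (f r) - chi (f t) else 0)"
    unfolding sum_subtractf[symmetric] using elim(1) by (intro sum.cong) auto
  also have "\<dots> = (if n \<in> {i..<j} then chi (f r) - chi (f t) else 0)" by simp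
  finally have "sgn_side s * (\<Sum>m\<in>{i..<j}. lift f r m) - sgn_side s * (\<Sum>m\<in>{i..<j}. lift f t m) =
      sgn_side s * (if n \<in> {i..<j} then chi (f r) - chi (f t) else 0)"
    by (simp only: right_diff_distrib[symmetric])
  then show ?case using elim(2) by (simp add: side_count_def)
qed

lemma side_count_locally_constant:
  assumes f: "pathin (punctured_surface 1) f" and t: "t \<in> {0..1}"
    and ij: "i < j" and nc: "f t \<notin> edge_path s i j ` {0..1}"
  shows "\<forall>\<^sub>F r in at t within {0..1}. side_count s i j f r = side_count s i j f t"
proof -
  obtain n where n: "f t \<in> chart_dom 1 n" using path_in_chart[OF f t] .
  let ?\<eta> = "\<lambda>r. height 1 i j (relative_position s n (f r))"
  \<comment> \<open>Within the polygon, the zero set of the height is the chord itself, which the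
    curve avoids at time \<open>t\<close>.\<close>
  have on_seg: "?\<eta> t \<noteq> 0" if y: "fst y = s" "f t = proj 1 y" "upright y = relative_position s n (f t)"
    "upright y \<in> polygon 1 Pos" for y
  proof
    assume "?\<eta> t = 0"
    then have "upright y \<in> closed_segment (vtx 1 i) (vtx 1 j)"
      using height_eq_0_segment[OF ij y(4)] y(3) by simp
    then obtain u where u: "0 \<le> u" "u \<le> 1" "upright y = (1 - u) *\<^sub>R vtx 1 i + u *\<^sub>R vtx 1 j"
      by (auto simp: in_segment)
    then have "y = segment_point s i j u"
      using y(1) by (intro upright_inj) (simp_all add: upright_segment_point, simp add: segment_point_def)
    then have "f t = edge_path s i j u" using y(2) u by (simp add: edge_path_eq)
    then show False using nc u by auto
  qed
  have same_sign: "\<forall>\<^sub>F r in at t within {0..1}. ?\<eta> r < 0 \<longleftrightarrow> ?\<eta> t < 0" if "?\<eta> t \<noteq> 0"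
  proof (cases "?\<eta> t < 0")
    case True
    then show ?thesis
      using order_tendstoD(2)[OF relative_position_tendsto[OF pathin_punctured_surface[OF f] t n]]
      by (auto elim: eventually_mono)
  next
    case False
    then have "0 < ?\<eta> t" using that by simp
    from order_tendstoD(1)[OF relative_position_tendsto[OF pathin_punctured_surface[OF f] t n] this]
    show ?thesis using False by (auto elim: eventually_mono)
  qed
  note inc = side_count_increment[OF f t n, of s i j]
  from n show ?thesis
  proof (cases rule: chart_dom_cases)
    case (face y)
    have "\<forall>\<^sub>F r in at t within {0..1}. f r \<in> face (fst y)"
      by (rule pathin_eventually[OF f openin_face t face(2)])
    with inc have chi_const: "\<forall>\<^sub>F r in at t within {0..1}. f r \<in> chart_dom 1 n \<and> chi (f r) = chi (f t) \<and>
        side_count s i j f r - side_count s i j f t = below s i j (f r) - below s i j (f t)"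
    proof eventually_elim
      case (elim r)
      have "chi (f r) = chi (f t)" using chi_face elim(2) face(2) by blast
      then show ?case using elim(1) by simp
    qed
    show ?thesis
    proof (cases "fst y = s")
      case True
      then have "?\<eta> t \<noteq> 0"
        using face interior_subset[of "polygon 1 Pos"] by (intro on_seg[of y]) auto
      from chi_const same_sign[OF this] show ?thesis
      proof eventually_elim
        case (elim r)
        then have "below s i j (f r) = below s i j (f t)"
          by (simp add: below_chart[of _ n] n)
        then show ?case using elim by simp
      qed
    next
      case False
      then have "chi (f t) \<noteq> side_chi s" using face(3) by (cases "fst y"; cases s) (auto simp: side_chi_def)
      then have z: "below s i j x = 0" if "chi x = chi (f t)" for x using that by (simp add: below_def)
      from chi_const show ?thesis
      proof eventually_elim
        case (elim r)
        then show ?case using z[of "f r"] z[of "f t"] by simp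
      qed
    qed
  next
    case edge
    obtain y where y: "fst y = s" "f t = proj 1 y" "upright y = relative_position s n (f t)" using edge(2) by blast
    have p: "relative_position s n (f t) \<in> open_edge 1 n" by (rule edge(3))
    have "?\<eta> t \<noteq> 0" using y p open_edge_in_polygon by (intro on_seg[of y]) metis+
    then have neg: "?\<eta> t < 0 \<longleftrightarrow> n \<in> {i..<j}" using height_open_edge[OF ij p] by fastforce
    from inc same_sign[OF \<open>?\<eta> t \<noteq> 0\<close>] show ?thesis
    proof eventually_elim
      case (elim r)
      have "chi (f r) = 0 \<or> chi (f r) = 1" by (simp add: chi_def)
      moreover have "below s i j (f r) = (if chi (f r) = side_chi s \<and> n \<in> {i..<j} then 1 else 0)"
        "below s i j (f t) = (if chi (f t) = side_chi s \<and> n \<in> {i..<j} then 1 else 0)"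
        using elim neg n by (simp_all add: below_chart[of _ n])
      \<comment> \<open>At an edge that is cut off, entering the negative polygon adds
        \<open>sgn_side s\<close> to the first term. For \<open>s = Pos\<close> this replaces a
        \<open>below\<close> of 1 that is lost; for \<open>s = Neg\<close> it offsets a
        \<open>below\<close> of 1 that is gained.\<close>
      ultimately have "(if n \<in> {i..<j} then sgn_side s * (chi (f r) - chi (f t)) else 0) +
          below s i j (f r) - below s i j (f t) = 0"
        using edge(1) by (cases s) (auto simp: side_chi_def)
      then show ?case using elim(1) by simp
    qed
  qed
qed

text \<open>To the right of the chord the count is larger by 1 than to its left. At an interior
  point of the polygon this jump comes from \<open>below\<close>. At a point of an edge the chord is
  that edge, \<open>below\<close> vanishes near it, and the jump comes from the counts of the
  crossings.\<close>

lemma side_count_crossing: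
  assumes f: "pathin (punctured_surface 1) f" and t: "t \<in> {0..1}"
    and ij: "i < j" and cross: "f t \<in> edge_path s i j ` {0..1}" and n: "f t \<in> chart_dom 1 n"
  shows "\<exists>a. \<forall>\<^sub>F r in at t within {0..1}.
    (0 < wedge (vertex 1 s j - vertex 1 s i) (chart 1 n (f r) - chart 1 n (f t)) \<longrightarrow> side_count s i j f r = a) \<and>
    (wedge (vertex 1 s j - vertex 1 s i) (chart 1 n (f r) - chart 1 n (f t)) < 0 \<longrightarrow> side_count s i j f r = a + 1)"
proof -
  let ?\<eta> = "\<lambda>r. height 1 i j (relative_position s n (f r))"
  obtain u where u: "u \<in> {0..1}" "f t = proj 1 (segment_point s i j u)"
    using cross by (auto simp: edge_path_eq)
  let ?y = "segment_point s i j u"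
  have zone: "upright ?y \<in> chart_zone 1 n" using n u(2) by (simp add: proj_in_chart_dom)
  have fst_y: "fst ?y = s" by (simp add: segment_point_def)
  have rel: "relative_position s n (f t) = upright ?y"
    using relative_position_proj[OF zone] u(2) fst_y by simp
  have \<eta>0: "?\<eta> t = 0"
    unfolding rel upright_segment_point height_convex_comb by (simp add: height_def wedge_def)
  have w: "wedge (vertex 1 s j - vertex 1 s i) (chart 1 n (f r) - chart 1 n (f t)) = ?\<eta> r" for r
    unfolding wedge_relative_position \<eta>0 by simp
  note inc = side_count_increment[OF f t n, of s i j]
  show ?thesis
  proof (cases "upright ?y \<in> interior (polygon 1 Pos)")
    case True
    then have face: "f t \<in> face s" using u(2) fst_y by (simp add: proj_in_face)
    have chi: "chi x = side_chi s" if "x \<in> face s" for x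
      using that face_disjoint by (cases s) (auto simp: chi_def side_chi_def)
    have b0: "below s i j (f t) = 0" using \<eta>0 by (simp add: below_chart[OF n])
    show ?thesis unfolding w
    proof (intro exI[of _ "side_count s i j f t"])
      show "\<forall>\<^sub>F r in at t within {0..1}. (0 < ?\<eta> r \<longrightarrow> side_count s i j f r = side_count s i j f t) \<and>
          (?\<eta> r < 0 \<longrightarrow> side_count s i j f r = side_count s i j f t + 1)"
        using inc pathin_eventually[OF f openin_face t face]
      proof eventually_elim
        case (elim r)
        have "chi (f r) = side_chi s" "chi (f t) = side_chi s" using chi elim(2) face by blast+
        then have "side_count s i j f r - side_count s i j f t = (if ?\<eta> r < 0 then 1 else 0)"
          using elim(1) b0 by (simp add: below_chart[of "f r" n])
        then show ?case by auto
      qed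
    qed
  next
    case False
    then have e: "upright ?y \<in> open_edge 1 n" using zone by (simp add: chart_zone_def)
    have "u \<noteq> 0" "u \<noteq> 1"
      using e vtx_not_open_edge[OF order_refl] by (auto simp: upright_segment_point)
    then have u01: "u \<in> {0<..<1}" using u by auto
    have 0: "(1 - u) * height 1 n (n + 1) (vtx 1 i) + u * height 1 n (n + 1) (vtx 1 j) = 0"
      using height_edge_seg[OF open_closed_segment[OF e]] by (simp add: upright_segment_point height_convex_comb)
    have nn: "0 \<le> height 1 n (n + 1) (vtx 1 m)" for m
      by (rule height_edge(1)[OF order_refl vtx_in_polygon])
    have "0 \<le> (1 - u) * height 1 n (n + 1) (vtx 1 i)" "0 \<le> u * height 1 n (n + 1) (vtx 1 j)"
      using nn u01 by simp_all
    with 0 have "(1 - u) * height 1 n (n + 1) (vtx 1 i) = 0" "u * height 1 n (n + 1) (vtx 1 j) = 0"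
      by linarith+
    then have "height 1 n (n + 1) (vtx 1 i) = 0" "height 1 n (n + 1) (vtx 1 j) = 0" using u01 by auto
    then have "i = n \<or> i = n + 1" "j = n \<or> j = n + 1"
      using height_vtx_edge(1)[OF order_refl, of i n] height_vtx_edge(1)[OF order_refl, of j n] by force+
    then have [simp]: "i = n" "j = n + 1" using ij by auto
    have chi_t: "chi (f t) = 0" using False u(2) by (simp add: chi_proj)
    have below0: "below s n (n + 1) x = 0" if "x \<in> chart_dom 1 n" for x
      using that
    proof (cases rule: chart_dom_cases)
      case (face y)
      show ?thesis
      proof (cases "fst y = s")
        case True
        then have "0 \<le> height 1 n (n + 1) (relative_position s n x)"
          using face interior_subset height_edge(1)[OF order_refl] by (metis subsetD)
        then show ?thesis by (simp add: below_chart[OF that])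
      next
        case False
        then have "chi x \<noteq> side_chi s" using face(3) by (cases "fst y"; cases s) (auto simp: side_chi_def)
        then show ?thesis by (simp add: below_def)
      qed
    next
      case edge
      have "0 \<le> height 1 n (n + 1) (relative_position s n x)"
        by (rule height_edge(1)[OF order_refl open_edge_in_polygon[OF edge(3)]])
      then show ?thesis by (simp add: below_chart[OF that])
    qed
    have flip: "height 1 n (n + 1) (edge_sum 1 n - p) = - height 1 n (n + 1) p" for p
      by (simp add: height_def wedge_def edge_sum_def algebra_simps)
    have sign: "(0 < height 1 n (n + 1) (relative_position s n x) \<longrightarrow> chi x = side_chi s) \<and>
        (height 1 n (n + 1) (relative_position s n x) < 0 \<longrightarrow> chi x = 1 - side_chi s)" if "x \<in> chart_dom 1 n" for x
      using that
    proof (cases rule: chart_dom_cases)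
      case (face y)
      have "0 \<le> height 1 n (n + 1) (relative_position (fst y) n x)"
        using face interior_subset height_edge(1)[OF order_refl] by (metis subsetD)
      moreover have "height 1 n (n + 1) (relative_position s n x) = - height 1 n (n + 1) (relative_position (fst y) n x)"
        if "fst y \<noteq> s"
        using that flip[of "chart 1 n x"] by (cases "fst y"; cases s) (simp_all add: relative_position_def)
      moreover have "chi x = 1 - side_chi s" if "fst y \<noteq> s"
        using that face(3) by (cases "fst y"; cases s) (simp_all add: side_chi_def)
      ultimately show ?thesis using face(3) by (cases "fst y = s") auto
    next
      case edge
      then show ?thesis using height_edge_seg[OF open_closed_segment[OF edge(3)]] by simp
    qed
    \<comment> \<open>Polygon \<open>s\<close> itself lies to the left of its own edge, while at
      time \<open>t\<close> the value of \<open>chi\<close> is 0; hence the correction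
      \<open>sgn_side s * side_chi s\<close> in the left value.\<close>
    show ?thesis unfolding w
    proof (intro exI[of _ "side_count s i j f t + sgn_side s * side_chi s"])
      show "\<forall>\<^sub>F r in at t within {0..1}. (0 < ?\<eta> r \<longrightarrow> side_count s i j f r = side_count s i j f t + sgn_side s * side_chi s) \<and>
          (?\<eta> r < 0 \<longrightarrow> side_count s i j f r = side_count s i j f t + sgn_side s * side_chi s + 1)"
        using inc
      proof eventually_elim
        case (elim r)
        then have "side_count s i j f r - side_count s i j f t = sgn_side s * chi (f r)"
          using below0[OF n] below0[of "f r"] chi_t by simp
        then have count: "side_count s i j f r = side_count s i j f t + sgn_side s * chi (f r)" by simp
        have side: "sgn_side s * (1 - side_chi s) = sgn_side s * side_chi s + 1"
          by (cases s) (simp_all add: side_chi_def)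
        have sign_r: "0 < ?\<eta> r \<Longrightarrow> chi (f r) = side_chi s" "?\<eta> r < 0 \<Longrightarrow> chi (f r) = 1 - side_chi s"
          using sign[of "f r"] elim by simp_all
        show ?case
        proof (intro conjI impI)
          assume "0 < ?\<eta> r"
          show "side_count s i j f r = side_count s i j f t + sgn_side s * side_chi s"
            unfolding count sign_r(1)[OF \<open>0 < ?\<eta> r\<close>] ..
        next
          assume "?\<eta> r < 0"
          show "side_count s i j f r = side_count s i j f t + sgn_side s * side_chi s + 1"
            unfolding count sign_r(2)[OF \<open>?\<eta> r < 0\<close>] side by simp
        qed
      qed
    qed
  qed
qed

definition edge_direction :: "int \<Rightarrow> int \<Rightarrow> real" where
  "edge_direction a b = (if a < b then 1 else -1)"

lemma edge_direction_square [simp]: "edge_direction a b * edge_direction a b = 1"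
  by (simp add: edge_direction_def)

lemma edge_path_image_commute: "edge_path s b a ` {0..1} = edge_path s a b ` {0..1}"
proof -
  have "edge_path s b a ` {0..1} \<subseteq> edge_path s a b ` {0..1}" for a b
  proof
    fix x assume "x \<in> edge_path s b a ` {0..1}"
    then obtain t where t: "t \<in> {0..1}" "x = edge_path s b a t" by blast
    have "segment_point s b a t = segment_point s a b (1 - t)"
      by (simp add: segment_point_def algebra_simps)
    then have "x = edge_path s a b (1 - t)" using t by (simp add: edge_path_eq)
    then show "x \<in> edge_path s a b ` {0..1}" using t by auto
  qed
  then show ?thesis by blast
qed

text \<open>The crossing signs are the jumps of \<open>side_count\<close>, up to the direction of
  the edge. For a closed curve the two \<open>below\<close> terms at the ends agree, so the total
  jump is the sum of the counts of the edges cut off.\<close>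

lemma transverse_crossing_sum:
  assumes f: "pathin (punctured_surface 1) f" "f 1 = f 0" and ab: "a \<noteq> b"
    and tr: "transverse f (edge_path s a b)"
  shows "(\<Sum>t\<in>crossings f (edge_path s a b). crossing_sign (holonomy 1 (edge_path s a b)) f t) =
    sgn_side s * edge_direction a b * (\<Sum>n\<in>{min a b..<max a b}. turns f n)"
proof -
  define i j where "i = min a b" and "j = max a b"
  define k where "k = edge_direction a b"
  let ?e = "edge_path s a b"
  let ?w = "vertex 1 s j - vertex 1 s i"
  let ?D = "side_count s i j f"
  let ?C = "crossings f ?e"
  have ij: "i < j" using ab by (auto simp: i_def j_def)
  have k: "k = 1 \<or> k = -1" by (simp add: k_def edge_direction_def)
  have img: "?e ` {0..1} = edge_path s i j ` {0..1}"
    using edge_path_image_commute[of s a b] by (simp add: i_def j_def min_def max_def)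
  have hol: "holonomy 1 ?e = k *\<^sub>R ?w"
    using holonomy_edge_1[OF ab, of s] by (auto simp: i_def j_def k_def edge_direction_def min_def max_def)
  have wk: "wedge (k *\<^sub>R u) v = k * wedge u v" for u v :: "real \<times> real"
    by (simp add: wedge_def algebra_simps)
  have fin: "finite ?C" and start: "f 0 \<notin> ?e ` {0..1}" and nz: "\<And>t. t \<in> ?C \<Longrightarrow> crossing_sign (holonomy 1 ?e) f t \<noteq> 0"
    using tr by (auto simp: transverse_def)
  have C01: "?C \<subseteq> {0<..<1}"
  proof
    fix t assume t: "t \<in> ?C"
    then have "t \<noteq> 0" "t \<noteq> 1" using start f(2) by (auto simp: crossings_def)
    then show "t \<in> {0<..<1}" using t by (auto simp: crossings_def)
  qed
  have "(\<Sum>t\<in>?C. k * crossing_sign (holonomy 1 ?e) f t) = ?D 1 - ?D 0"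
  proof (rule sum_of_jumps[OF fin C01])
    fix t assume "t \<in> {0..1} - ?C"
    then show "\<forall>\<^sub>F r in at t within {0..1}. ?D r = ?D t"
      by (intro side_count_locally_constant[OF f(1) _ ij]) (auto simp: crossings_def img)
  next
    fix t assume t: "t \<in> ?C"
    have t01: "t \<in> {0<..<1}" using t C01 by blast
    then have "t \<in> interior {0..1}" by simp
    then have at: "at t within {0..1} = at t" by (rule at_within_interior)
    have cross: "f t \<in> edge_path s i j ` {0..1}" using t by (simp add: crossings_def img)
    have local: "\<exists>a. (\<forall>\<^sub>F r in at_left t. (0 < wedge ?w (chart 1 n (f r) - chart 1 n (f t)) \<longrightarrow> ?D r = a) \<and>
          (wedge ?w (chart 1 n (f r) - chart 1 n (f t)) < 0 \<longrightarrow> ?D r = a + 1)) \<and>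
        (\<forall>\<^sub>F r in at_right t. (0 < wedge ?w (chart 1 n (f r) - chart 1 n (f t)) \<longrightarrow> ?D r = a) \<and>
          (wedge ?w (chart 1 n (f r) - chart 1 n (f t)) < 0 \<longrightarrow> ?D r = a + 1))"
      if "f t \<in> chart_dom 1 n" for n
    proof -
      have "t \<in> {0..1}" using t01 by simp
      from side_count_crossing[OF f(1) this ij cross that]
      show ?thesis unfolding at by (simp add: eventually_at_split)
    qed
    let ?cs = "crossing_sign (holonomy 1 ?e) f t"
    \<comment> \<open>Multiplication by the sign merges the two nonzero cases in the definition of
      \<open>crossing_sign\<close>.\<close>
    have "(\<exists>n. f t \<in> chart_dom 1 n \<and> (\<forall>\<^sub>F r in at_left t. 0 < ?cs * wedge (k *\<^sub>R ?w) (chart 1 n (f r) - chart 1 n (f t))) \<and>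
        (\<forall>\<^sub>F r in at_right t. ?cs * wedge (k *\<^sub>R ?w) (chart 1 n (f r) - chart 1 n (f t)) < 0)) \<and> (?cs = 1 \<or> ?cs = -1)"
      using nz[OF t] unfolding crossing_sign_def hol left_of_def right_of_def
      by (auto split: if_splits)
    then obtain n where n: "f t \<in> chart_dom 1 n" and cs: "?cs = 1 \<or> ?cs = -1"
      and l: "\<forall>\<^sub>F r in at_left t. 0 < ?cs * (k * wedge ?w (chart 1 n (f r) - chart 1 n (f t)))"
      and r: "\<forall>\<^sub>F r in at_right t. ?cs * (k * wedge ?w (chart 1 n (f r) - chart 1 n (f t))) < 0"
      unfolding wk by blast
    obtain a where a: "\<forall>\<^sub>F r in at_left t. (0 < wedge ?w (chart 1 n (f r) - chart 1 n (f t)) \<longrightarrow> ?D r = a) \<and>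
          (wedge ?w (chart 1 n (f r) - chart 1 n (f t)) < 0 \<longrightarrow> ?D r = a + 1)"
        "\<forall>\<^sub>F r in at_right t. (0 < wedge ?w (chart 1 n (f r) - chart 1 n (f t)) \<longrightarrow> ?D r = a) \<and>
          (wedge ?w (chart 1 n (f r) - chart 1 n (f t)) < 0 \<longrightarrow> ?D r = a + 1)"
      using local[OF n] by blast
    show "\<exists>a. (\<forall>\<^sub>F r in at_left t. ?D r = a) \<and> (\<forall>\<^sub>F r in at_right t. ?D r = a + k * ?cs)"
    proof (cases "?cs * k = 1")
      case True
      have "\<forall>\<^sub>F r in at_left t. ?D r = a"
        using l a(1) by eventually_elim (simp add: True flip: mult.assoc)
      moreover have "\<forall>\<^sub>F r in at_right t. ?D r = a + k * ?cs"
        using r a(2) by eventually_elim (use True in \<open>simp add: mult.commute flip: mult.assoc\<close>)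
      ultimately show ?thesis by blast
    next
      case False
      then have ck: "?cs * k = -1" using k cs by auto
      have "\<forall>\<^sub>F r in at_left t. ?D r = a + 1"
        using l a(1) by eventually_elim (simp add: ck flip: mult.assoc)
      moreover have "\<forall>\<^sub>F r in at_right t. ?D r = a + 1 + k * ?cs"
        using r a(2) by eventually_elim (use ck in \<open>simp add: mult.commute flip: mult.assoc\<close>)
      ultimately show ?thesis by blast
    qed
  qed
  also have "?D 1 - ?D 0 = sgn_side s * (\<Sum>n\<in>{i..<j}. turns f n)"
    using f(2) lift_0[OF f(1)] by (simp add: side_count_def turns_def)
  finally have "k * (k * (\<Sum>t\<in>?C. crossing_sign (holonomy 1 ?e) f t)) = k * (sgn_side s * (\<Sum>n\<in>{i..<j}. turns f n))"
    by (simp only: sum_distrib_left)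
  moreover have "k * k = 1" by (simp add: k_def)
  ultimately show ?thesis
    by (simp add: i_def j_def k_def mult.commute flip: mult.assoc)
qed

section \<open>Transverse representatives\<close>

text \<open>Two polygons placed symmetrically about the midpoint of edge \<open>n\<close>, joined
  along this open edge. The line through the edge separates them, so \<open>chart_inv\<close>
  decides by the sign of the height.\<close>

definition chart_image :: "int \<Rightarrow> (real \<times> real) set" where
  "chart_image n = {p. p \<in> chart_zone 1 n \<or> edge_sum 1 n - p \<in> interior (polygon 1 Pos)}"

definition chart_inv :: "int \<Rightarrow> real \<times> real \<Rightarrow> point" where
  "chart_inv n p = (if 0 \<le> height 1 n (n + 1) p then proj 1 (Pos, p) else proj 1 (Neg, p - edge_sum 1 n))"

lemma height_flip: "height 1 n (n + 1) (edge_sum 1 n - p) = - height 1 n (n + 1) p"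
  by (simp add: height_def wedge_def edge_sum_def algebra_simps)

lemma height_interior_pos: "p \<in> interior (polygon 1 Pos) \<Longrightarrow> 0 < height 1 n (n + 1) p"
  using height_edge[OF order_refl, of p n] edge_seg_not_interior[OF order_refl, of p n] interior_subset
  by (metis less_le subsetD)

lemma chart_image_cases:
  assumes "p \<in> chart_image n"
  obtains (Pos) "p \<in> chart_zone 1 n" "0 \<le> height 1 n (n + 1) p"
    | (Neg) "edge_sum 1 n - p \<in> interior (polygon 1 Pos)" "height 1 n (n + 1) p < 0"
proof (cases "p \<in> chart_zone 1 n")
  case True
  then show ?thesis using Pos height_edge(1)[OF order_refl chart_zone_polygon] by blast
next
  case False
  then have "edge_sum 1 n - p \<in> interior (polygon 1 Pos)" using assms by (simp add: chart_image_def)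
  with height_interior_pos[OF this, of n] show ?thesis unfolding height_flip by (intro Neg) simp_all
qed

lemma chart_image_upper:
  assumes "p \<in> chart_image n" "0 \<le> height 1 n (n + 1) p"
  shows "p \<in> polygon 1 Pos"
  using assms(1)
proof (cases rule: chart_image_cases)
  case Pos
  then show ?thesis by (intro chart_zone_polygon)
qed (use assms(2) in simp)

lemma chart_inv:
  assumes "p \<in> chart_image n"
  shows "chart_inv n p \<in> chart_dom 1 n" "chart 1 n (chart_inv n p) = p"
proof -
  have "chart_inv n p \<in> chart_dom 1 n \<and> chart 1 n (chart_inv n p) = p"
    using assms
  proof (cases rule: chart_image_cases)
    case Pos
    then show ?thesis by (simp add: chart_inv_def proj_in_chart_dom chart_proj shift_def)
  next
    case Neg
    then have "upright (Neg, p - edge_sum 1 n) \<in> chart_zone 1 n" by (simp add: chart_zone_def)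
    with Neg show ?thesis
      by (simp add: chart_inv_def proj_in_chart_dom chart_proj shift_def)
  qed
  then show "chart_inv n p \<in> chart_dom 1 n" "chart 1 n (chart_inv n p) = p" by auto
qed

lemma chart_in_image:
  assumes "x \<in> chart_dom 1 n"
  shows "chart 1 n x \<in> chart_image n" "chart_inv n (chart 1 n x) = x"
proof -
  obtain y where y: "x = proj 1 y" "upright y \<in> chart_zone 1 n" "chart 1 n x = snd y + shift 1 n (fst y)"
    using in_chart_domE[OF order_refl assms] by metis
  define p where "p = chart 1 n x"
  have py: "p = snd y + shift 1 n (fst y)" using y(3) by (simp add: p_def)
  have "p \<in> chart_image n \<and> chart_inv n p = x"
  proof (cases "fst y")
    case Pos
    then have y': "y = (Pos, p)" using py by (simp add: shift_def prod_eq_iff)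
    then have z: "p \<in> chart_zone 1 n" using y(2) by (metis upright_simps(1))
    then have "0 \<le> height 1 n (n + 1) p"
      by (intro height_edge(1)[OF order_refl] chart_zone_polygon)
    then show ?thesis using z y(1) y' by (simp add: chart_inv_def chart_image_def)
  next
    case Neg
    then have y': "y = (Neg, p - edge_sum 1 n)" using py by (simp add: shift_def prod_eq_iff)
    then have u: "upright y = edge_sum 1 n - p" by (metis upright_simps(2) minus_diff_eq)
    show ?thesis
    proof (cases "upright y \<in> interior (polygon 1 Pos)")
      case True
      then have "height 1 n (n + 1) p < 0"
        using height_interior_pos[of "upright y" n] unfolding u height_flip by simp
      then show ?thesis using True y(1) y' unfolding u by (simp add: chart_inv_def chart_image_def)
    next
      case False
      then have e: "upright y \<in> open_edge 1 n" using y(2) by (simp add: chart_zone_def)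
      then have e': "p \<in> open_edge 1 n"
        using open_edge_reflect[OF e] unfolding u by simp
      then have "height 1 n (n + 1) p = 0"
        using height_edge_seg open_closed_segment by blast
      moreover have "partner 1 n y = (Pos, p)" by (subst y') (simp add: partner_def)
      then have "x = proj 1 (Pos, p)"
        using proj_partner[of y 1 n] open_closed_segment[OF e] y(1) by simp
      ultimately show ?thesis using e' by (simp add: chart_inv_def chart_image_def chart_zone_def)
    qed
  qed
  then show "chart 1 n x \<in> chart_image n" "chart_inv n (chart 1 n x) = x" by (auto simp: p_def)
qed

lemma continuous_map_proj_compose:
  assumes "continuous_on S f" "\<And>p. p \<in> S \<Longrightarrow> f p \<in> polygon 1 s"
  shows "continuous_map (top_of_set S) (surface 1) (\<lambda>p. proj 1 (s, f p))"
proof -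
  have "continuous_map (top_of_set S) (top_of_set (polygon 1 s)) f" using assms by auto
  from continuous_map_compose[OF this continuous_map_compose[OF continuous_map_polygons_side continuous_map_proj]]
  show ?thesis by (simp add: o_def)
qed

lemma continuous_map_punctured:
  assumes "continuous_map Z (surface 1) f" "\<And>z. z \<in> topspace Z \<Longrightarrow> \<exists>n. f z \<in> chart_dom 1 n"
  shows "continuous_map Z (punctured_surface 1) f"
proof -
  have "f z \<in> topspace (surface 1) - singularities 1" if "z \<in> topspace Z" for z
  proof -
    have "f z \<in> topspace (punctured_surface 1)" using assms(2)[OF that] topspace_punctured by blast
    then show ?thesis by (simp add: punctured_surface_def)
  qed
  then show ?thesis
    unfolding punctured_surface_def using assms(1) by (intro continuous_map_into_subtopology) auto
qed

lemma continuous_map_chart_inv: "continuous_map (top_of_set (chart_image n)) (punctured_surface 1) (chart_inv n)"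
proof (rule continuous_map_punctured)
  let ?R = "top_of_set (chart_image n)"
  show "continuous_map ?R (surface 1) (chart_inv n)"
    unfolding chart_inv_def
  proof (rule continuous_map_cases_le)
    show "continuous_map ?R euclideanreal (\<lambda>p. 0)" by simp
    show "continuous_map ?R euclideanreal (height 1 n (n + 1))"
      by (auto intro: continuous_intros)
    have eq1: "subtopology ?R {x \<in> topspace ?R. 0 \<le> height 1 n (n + 1) x} =
        top_of_set {x \<in> chart_image n. 0 \<le> height 1 n (n + 1) x}"
      by (simp add: subtopology_subtopology Int_def)
    show "continuous_map (subtopology ?R {x \<in> topspace ?R. 0 \<le> height 1 n (n + 1) x}) (surface 1) (\<lambda>p. proj 1 (Pos, p))"
      unfolding eq1
    proof (rule continuous_map_proj_compose)
      fix p assume "p \<in> {x \<in> chart_image n. 0 \<le> height 1 n (n + 1) x}"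
      then show "p \<in> polygon 1 Pos" by (intro chart_image_upper) auto
    qed (rule continuous_on_id)
    have eq2: "subtopology ?R {x \<in> topspace ?R. height 1 n (n + 1) x \<le> 0} =
        top_of_set {x \<in> chart_image n. height 1 n (n + 1) x \<le> 0}"
      by (simp add: subtopology_subtopology Int_def)
    show "continuous_map (subtopology ?R {x \<in> topspace ?R. height 1 n (n + 1) x \<le> 0}) (surface 1) (\<lambda>p. proj 1 (Neg, p - edge_sum 1 n))"
      unfolding eq2
    proof (rule continuous_map_proj_compose)
      fix p assume p: "p \<in> {x \<in> chart_image n. height 1 n (n + 1) x \<le> 0}"
      then have "p \<in> chart_image n" by simp
      then have "edge_sum 1 n - p \<in> polygon 1 Pos"
      proof (cases rule: chart_image_cases)
        case Pos
        then have "p \<in> edge_seg 1 n" using p by (intro height_edge(2)[OF order_refl] chart_zone_polygon) auto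
        then show ?thesis using edge_reflect edge_seg_subset_polygon by blast
      next
        case Neg
        then show ?thesis using interior_subset by blast
      qed
      then show "p - edge_sum 1 n \<in> polygon 1 Neg"
        using in_polygon_iff[of "(Neg, p - edge_sum 1 n)" 1] by simp
    qed (auto intro!: continuous_intros)
  next
    fix p assume p: "p \<in> topspace ?R" "0 = height 1 n (n + 1) p"
    then have "p \<in> polygon 1 Pos" by (intro chart_image_upper[of p n]) auto
    then have "p \<in> edge_seg 1 n" using p(2) by (intro height_edge(2)[OF order_refl]) auto
    then show "proj 1 (Pos, p) = proj 1 (Neg, p - edge_sum 1 n)"
      using proj_partner[of "(Pos, p)" 1 n] by (simp add: partner_def)
  qed
  show "\<exists>m. chart_inv n z \<in> chart_dom 1 m" if "z \<in> topspace ?R" for z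
  proof -
    have "z \<in> chart_image n" using that by simp
    from chart_inv(1)[OF this] show ?thesis by blast
  qed
qed

lemma segment_to_interior:
  assumes "p \<in> polygon 1 Pos" "q \<in> interior (polygon 1 Pos)" "0 < t" "t \<le> 1"
  shows "(1 - t) *\<^sub>R p + t *\<^sub>R q \<in> interior (polygon 1 Pos)"
proof -
  have "p - t *\<^sub>R (p - q) \<in> interior (polygon 1 Pos)"
    using assms by (intro mem_interior_convex_shrink convex_polygon)
  moreover have "(1 - t) *\<^sub>R p + t *\<^sub>R q = p - t *\<^sub>R (p - q)" by (simp add: algebra_simps)
  ultimately show ?thesis by simp
qed

definition edge_mid :: "int \<Rightarrow> real \<times> real" where
  "edge_mid n = (1/2) *\<^sub>R edge_sum 1 n"

lemma edge_mid_in: "edge_mid n \<in> open_edge 1 n"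
proof -
  have "edge_mid n = (1 - 1/2) *\<^sub>R vtx 1 n + (1/2) *\<^sub>R vtx 1 (n + 1)"
    by (simp add: edge_mid_def edge_sum_def scaleR_add_right)
  then show ?thesis unfolding in_segment by (intro conjI exI[of _ "1/2"]) auto
qed

text \<open>The midpoint of the common edge lies on the boundary of both convex halves, and a
  segment from there to an interior point of a half is interior after its start.\<close>

lemma starlike_chart_image: "starlike (chart_image n)"
  unfolding starlike_def
proof (intro bexI[of _ "edge_mid n"] ballI subsetI)
  show "edge_mid n \<in> chart_image n" using edge_mid_in by (simp add: chart_image_def chart_zone_def)
  fix p z assume p: "p \<in> chart_image n" and z: "z \<in> closed_segment (edge_mid n) p"
  then obtain t where t: "0 \<le> t" "t \<le> 1" "z = (1 - t) *\<^sub>R edge_mid n + t *\<^sub>R p" by (auto simp: in_segment)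
  have mid: "edge_mid n \<in> polygon 1 Pos" using edge_mid_in open_edge_in_polygon by blast
  show "z \<in> chart_image n"
  proof (cases "t = 0")
    case True
    then show ?thesis using t edge_mid_in by (simp add: chart_image_def chart_zone_def)
  next
    case False
    then have t0: "0 < t" using t by simp
    consider "p \<in> open_edge 1 n" | "p \<in> interior (polygon 1 Pos)" | "edge_sum 1 n - p \<in> interior (polygon 1 Pos)"
      using p by (auto simp: chart_image_def chart_zone_def)
    then show ?thesis
    proof cases
      case 1
      then have "z \<in> open_edge 1 n"
        unfolding t(3) using t by (intro convexD_alt[OF convex_open_segment edge_mid_in]) auto
      then show ?thesis by (simp add: chart_image_def chart_zone_def)
    next
      case 2
      then have "z \<in> interior (polygon 1 Pos)" unfolding t(3) using segment_to_interior[OF mid _ t0 t(2)] by blast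
      then show ?thesis by (simp add: chart_image_def chart_zone_def)
    next
      case 3
      have "edge_sum 1 n - z = (1 - t) *\<^sub>R edge_mid n + t *\<^sub>R (edge_sum 1 n - p)"
        by (simp add: t(3) edge_mid_def algebra_simps flip: scaleR_add_left)
      then have "edge_sum 1 n - z \<in> interior (polygon 1 Pos)" using segment_to_interior[OF mid 3 t0 t(2)] by simp
      then show ?thesis by (simp add: chart_image_def)
    qed
  qed
qed

text \<open>Both paths are carried to \<open>chart_image n\<close>, which is simply connected
  because it is starlike, and the homotopy found there is carried back by
  \<open>chart_inv n\<close>.\<close>

lemma path_homotopic_chart:
  assumes f: "pathin (punctured_surface 1) f" "\<And>t. t \<in> {0..1} \<Longrightarrow> f t \<in> chart_dom 1 n"
    and g: "pathin (punctured_surface 1) g" "\<And>t. t \<in> {0..1} \<Longrightarrow> g t \<in> chart_dom 1 n"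
    and ends: "f 0 = x" "g 0 = x" "f 1 = y" "g 1 = y"
  shows "path_homotopic (punctured_surface 1) x y f g"
proof -
  let ?X = "punctured_surface 1" and ?c = "chart 1 n"
  have path: "path (?c \<circ> k)" "path_image (?c \<circ> k) \<subseteq> chart_image n"
    if "pathin ?X k" "\<And>t. t \<in> {0..1} \<Longrightarrow> k t \<in> chart_dom 1 n" for k
  proof -
    show "path (?c \<circ> k)"
      unfolding path_def continuous_on_def
      using id_lift.chart_h_tendsto[OF pathin_punctured_surface[OF that(1)] _ that(2)] by (simp add: o_def)
    show "path_image (?c \<circ> k) \<subseteq> chart_image n"
      using that(2) chart_in_image(1) by (auto simp: path_image_def)
  qed
  have "homotopic_paths (chart_image n) (?c \<circ> f) (?c \<circ> g)"
    using starlike_imp_simply_connected[OF starlike_chart_image, of n] path[OF f] path[OF g] ends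
    unfolding simply_connected_eq_homotopic_paths by (simp add: pathstart_def pathfinish_def)
  then have "path_homotopic ?X x y (chart_inv n \<circ> (?c \<circ> f)) (chart_inv n \<circ> (?c \<circ> g))"
    unfolding path_homotopic_def homotopic_paths_def
  proof (rule homotopic_with_compose_continuous_map_left[OF _ continuous_map_chart_inv])
    fix j assume "pathstart j = pathstart (?c \<circ> f) \<and> pathfinish j = pathfinish (?c \<circ> f)"
    then show "(chart_inv n \<circ> j) 0 = x \<and> (chart_inv n \<circ> j) 1 = y"
      using chart_in_image(2)[OF f(2)[of 0]] chart_in_image(2)[OF f(2)[of 1]] ends
      by (simp add: pathstart_def pathfinish_def)
  qed
  moreover have "path_homotopic ?X x y f (chart_inv n \<circ> (?c \<circ> f))"
    using f(2) chart_in_image(2) ends by (intro path_homotopic_eq[OF f(1)]) auto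
  moreover have "path_homotopic ?X x y g (chart_inv n \<circ> (?c \<circ> g))"
    using g(2) chart_in_image(2) ends by (intro path_homotopic_eq[OF g(1)]) auto
  ultimately show ?thesis by (metis path_homotopic_sym path_homotopic_trans)
qed

section \<open>Crossing signs under concatenation\<close>

lemma eventually_at_left_affine:
  fixes \<alpha> \<beta> t :: real
  assumes "0 < \<alpha>" "\<forall>\<^sub>F r in at_left (\<alpha> * t + \<beta>). P r"
  shows "\<forall>\<^sub>F r in at_left t. P (\<alpha> * r + \<beta>)"
proof -
  obtain b where b: "b < \<alpha> * t + \<beta>" "\<And>y. b < y \<Longrightarrow> y < \<alpha> * t + \<beta> \<Longrightarrow> P y"
    using assms(2) unfolding eventually_at_left_field by blast
  show ?thesis
    unfolding eventually_at_left_field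
    using assms(1) b by (intro exI[of _ "(b - \<beta>) / \<alpha>"]) (simp add: field_simps)
qed

lemma eventually_at_right_affine:
  fixes \<alpha> \<beta> t :: real
  assumes "0 < \<alpha>" "\<forall>\<^sub>F r in at_right (\<alpha> * t + \<beta>). P r"
  shows "\<forall>\<^sub>F r in at_right t. P (\<alpha> * r + \<beta>)"
proof -
  obtain b where b: "\<alpha> * t + \<beta> < b" "\<And>y. \<alpha> * t + \<beta> < y \<Longrightarrow> y < b \<Longrightarrow> P y"
    using assms(2) unfolding eventually_at_right_field by blast
  show ?thesis
    unfolding eventually_at_right_field
    using assms(1) b by (intro exI[of _ "(b - \<beta>) / \<alpha>"]) (simp add: field_simps)
qed

lemma crossing_sign_nonzero:
  "crossing_sign w f t \<noteq> 0 \<longleftrightarrow> (\<exists>n. f t \<in> chart_dom 1 n \<and>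
    ((\<forall>\<^sub>F s in at_left t. left_of n w (f t) (f s)) \<and> (\<forall>\<^sub>F s in at_right t. right_of n w (f t) (f s)) \<or>
     (\<forall>\<^sub>F s in at_left t. right_of n w (f t) (f s)) \<and> (\<forall>\<^sub>F s in at_right t. left_of n w (f t) (f s))))"
  unfolding crossing_sign_def by auto

text \<open>The crossing sign depends only on the curve near \<open>t\<close>, and an increasing
  affine change of parameter keeps before and after apart.\<close>

lemma crossing_sign_nonzero_affine:
  fixes \<alpha> \<beta> :: real
  assumes nz: "crossing_sign w f (\<alpha> * t + \<beta>) \<noteq> 0" and "0 < \<alpha>"
    and F: "\<forall>\<^sub>F r in nhds t. F r = f (\<alpha> * r + \<beta>)"
  shows "crossing_sign w F t \<noteq> 0"
proof -
  have Ft: "F t = f (\<alpha> * t + \<beta>)" using eventually_nhds_x_imp_x[OF F] .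
  have Fl: "\<forall>\<^sub>F r in at_left t. F r = f (\<alpha> * r + \<beta>)" and Fr: "\<forall>\<^sub>F r in at_right t. F r = f (\<alpha> * r + \<beta>)"
    using F by (auto simp: eventually_at_filter elim: eventually_mono)
  have l: "\<forall>\<^sub>F r in at_left t. P (F r)" if "\<forall>\<^sub>F r in at_left (\<alpha> * t + \<beta>). P (f r)" for P
    using eventually_at_left_affine[OF \<open>0 < \<alpha>\<close>, of "\<lambda>r. P (f r)", OF that] Fl by eventually_elim simp
  have r: "\<forall>\<^sub>F r in at_right t. P (F r)" if "\<forall>\<^sub>F r in at_right (\<alpha> * t + \<beta>). P (f r)" for P
    using eventually_at_right_affine[OF \<open>0 < \<alpha>\<close>, of "\<lambda>r. P (f r)", OF that] Fr by eventually_elim simp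
  show ?thesis
    using nz unfolding crossing_sign_nonzero Ft using l r by blast
qed

text \<open>The junction is off the edge, so every crossing lies strictly inside one half of the
  parameter interval, where the concatenation is an affine reparametrization of \<open>f\<close> or
  \<open>g\<close>.\<close>

lemma transverse_concat:
  assumes f: "transverse f e" "f 1 \<notin> e ` {0..1}" and g: "transverse g e" "g 1 \<notin> e ` {0..1}" and fg: "f 1 = g 0"
  shows "transverse (concat_paths f g) e"
proof -
  let ?F = "concat_paths f g" and ?w = "holonomy 1 e"
  have cases: "(t < 1/2 \<and> 2 * t \<in> crossings f e \<and> 2 * t \<noteq> 1) \<or> (1/2 < t \<and> 2 * t - 1 \<in> crossings g e)"
    if t: "t \<in> crossings ?F e" for t
  proof -
    have t01: "t \<in> {0..1}" "?F t \<in> e ` {0..1}" using t by (auto simp: crossings_def)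
    have "?F (1/2) = f 1" by (simp add: concat_paths_def)
    then have "t \<noteq> 1/2" using t01(2) f(2) by metis
    then show ?thesis using t01 by (cases "t < 1/2") (auto simp: crossings_def concat_paths_def)
  qed
  have "crossings ?F e \<subseteq> (\<lambda>t. t / 2) ` crossings f e \<union> (\<lambda>t. (t + 1) / 2) ` crossings g e"
  proof
    fix t assume "t \<in> crossings ?F e"
    from cases[OF this] show "t \<in> (\<lambda>t. t / 2) ` crossings f e \<union> (\<lambda>t. (t + 1) / 2) ` crossings g e"
      by (auto intro: image_eqI[of _ _ "2 * t"] image_eqI[of _ _ "2 * t - 1"])
  qed
  then have "finite (crossings ?F e)"
    using f(1) g(1) finite_subset by (fastforce simp: transverse_def)
  moreover have "crossing_sign ?w ?F t \<noteq> 0" if "t \<in> crossings ?F e" for t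
    using cases[OF that]
  proof
    assume t: "t < 1/2 \<and> 2 * t \<in> crossings f e \<and> 2 * t \<noteq> 1"
    then have "\<forall>\<^sub>F r in nhds t. r \<in> {..<1/2}" by (intro eventually_nhds_in_open) auto
    then have "\<forall>\<^sub>F r in nhds t. ?F r = f (2 * r + 0)" by eventually_elim (simp add: concat_paths_def)
    moreover have "crossing_sign ?w f (2 * t + 0) \<noteq> 0" using t f(1) by (simp add: transverse_def)
    ultimately show ?thesis by (intro crossing_sign_nonzero_affine[of ?w f 2 t 0]) auto
  next
    assume t: "1/2 < t \<and> 2 * t - 1 \<in> crossings g e"
    then have "\<forall>\<^sub>F r in nhds t. r \<in> {1/2<..}" by (intro eventually_nhds_in_open) auto
    then have "\<forall>\<^sub>F r in nhds t. ?F r = g (2 * r + (-1))" by eventually_elim (simp add: concat_paths_def)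
    moreover have "crossing_sign ?w g (2 * t + (-1)) \<noteq> 0" using t g(1) by (simp add: transverse_def)
    ultimately show ?thesis by (intro crossing_sign_nonzero_affine[of ?w g 2 t "-1"]) auto
  qed
  moreover have "?F 0 \<notin> e ` {0..1}" using f(1) by (simp add: transverse_def)
  ultimately show ?thesis by (simp add: transverse_def)
qed

text \<open>Follows the convention of \<open>chi\<close>: points on the edges count as
  positive.\<close>

definition side_of :: "point \<Rightarrow> side" where
  "side_of x = (if chi x = 1 then Neg else Pos)"

definition rep :: "point \<Rightarrow> side \<times> (real \<times> real)" where
  "rep x = (SOME y. x = proj 1 y \<and> fst y = side_of x)"

lemma rep:
  assumes "x \<in> chart_dom 1 n"
  shows "proj 1 (rep x) = x" "fst (rep x) = side_of x" "upright (rep x) \<in> chart_zone 1 n"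
proof -
  have "\<exists>y. x = proj 1 y \<and> fst y = side_of x"
    using assms
  proof (cases rule: chart_dom_cases)
    case (face y)
    then have "x = proj 1 y \<and> fst y = side_of x" by (cases "fst y") (auto simp: side_of_def side_chi_def)
    then show ?thesis by blast
  next
    case edge
    then show ?thesis by blast
  qed
  from someI_ex[OF this] have *: "x = proj 1 (rep x) \<and> fst (rep x) = side_of x" unfolding rep_def .
  then show "proj 1 (rep x) = x" "fst (rep x) = side_of x" by auto
  show "upright (rep x) \<in> chart_zone 1 n"
    using assms * proj_in_chart_dom[OF order_refl, of "rep x" n] by simp
qed

section \<open>Hubs, spokes and bridges\<close>

context
  fixes i j :: int
  assumes ij: "i < j"
begin

text \<open>The hub is high enough on the axis to lie off the line through the vertices \<open>i\<close> and \<open>j\<close>. Two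
  opposite hubs developed across any edge are symmetric about its midpoint, so the segment
  between them crosses exactly this edge.\<close>

definition hub :: "real \<times> real" where
  "hub = (0, of_int (1 + \<bar>i * j\<bar>))"

lemma height_hub: "0 < height 1 i j hub"
proof -
  \<comment> \<open>The line through the vertices \<open>i\<close> and \<open>j\<close> meets the
    axis at height \<open>- i * j\<close>.\<close>
  have "0 < 1 + \<bar>i * j\<bar> + i * j" by linarith
  then have "0 < real_of_int (1 + \<bar>i * j\<bar> + i * j)" by simp
  then have "0 < of_int (1 + \<bar>i * j\<bar>) + real_of_int (i * j)" by (simp only: of_int_add)
  then have "0 < of_int (j - i) * (of_int (1 + \<bar>i * j\<bar>) + real_of_int (i * j))"
    using ij by (intro mult_pos_pos) auto
  then show ?thesis by (simp add: height_1 hub_def)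
qed

lemma hub_interior: "hub \<in> interior (polygon 1 Pos)"
proof (rule not_edge_interior[OF order_refl])
  define N where "N = 1 + \<bar>i * j\<bar>"
  have N: "1 \<le> N" by (simp add: N_def)
  then have N0: "real_of_int N \<noteq> 0" by simp
  \<comment> \<open>The hub \<open>(0, N)\<close> lies on the segment from vertex 0 to the midpoint
    \<open>(0, N^2)\<close> of the vertices \<open>- N\<close> and \<open>N\<close>.\<close>
  have top: "(0, (real_of_int N)\<^sup>2) \<in> polygon 1 Pos"
  proof -
    have "(1 - 1/2) *\<^sub>R vtx 1 (- N) + (1/2) *\<^sub>R vtx 1 N \<in> polygon 1 Pos"
      by (intro convexD_alt[OF convex_polygon] vtx_in_polygon) auto
    then show ?thesis by (simp add: vtx_1)
  qed
  have "(1 - 1 / N) *\<^sub>R vtx 1 0 + (1 / N) *\<^sub>R (0, (real_of_int N)\<^sup>2) \<in> polygon 1 Pos"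
    using N by (intro convexD_alt[OF convex_polygon vtx_in_polygon top]) auto
  then show "hub \<in> polygon 1 Pos"
    using N0 by (simp add: hub_def N_def[symmetric] power2_eq_square)
  fix k :: int
  have "0 \<le> k * (k + 1)"
  proof (cases "0 \<le> k")
    case False
    then show ?thesis by (simp add: zero_le_mult_iff)
  qed simp
  then have "0 < N + k * (k + 1)" using N by linarith
  then have "0 < real_of_int (N + k * (k + 1))" by (simp only: of_int_0_less_iff)
  then have "height 1 k (k + 1) hub \<noteq> 0"
    by (simp add: height_1 hub_def N_def[symmetric] algebra_simps)
  then show "hub \<notin> edge_seg 1 k" using height_edge_seg by blast
qed

definition center :: "side \<Rightarrow> point" where
  "center r = proj 1 (r, sgn_side r *\<^sub>R hub)"

lemma upright_hub: "upright (r, sgn_side r *\<^sub>R hub) = hub"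
  by (simp add: upright_def)

lemma center_chart_dom: "center r \<in> chart_dom 1 n"
  unfolding center_def proj_in_chart_dom[OF order_refl] upright_hub
  using hub_interior by (simp add: chart_zone_def)

lemma center_not_on_edge: "center r \<notin> edge_path s i j ` {0..1}"
proof
  assume "center r \<in> edge_path s i j ` {0..1}"
  then obtain u where u: "proj 1 (r, sgn_side r *\<^sub>R hub) = proj 1 (segment_point s i j u)"
    by (auto simp: center_def edge_path_eq)
  then have "segment_point s i j u = (r, sgn_side r *\<^sub>R hub)"
    using glue_interior[OF order_refl, of "(r, sgn_side r *\<^sub>R hub)"] hub_interior
    unfolding proj_eq_iff upright_hub by blast
  then have "hub = (1 - u) *\<^sub>R vtx 1 i + u *\<^sub>R vtx 1 j"
    using upright_segment_point[of s i j u] upright_hub[of r] by simp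
  then have "height 1 i j hub = 0"
    by (simp only: height_convex_comb) (simp add: height_def wedge_def)
  then show False using height_hub by simp
qed

definition spoke :: "point \<Rightarrow> real \<Rightarrow> point" where
  "spoke x t = proj 1 (side_of x, (1 - t) *\<^sub>R snd (rep x) + t *\<^sub>R (sgn_side (side_of x) *\<^sub>R hub))"

lemma spoke:
  assumes x: "x \<in> chart_dom 1 n"
  shows "spoke x 0 = x" "spoke x 1 = center (side_of x)" "t \<in> {0..1} \<Longrightarrow> spoke x t \<in> chart_dom 1 n"
    and "pathin (punctured_surface 1) (spoke x)"
proof -
  let ?y = "\<lambda>t. (side_of x, (1 - t) *\<^sub>R snd (rep x) + t *\<^sub>R (sgn_side (side_of x) *\<^sub>R hub))"
  note r = rep[OF x]
  have up: "upright (?y t) = (1 - t) *\<^sub>R upright (rep x) + t *\<^sub>R hub" for t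
    using r(2) by (simp add: upright_def algebra_simps)
  have "rep x = (side_of x, snd (rep x))" using r(2) by (metis prod.collapse)
  then show "spoke x 0 = x" using r(1) by (simp add: spoke_def)
  show "spoke x 1 = center (side_of x)" by (simp add: spoke_def center_def)
  have zone: "upright (?y t) \<in> chart_zone 1 n" if t: "t \<in> {0..1}" for t
  proof (cases "t = 0")
    case True
    then show ?thesis using r(3) unfolding up by simp
  next
    case False
    then have "upright (?y t) \<in> interior (polygon 1 Pos)"
      unfolding up using t by (intro segment_to_interior chart_zone_polygon[OF r(3)] hub_interior) auto
    then show ?thesis by (simp add: chart_zone_def)
  qed
  then show dom: "spoke x t \<in> chart_dom 1 n" if "t \<in> {0..1}" for t
    using that unfolding spoke_def by (simp add: proj_in_chart_dom)
  show "pathin (punctured_surface 1) (spoke x)"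
    unfolding pathin_def
  proof (rule continuous_map_punctured)
    show "continuous_map (top_of_set {0..1}) (surface 1) (spoke x)"
      unfolding spoke_def[abs_def]
    proof (rule continuous_map_proj_compose)
      fix t :: real assume "t \<in> {0..1}"
      then show "(1 - t) *\<^sub>R snd (rep x) + t *\<^sub>R sgn_side (side_of x) *\<^sub>R hub \<in> polygon 1 (side_of x)"
        using chart_zone_polygon[OF zone] in_polygon_iff[of "?y t" 1] by simp
    qed (intro continuous_intros)
    show "\<exists>m. spoke x t \<in> chart_dom 1 m" if "t \<in> topspace (top_of_set {0..1})" for t
      using dom that by auto
  qed
qed

definition bridge_point :: "int \<Rightarrow> side \<Rightarrow> real \<Rightarrow> real \<times> real" where
  "bridge_point n r t = (if r = Pos then (1 - t) *\<^sub>R hub + t *\<^sub>R (edge_sum 1 n - hub)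
     else (1 - t) *\<^sub>R (edge_sum 1 n - hub) + t *\<^sub>R hub)"

definition bridge :: "int \<Rightarrow> side \<Rightarrow> real \<Rightarrow> point" where
  "bridge n r t = chart_inv n (bridge_point n r t)"

lemma bridge_point_image:
  assumes t: "t \<in> {0..1}"
  shows "bridge_point n r t \<in> chart_image n"
proof -
  \<comment> \<open>Only the half from the hub to the midpoint of the edge is treated. The
    reflection in this midpoint exchanges the halves of the bridge and the two directions.\<close>
  have half: "(1 - t) *\<^sub>R hub + t *\<^sub>R (edge_sum 1 n - hub) \<in> chart_zone 1 n" if t: "0 \<le> t" "t \<le> 1/2" for t
  proof (cases "t = 1/2")
    case True
    have "(1 - t) *\<^sub>R hub + t *\<^sub>R (edge_sum 1 n - hub) = edge_mid n"
      unfolding True edge_mid_def by (simp add: scaleR_diff_right)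
    then show ?thesis using edge_mid_in by (simp add: chart_zone_def)
  next
    case False
    have "edge_mid n \<in> polygon 1 Pos" using edge_mid_in open_edge_in_polygon by blast
    then have "(1 - (1 - 2 * t)) *\<^sub>R edge_mid n + (1 - 2 * t) *\<^sub>R hub \<in> interior (polygon 1 Pos)"
      using t False by (intro segment_to_interior hub_interior) auto
    also have "(1 - (1 - 2 * t)) *\<^sub>R edge_mid n + (1 - 2 * t) *\<^sub>R hub = (1 - t) *\<^sub>R hub + t *\<^sub>R (edge_sum 1 n - hub)"
    proof -
      have "(1 - (1 - 2 * t)) *\<^sub>R edge_mid n = t *\<^sub>R edge_sum 1 n" by (simp add: edge_mid_def)
      then show ?thesis by (simp add: algebra_simps flip: scaleR_add_left)
    qed
    finally show ?thesis by (simp add: chart_zone_def)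
  qed
  have other: "p \<in> chart_image n" if "edge_sum 1 n - p \<in> chart_zone 1 n" for p
    using that open_edge_reflect[of "edge_sum 1 n - p" 1 n]
    by (auto simp: chart_image_def chart_zone_def)
  have le: "p \<in> chart_image n" if "p \<in> chart_zone 1 n" for p using that by (simp add: chart_image_def)
  show ?thesis
  proof (cases "t \<le> 1/2")
    case True
    show ?thesis
    proof (cases r)
      case Pos
      then show ?thesis using half[of t] True t by (intro le) (simp add: bridge_point_def)
    next
      case Neg
      have "edge_sum 1 n - bridge_point n r t = (1 - t) *\<^sub>R hub + t *\<^sub>R (edge_sum 1 n - hub)"
        by (simp add: Neg bridge_point_def algebra_simps)
      then show ?thesis using half[of t] True t by (intro other) simp
    qed
  next
    case False
    show ?thesis
    proof (cases r)
      case Pos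
      have "edge_sum 1 n - bridge_point n r t = (1 - (1 - t)) *\<^sub>R hub + (1 - t) *\<^sub>R (edge_sum 1 n - hub)"
        by (simp add: Pos bridge_point_def algebra_simps)
      then show ?thesis using half[of "1 - t"] False t by (intro other) simp
    next
      case Neg
      have "bridge_point n r t = (1 - (1 - t)) *\<^sub>R hub + (1 - t) *\<^sub>R (edge_sum 1 n - hub)"
        by (simp add: Neg bridge_point_def algebra_simps)
      then show ?thesis using half[of "1 - t"] False t by (intro le) simp
    qed
  qed
qed

lemma bridge_chart:
  assumes "t \<in> {0..1}"
  shows "bridge n r t \<in> chart_dom 1 n" "chart 1 n (bridge n r t) = bridge_point n r t"
  using chart_inv[OF bridge_point_image[OF assms]] by (simp_all add: bridge_def)

lemma pathin_bridge: "pathin (punctured_surface 1) (bridge n r)"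
proof -
  have "continuous_map (top_of_set {0..1}) (top_of_set (chart_image n)) (bridge_point n r)"
  proof -
    have "continuous_on {0..1} (bridge_point n r)"
      unfolding bridge_point_def by (cases r) (auto intro!: continuous_intros)
    then show ?thesis using bridge_point_image by auto
  qed
  from continuous_map_compose[OF this continuous_map_chart_inv]
  show ?thesis by (simp add: pathin_def o_def bridge_def[abs_def])
qed

lemma chart_center: "chart 1 n (center Pos) = hub" "chart 1 n (center Neg) = edge_sum 1 n - hub"
proof -
  have "upright (r, sgn_side r *\<^sub>R hub) \<in> chart_zone 1 n" for r
    unfolding upright_hub using hub_interior by (simp add: chart_zone_def)
  from chart_proj[OF order_refl this[of Pos]] chart_proj[OF order_refl this[of Neg]]
  show "chart 1 n (center Pos) = hub" "chart 1 n (center Neg) = edge_sum 1 n - hub"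
    by (simp_all add: center_def shift_def)
qed

lemma bridge_ends: "bridge n r 0 = center r" "bridge n r 1 = center (flip r)"
  using chart_in_image(2)[OF center_chart_dom, of n r] chart_in_image(2)[OF center_chart_dom, of n "flip r"]
  by (cases r; simp add: bridge_def bridge_point_def chart_center)+

text \<open>The height over the chord is an affine function \<open>\<eta>\<close> of the time along
  the bridge. It is nonzero at one end, so it has at most one zero, and there it changes
  sign.\<close>

lemma transverse_bridge:
  assumes a: "{a, b} = {i, j}"
  shows "transverse (bridge n r) (edge_path s a b)"
proof -
  let ?e = "edge_path s a b" and ?f = "bridge n r"
  have ab: "a = i \<and> b = j \<or> a = j \<and> b = i" using a ij by (auto simp: doubleton_eq_iff)
  have img: "?e ` {0..1} = edge_path s i j ` {0..1}"
    using ab edge_path_image_commute[of s j i] by metis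
  define \<eta> where "\<eta> t = height 1 i j (if s = Pos then bridge_point n r t else edge_sum 1 n - bridge_point n r t)" for t
  have rel: "height 1 i j (relative_position s n (?f t)) = \<eta> t" if "t \<in> {0..1}" for t
    using bridge_chart[OF that] by (simp add: relative_position_def \<eta>_def)
  obtain A B where AB: "\<And>t. \<eta> t = A + B * t"
  proof
    fix t
    show "\<eta> t = \<eta> 0 + (\<eta> 1 - \<eta> 0) * t"
      by (cases s; cases r) (simp_all add: \<eta>_def bridge_point_def height_def wedge_def algebra_simps)
  qed
  obtain t0 where "\<eta> t0 \<noteq> 0"
  proof
    \<comment> \<open>This is the time at which the bridge is at the hub of polygon
      \<open>s\<close>, where \<open>height_hub\<close> applies.\<close>
    show "\<eta> (if s = r then 0 else 1) \<noteq> 0"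
      using height_hub by (cases s; cases r) (auto simp: \<eta>_def bridge_point_def)
  qed
  have zero: "\<eta> t = 0" if t: "t \<in> crossings ?f ?e" for t
  proof -
    have t01: "t \<in> {0..1}" using t by (simp add: crossings_def)
    have "?f t \<in> edge_path s i j ` {0..1}" using t unfolding crossings_def img by blast
    then obtain u where u: "?f t = proj 1 (segment_point s i j u)"
      by (auto simp: edge_path_eq)
    then have "upright (segment_point s i j u) \<in> chart_zone 1 n"
      using bridge_chart(1)[OF t01, of n r] unfolding u by (simp add: proj_in_chart_dom)
    from relative_position_proj[OF this] have "relative_position s n (?f t) = upright (segment_point s i j u)"
      using u by (simp add: segment_point_def)
    then have "\<eta> t = height 1 i j (upright (segment_point s i j u))" using rel[OF t01] by simp
    then show ?thesis
      by (simp add: upright_segment_point height_convex_comb) (simp add: height_def wedge_def)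
  qed
  have B: "B \<noteq> 0" if "t \<in> crossings ?f ?e" for t
    using zero[OF that] \<open>\<eta> t0 \<noteq> 0\<close> unfolding AB by auto
  have "crossings ?f ?e \<subseteq> {- A / B}"
  proof
    fix t assume t: "t \<in> crossings ?f ?e"
    then show "t \<in> {- A / B}" using zero[OF t] B[OF t] unfolding AB by (simp add: field_simps)
  qed
  then have "finite (crossings ?f ?e)" using finite_subset by blast
  moreover have start: "?f 0 \<notin> ?e ` {0..1}" "?f 1 \<notin> ?e ` {0..1}"
    unfolding img bridge_ends by (rule center_not_on_edge)+
  moreover have "crossing_sign (holonomy 1 ?e) ?f t \<noteq> 0" if t: "t \<in> crossings ?f ?e" for t
  proof -
    have t01: "t \<in> {0..1}" using t by (simp add: crossings_def)
    have "t \<noteq> 0" "t \<noteq> 1" using t start by (auto simp: crossings_def)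
    then have t': "t \<in> {0<..<1}" using t01 by auto
    define k where "k = edge_direction a b"
    have k: "k = 1 \<or> k = -1" by (simp add: k_def edge_direction_def)
    have "a \<noteq> b" using ab ij by auto
    then have hol: "holonomy 1 ?e = k *\<^sub>R (vertex 1 s j - vertex 1 s i)"
      using ab ij by (auto simp: holonomy_edge_1 k_def edge_direction_def)
    have wk: "wedge (k *\<^sub>R u) v = k * wedge u v" for u v :: "real \<times> real"
      by (simp add: wedge_def algebra_simps)
    have w: "wedge (holonomy 1 ?e) (chart 1 n (?f u) - chart 1 n (?f t)) = (k * B) * (u - t)" if "u \<in> {0..1}" for u
      unfolding hol wk wedge_relative_position rel[OF that] rel[OF t01] AB by (simp add: algebra_simps)
    have "k * B \<noteq> 0" using k B[OF t] by auto
    have near: "\<forall>\<^sub>F u in at t. u \<in> {0<..<1}" using t' by (intro eventually_at_in_open') auto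
    then have nl: "\<forall>\<^sub>F u in at_left t. u \<in> {0<..<1} \<and> u < t" and nr: "\<forall>\<^sub>F u in at_right t. u \<in> {0<..<1} \<and> t < u"
      by (auto simp: eventually_at_filter elim: eventually_mono)
    have ft: "?f t \<in> chart_dom 1 n" by (rule bridge_chart(1)[OF t01])
    show ?thesis
    proof (cases "0 < k * B")
      case True
      have "\<forall>\<^sub>F u in at_left t. right_of n (holonomy 1 ?e) (?f t) (?f u)"
        using nl by eventually_elim (use True in \<open>auto simp: right_of_def w mult_pos_neg\<close>)
      moreover have "\<forall>\<^sub>F u in at_right t. left_of n (holonomy 1 ?e) (?f t) (?f u)"
        using nr by eventually_elim (use True in \<open>auto simp: left_of_def w\<close>)
      ultimately show ?thesis unfolding crossing_sign_nonzero using ft by blast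
    next
      case False
      then have neg: "k * B < 0" using \<open>k * B \<noteq> 0\<close> by linarith
      have "\<forall>\<^sub>F u in at_left t. left_of n (holonomy 1 ?e) (?f t) (?f u)"
        using nl by eventually_elim (use neg in \<open>auto simp: left_of_def w intro: mult_neg_neg\<close>)
      moreover have "\<forall>\<^sub>F u in at_right t. right_of n (holonomy 1 ?e) (?f t) (?f u)"
        using nr by eventually_elim (use neg in \<open>auto simp: right_of_def w intro: mult_neg_pos\<close>)
      ultimately show ?thesis unfolding crossing_sign_nonzero using ft by blast
    qed
  qed
  ultimately show ?thesis by (simp add: transverse_def)
qed

lemma transverse_center: "{a, b} = {i, j} \<Longrightarrow> transverse (\<lambda>_. center r) (edge_path s a b)"
proof -
  assume "{a, b} = {i, j}"
  then have "a = i \<and> b = j \<or> a = j \<and> b = i" using ij by (auto simp: doubleton_eq_iff)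
  then have "edge_path s a b ` {0..1} = edge_path s i j ` {0..1}"
    using edge_path_image_commute[of s j i] by metis
  then have "center r \<notin> edge_path s a b ` {0..1}" using center_not_on_edge by simp
  then show ?thesis by (simp add: transverse_def crossings_def)
qed

section \<open>Subdivision of a path and cancellation of spokes\<close>

definition restrict_path :: "(real \<Rightarrow> point) \<Rightarrow> real \<Rightarrow> real \<Rightarrow> real \<Rightarrow> point" where
  "restrict_path g u v t = g (u + (v - u) * t)"

lemma unit_affine: "0 \<le> u \<Longrightarrow> u \<le> v \<Longrightarrow> v \<le> 1 \<Longrightarrow> t \<in> {0..1} \<Longrightarrow> u + (v - u) * t \<in> {u..v::real}"
  using mult_left_le[of t "v - u"] by auto

lemma pathin_restrict_path:
  assumes "pathin X g" "0 \<le> u" "u \<le> v" "v \<le> 1"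
  shows "pathin X (restrict_path g u v)"
  unfolding restrict_path_def[abs_def]
proof (rule pathin_reparametrize[OF assms(1)])
  show "(\<lambda>t. u + (v - u) * t) ` {0..1} \<subseteq> {0..1}"
    using unit_affine[OF assms(2-4)] assms by fastforce
qed (intro continuous_intros)

lemma restrict_path_concat:
  assumes g: "pathin X g" and uvw: "0 \<le> u" "u \<le> v" "v \<le> w" "w \<le> 1"
  shows "path_homotopic X (g u) (g w) (restrict_path g u w) (concat_paths (restrict_path g u v) (restrict_path g v w))"
proof -
  let ?p = "concat_paths (\<lambda>t. u + (v - u) * t) (\<lambda>t. v + (w - v) * t)"
  have "pathin euclideanreal ?p"
    by (intro pathin_concat) (auto simp: pathin_def intro!: continuous_intros)
  then have cont: "continuous_on {0..1} ?p" by (simp add: pathin_def)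
  have range: "?p ` {0..1} \<subseteq> {0..1}"
  proof
    fix x assume "x \<in> ?p ` {0..1}"
    then obtain t where t: "t \<in> {0..1}" "x = ?p t" by blast
    show "x \<in> {0..1}"
    proof (cases "t \<le> 1/2")
      case True
      then have "2 * t \<in> {0..1}" using t by auto
      from unit_affine[OF uvw(1,2) _ this] show ?thesis using True t uvw by (simp add: concat_paths_def)
    next
      case False
      then have "2 * t - 1 \<in> {0..1}" using t by auto
      from unit_affine[OF _ uvw(3,4) this] show ?thesis using False t uvw by (simp add: concat_paths_def)
    qed
  qed
  have eq: "concat_paths (restrict_path g u v) (restrict_path g v w) = (\<lambda>t. g (?p t))"
    by (simp add: fun_eq_iff concat_paths_def restrict_path_def)
  have "(\<lambda>t. u + (w - u) * t) ` {0..1} \<subseteq> {0..1}"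
    using unit_affine[of u w] uvw by fastforce
  then show ?thesis
    unfolding eq restrict_path_def[of g u w, abs_def]
    by (intro path_homotopic_reparametrize[OF g _ _ cont range]) (auto intro!: continuous_intros)
qed

text \<open>The reverse of \<open>F\<close> followed by \<open>F\<close> contracts. In the
  application \<open>F\<close> is the spoke at the point where two pieces of the curve meet.\<close>

lemma conjugate_concat:
  assumes A: "pathin X A" and B: "pathin X B" and D: "pathin X D" and F: "pathin X F"
    and ends: "A 1 = B 0" "B 1 = F 1" "D 0 = F 1"
  shows "path_homotopic X (A 0) (D 1)
    (concat_paths (concat_paths A (concat_paths B (\<lambda>t. F (1 - t)))) (concat_paths F D))
    (concat_paths A (concat_paths B D))"
proof -
  let ?C = "\<lambda>t. F (1 - t)"
  have C: "pathin X ?C" by (rule pathin_reverse[OF F])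
  have refl: "path_homotopic X (k 0) (k 1) k k" if "pathin X k" for k
    using that by (intro path_homotopic_eq) auto
  have BC: "pathin X (concat_paths B ?C)" using B C ends by (intro pathin_concat) auto
  have FD: "pathin X (concat_paths F D)" using F D ends by (intro pathin_concat) auto
  have "path_homotopic X (F 1) (D 1) (concat_paths ?C (concat_paths F D)) (concat_paths (concat_paths ?C F) D)"
    using path_homotopic_sym[OF path_homotopic_assoc[OF C F D]] ends by simp
  moreover have "path_homotopic X (F 1) (D 1) (concat_paths (concat_paths ?C F) D) (concat_paths (\<lambda>_. F 1) D)"
    using path_homotopic_concat[OF path_homotopic_inverse[OF F]] refl[OF D] ends by simp
  moreover have "path_homotopic X (F 1) (D 1) (concat_paths (\<lambda>_. F 1) D) D"
    using path_homotopic_unit_left[OF D] ends by simp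
  ultimately have CFD: "path_homotopic X (F 1) (D 1) (concat_paths ?C (concat_paths F D)) D"
    by (metis path_homotopic_trans)
  have "path_homotopic X (B 0) (D 1) (concat_paths (concat_paths B ?C) (concat_paths F D)) (concat_paths B (concat_paths ?C (concat_paths F D)))"
    using path_homotopic_assoc[OF B C FD] ends by simp
  moreover have "path_homotopic X (B 0) (D 1) (concat_paths B (concat_paths ?C (concat_paths F D))) (concat_paths B D)"
    using path_homotopic_concat[OF refl[OF B, unfolded ends(2)] CFD] .
  ultimately have BCFD: "path_homotopic X (B 0) (D 1) (concat_paths (concat_paths B ?C) (concat_paths F D)) (concat_paths B D)"
    by (rule path_homotopic_trans)
  have "path_homotopic X (A 0) (D 1) (concat_paths (concat_paths A (concat_paths B ?C)) (concat_paths F D))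
      (concat_paths A (concat_paths (concat_paths B ?C) (concat_paths F D)))"
    using path_homotopic_assoc[OF A BC FD] ends by simp
  moreover have "path_homotopic X (A 0) (D 1) (concat_paths A (concat_paths (concat_paths B ?C) (concat_paths F D))) (concat_paths A (concat_paths B D))"
    using path_homotopic_concat[OF refl[OF A, unfolded ends(1)] BCFD] .
  ultimately show ?thesis by (rule path_homotopic_trans)
qed

text \<open>The concatenation runs through \<open>w\<close> during the interval from 1/2 to 3/4. The
  homotopy shrinks the parameter window to this interval; at stage \<open>\<sigma>\<close> it is the
  window from \<open>\<sigma> / 2\<close> to \<open>1 - \<sigma> / 4\<close>, and at both ends the
  curve is at \<open>A \<sigma>\<close>, so it stays closed.\<close>

lemma conjugate_freely_homotopic:
  assumes A: "pathin X A" and w: "pathin X w" and ends: "A 1 = w 0" "w 1 = A 1"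
  shows "freely_homotopic X (concat_paths A (concat_paths w (\<lambda>t. A (1 - t)))) w"
proof -
  let ?F = "concat_paths A (concat_paths w (\<lambda>t. A (1 - t)))"
  have F: "pathin X ?F"
    using pathin_reverse[OF A] A w ends by (intro pathin_concat) auto
  let ?p = "\<lambda>t::real. t" and ?q = "\<lambda>t::real. 1/2 + t/4"
  let ?r = "\<lambda>z::real\<times>real. (1 - fst z) * ?p (snd z) + fst z * ?q (snd z)"
  have "continuous_map (prod_topology (top_of_set {0..1}) (top_of_set {0..1})) X (?F \<circ> ?r)"
    by (intro continuous_map_compose[OF convex_reparametrization F[unfolded pathin_def]])
       (auto intro!: continuous_intros)
  moreover have "?F (?r (\<sigma>, 1)) = ?F (?r (\<sigma>, 0))" if \<sigma>: "\<sigma> \<in> {0..1}" for \<sigma>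
  proof -
    have "?F (?r (\<sigma>, 0)) = A \<sigma>" using \<sigma> by (simp add: concat_paths_def)
    moreover have "?F (?r (\<sigma>, 1)) = A \<sigma>"
    proof (cases "\<sigma> = 1")
      case True
      then show ?thesis using ends by (simp add: concat_paths_def)
    next
      case False
      have r: "?r (\<sigma>, 1) = 1 - \<sigma> / 4" by (simp add: algebra_simps)
      have "\<not> 1 - \<sigma> / 4 \<le> 1/2" using \<sigma> by auto
      moreover have "\<not> 2 * (1 - \<sigma> / 4) - 1 \<le> 1/2" using \<sigma> False by auto
      moreover have "1 - (2 * (2 * (1 - \<sigma> / 4) - 1) - 1) = \<sigma>" by simp
      ultimately show ?thesis unfolding r concat_paths_def by simp
    qed
    ultimately show ?thesis by simp
  qed
  ultimately have "freely_homotopic X ?F (\<lambda>t. ?F (?q t))"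
    unfolding freely_homotopic_def homotopic_with_def
    by (intro exI[of _ "?F \<circ> ?r"]) simp
  moreover have "freely_homotopic X (\<lambda>t. ?F (?q t)) w"
    unfolding freely_homotopic_def
  proof (rule homotopic_with_equal)
    have q: "?F (?q t) = w t" if t: "t \<in> {0..1}" for t
    proof (cases "t = 0")
      case True
      then show ?thesis using ends by (simp add: concat_paths_def)
    next
      case False
      have "\<not> 1/2 + t/4 \<le> 1/2" "2 * (1/2 + t/4) - 1 \<le> 1/2" "2 * (2 * (1/2 + t/4) - 1) = t"
        using t False by auto
      then show ?thesis unfolding concat_paths_def by simp
    qed
    then show "\<And>x. x \<in> topspace (top_of_set {0..1}) \<Longrightarrow> ?F (?q x) = w x" by simp
    show "?F (?q 1) = ?F (?q 0)" using q[of 0] q[of 1] ends by simp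
    show "w 1 = w 0" using ends by simp
    show "continuous_map (top_of_set {0..1}) X (\<lambda>t. ?F (?q t))"
    proof -
      have "pathin X (\<lambda>t. ?F (?q t))"
        by (rule pathin_reparametrize[OF F]) (auto intro!: continuous_intros)
      then show ?thesis by (simp only: pathin_def)
    qed
  qed
  ultimately show ?thesis
    unfolding freely_homotopic_def by (rule homotopic_with_trans)
qed

text \<open>Within one chart domain, which is simply connected, the curve may be replaced by a straight
  crossing of the edge between the two hubs, or by a constant curve. The spokes, which join points of
  the curve to the hubs, cancel when consecutive pieces are concatenated.\<close>

lemma transverse_subdivision:
  assumes g: "pathin (punctured_surface 1) g" and ab: "{a, b} = {i, j}"
  shows "\<exists>w. pathin (punctured_surface 1) w \<and> transverse w (edge_path s a b) \<and>
    w 0 = center (side_of (g 0)) \<and> w 1 = center (side_of (g 1)) \<and>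
    path_homotopic (punctured_surface 1) (g 0) (g 1) g
      (concat_paths (spoke (g 0)) (concat_paths w (\<lambda>t. spoke (g 1) (1 - t))))"
proof -
  let ?X = "punctured_surface 1" and ?e = "edge_path s a b"
  have "a = i \<and> b = j \<or> a = j \<and> b = i" using ab ij by (auto simp: doubleton_eq_iff)
  then have img: "?e ` {0..1} = edge_path s i j ` {0..1}"
    using edge_path_image_commute[of s j i] by metis
  define good where "good u v w \<longleftrightarrow> pathin ?X w \<and> transverse w ?e \<and>
    w 0 = center (side_of (g u)) \<and> w 1 = center (side_of (g v)) \<and>
    path_homotopic ?X (g u) (g v) (restrict_path g u v)
      (concat_paths (spoke (g u)) (concat_paths w (\<lambda>t. spoke (g v) (1 - t))))" for u v w
  have "0 \<le> (0::real) \<and> (1::real) \<le> 1 \<longrightarrow> (\<exists>w. good 0 1 w)"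
  proof (rule Bolzano[where P = "\<lambda>u v. 0 \<le> u \<and> v \<le> 1 \<longrightarrow> (\<exists>w. good u v w)", OF zero_le_one])
    fix u v w :: real
    assume P: "0 \<le> u \<and> v \<le> 1 \<longrightarrow> (\<exists>k. good u v k)" "0 \<le> v \<and> w \<le> 1 \<longrightarrow> (\<exists>k. good v w k)"
      and le: "u \<le> v" "v \<le> w"
    show "0 \<le> u \<and> w \<le> 1 \<longrightarrow> (\<exists>k. good u w k)"
    proof
      assume uw: "0 \<le> u \<and> w \<le> 1"
      then obtain k l where k: "good u v k" and l: "good v w l" using P le by auto
      have sp: "spoke (g t) 0 = g t" "spoke (g t) 1 = center (side_of (g t))" "pathin ?X (spoke (g t))"
        if "t \<in> {0..1}" for t
        using path_in_chart[OF g that] spoke by metis+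
      have in01: "u \<in> {0..1}" "v \<in> {0..1}" "w \<in> {0..1}" using uw le by auto
      let ?A = "spoke (g u)" and ?F = "spoke (g v)" and ?E = "\<lambda>t. spoke (g w) (1 - t)"
      have pE: "pathin ?X ?E" by (rule pathin_reverse[OF sp(3)[OF in01(3)]])
      have pk: "pathin ?X k" "k 0 = ?A 1" "k 1 = ?F 1" and pl: "pathin ?X l" "l 0 = ?F 1" "l 1 = ?E 0"
        using k l sp(2)[OF in01(1)] sp(2)[OF in01(2)] sp(2)[OF in01(3)] by (auto simp: good_def)
      have D: "pathin ?X (concat_paths l ?E)" using pl pE by (intro pathin_concat) auto
      have "path_homotopic ?X (g u) (g w) (restrict_path g u w) (concat_paths (restrict_path g u v) (restrict_path g v w))"
        using uw le by (intro restrict_path_concat[OF g]) auto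
      moreover have "path_homotopic ?X (g u) (g w) (concat_paths (restrict_path g u v) (restrict_path g v w))
          (concat_paths (concat_paths ?A (concat_paths k (\<lambda>t. ?F (1 - t)))) (concat_paths ?F (concat_paths l ?E)))"
        using k l by (intro path_homotopic_concat) (auto simp: good_def)
      moreover have "path_homotopic ?X (g u) (g w)
          (concat_paths (concat_paths ?A (concat_paths k (\<lambda>t. ?F (1 - t)))) (concat_paths ?F (concat_paths l ?E)))
          (concat_paths ?A (concat_paths k (concat_paths l ?E)))"
        using conjugate_concat[OF sp(3)[OF in01(1)] pk(1) D sp(3)[OF in01(2)]] pk pl sp(1)[OF in01(1)] sp(1)[OF in01(3)]
        by simp
      moreover have "path_homotopic ?X (g u) (g w)
          (concat_paths ?A (concat_paths k (concat_paths l ?E))) (concat_paths ?A (concat_paths (concat_paths k l) ?E))"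
      proof (rule path_homotopic_concat)
        show "path_homotopic ?X (g u) (?A 1) ?A ?A"
          using sp[OF in01(1)] by (intro path_homotopic_eq) auto
        show "path_homotopic ?X (?A 1) (g w) (concat_paths k (concat_paths l ?E)) (concat_paths (concat_paths k l) ?E)"
          using path_homotopic_sym[OF path_homotopic_assoc[OF pk(1) pl(1) pE]] pk pl sp(1)[OF in01(3)] by simp
      qed
      ultimately have "path_homotopic ?X (g u) (g w) (restrict_path g u w) (concat_paths ?A (concat_paths (concat_paths k l) ?E))"
        by (metis path_homotopic_trans)
      moreover have "transverse (concat_paths k l) ?e"
        using k l pk(3) pl(2) center_not_on_edge unfolding good_def
        by (intro transverse_concat) (auto simp: img)
      moreover have "pathin ?X (concat_paths k l)" using pk pl by (intro pathin_concat) auto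
      ultimately have "good u w (concat_paths k l)" using k l by (simp add: good_def)
      then show "\<exists>k. good u w k" by blast
    qed
  next
    fix x :: real assume "0 \<le> x" "x \<le> 1"
    then have x: "x \<in> {0..1}" by simp
    obtain n where n: "g x \<in> chart_dom 1 n" using path_in_chart[OF g x] .
    then obtain d where d: "0 < d" "\<And>s. s \<in> {0..1} \<Longrightarrow> s \<noteq> x \<Longrightarrow> dist s x < d \<Longrightarrow> g s \<in> chart_dom 1 n"
      using pathin_eventually[OF g openin_chart_dom x n] unfolding eventually_at by metis
    show "\<exists>d>0. \<forall>u v. u \<le> x \<and> x \<le> v \<and> v - u < d \<longrightarrow> 0 \<le> u \<and> v \<le> 1 \<longrightarrow> (\<exists>w. good u v w)"
    proof (rule exI[of _ d], intro conjI allI impI)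
      fix u v assume uv: "u \<le> x \<and> x \<le> v \<and> v - u < d" "0 \<le> u \<and> v \<le> 1"
      have dom: "g t \<in> chart_dom 1 n" if "t \<in> {u..v}" for t
        using that uv n d(2)[of t] by (cases "t = x") (auto simp: dist_real_def)
      have ends: "g u \<in> chart_dom 1 n" "g v \<in> chart_dom 1 n" using uv by (auto intro: dom)
      obtain w where w: "pathin ?X w" "transverse w ?e" "w 0 = center (side_of (g u))" "w 1 = center (side_of (g v))"
        "\<And>t. t \<in> {0..1} \<Longrightarrow> w t \<in> chart_dom 1 n"
      proof (cases "side_of (g u) = side_of (g v)")
        case True
        have "center (side_of (g u)) \<in> topspace ?X" unfolding topspace_punctured using center_chart_dom by blast
        then show ?thesis
          using True transverse_center[OF ab] center_chart_dom by (intro that[of "\<lambda>_. center (side_of (g u))"]) auto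
      next
        case False
        then have "side_of (g v) = flip (side_of (g u))" by (cases "side_of (g u)"; cases "side_of (g v)") auto
        then show ?thesis
          using pathin_bridge transverse_bridge[OF ab] bridge_ends bridge_chart(1)
          by (intro that[of "bridge n (side_of (g u))"]) auto
      qed
      have rev: "pathin ?X (\<lambda>t. spoke (g v) (1 - t))" by (rule pathin_reverse[OF spoke(4)[OF ends(2)]])
      have "path_homotopic ?X (g u) (g v) (restrict_path g u v)
          (concat_paths (spoke (g u)) (concat_paths w (\<lambda>t. spoke (g v) (1 - t))))"
      proof (rule path_homotopic_chart[where n = n])
        show "pathin ?X (restrict_path g u v)" using uv by (intro pathin_restrict_path[OF g]) auto
        show "restrict_path g u v t \<in> chart_dom 1 n" if "t \<in> {0..1}" for t
          unfolding restrict_path_def using uv that by (intro dom unit_affine) auto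
        show "pathin ?X (concat_paths (spoke (g u)) (concat_paths w (\<lambda>t. spoke (g v) (1 - t))))"
          using w spoke(2)[OF ends(1)] spoke(2)[OF ends(2)] rev spoke(4)[OF ends(1)]
          by (intro pathin_concat) auto
        show "concat_paths (spoke (g u)) (concat_paths w (\<lambda>t. spoke (g v) (1 - t))) t \<in> chart_dom 1 n"
          if "t \<in> {0..1}" for t
          using that spoke(3)[OF ends(1)] spoke(3)[OF ends(2)] w(5) by (auto simp: concat_paths_def)
      qed (use spoke(1)[OF ends(1)] spoke(1)[OF ends(2)] in \<open>auto simp: restrict_path_def\<close>)
      then have "good u v w" using w by (simp add: good_def)
      then show "\<exists>w. good u v w" by blast
    qed (rule d)
  qed
  then obtain w where w: "good 0 1 w" by auto
  have "restrict_path g 0 1 = g" by (auto simp: restrict_path_def)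
  then show ?thesis using w unfolding good_def by metis
qed

end

text \<open>For a closed curve the first and the last spoke are the same path run out and back, so a
  free homotopy removes them.\<close>

lemma exists_transverse_representative:
  assumes g: "pathin (punctured_surface 1) g" "g 1 = g 0" and ab: "a \<noteq> b"
  shows "\<exists>f. freely_homotopic (punctured_surface 1) g f \<and> transverse f (edge_path s a b)"
proof -
  have ij: "min a b < max a b" "{a, b} = {min a b, max a b}" using ab by (auto simp: min_def max_def)
  obtain n where n: "g 0 \<in> chart_dom 1 n" using path_in_chart[OF g(1), of 0] by auto
  obtain w where w: "pathin (punctured_surface 1) w" "transverse w (edge_path s a b)"
    "w 0 = spoke (min a b) (max a b) (g 0) 1" "w 1 = spoke (min a b) (max a b) (g 0) 1"
    "path_homotopic (punctured_surface 1) (g 0) (g 0) g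
      (concat_paths (spoke (min a b) (max a b) (g 0)) (concat_paths w (\<lambda>t. spoke (min a b) (max a b) (g 0) (1 - t))))"
    using transverse_subdivision[OF ij(1) g(1) ij(2), of s] spoke(2)[OF ij(1) n] unfolding g(2) by metis
  have "freely_homotopic (punctured_surface 1) g
      (concat_paths (spoke (min a b) (max a b) (g 0)) (concat_paths w (\<lambda>t. spoke (min a b) (max a b) (g 0) (1 - t))))"
    using w(5) unfolding path_homotopic_def freely_homotopic_def by (rule homotopic_with_mono) auto
  moreover have "freely_homotopic (punctured_surface 1)
      (concat_paths (spoke (min a b) (max a b) (g 0)) (concat_paths w (\<lambda>t. spoke (min a b) (max a b) (g 0) (1 - t)))) w"
    using w spoke(4)[OF ij(1) n] by (intro conjugate_freely_homotopic) auto
  ultimately have "freely_homotopic (punctured_surface 1) g w"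
    unfolding freely_homotopic_def by (rule homotopic_with_trans)
  with w(2) show ?thesis by blast
qed

text \<open>The same coefficients express the holonomy of the segment through the vectors
  \<open>edge_vec\<close> and its intersection number through the counts
  \<open>turns\<close>.\<close>

definition edge_coeff :: "side \<Rightarrow> int \<Rightarrow> int \<Rightarrow> int \<Rightarrow> real" where
  "edge_coeff s a b n = (if n \<in> {min a b..<max a b} then sgn_side s * edge_direction a b else 0)"

text \<open>A transverse representative exists, and every such representative gives the same value
  because \<open>turns\<close> is invariant under free homotopy. This settles both parts of the
  definite description.\<close>

lemma loop_edge_intersection:
  assumes g: "pathin (punctured_surface 1) g" "g 1 = g 0" and ab: "a \<noteq> b"
    and M: "finite M" "support g \<subseteq> M"
  shows "loop_edge_intersection g (edge_path s a b) = (\<Sum>n\<in>M. edge_coeff s a b n * turns g n)"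
proof -
  let ?X = "punctured_surface 1" and ?e = "edge_path s a b"
  have "(\<Sum>n\<in>M. edge_coeff s a b n * turns g n) =
      (\<Sum>n\<in>M \<inter> {min a b..<max a b}. sgn_side s * edge_direction a b * turns g n)"
    using M(1) by (simp add: edge_coeff_def sum.inter_restrict if_distrib[of "\<lambda>x. x * _"] cong: if_cong)
  also have "\<dots> = (\<Sum>n\<in>{min a b..<max a b}. sgn_side s * edge_direction a b * turns g n)"
  proof (rule sum.mono_neutral_left)
    show "\<forall>n\<in>{min a b..<max a b} - M \<inter> {min a b..<max a b}. sgn_side s * edge_direction a b * turns g n = 0"
      using M(2) turns_support[of _ g] by auto
  qed auto
  finally have S: "(\<Sum>n\<in>M. edge_coeff s a b n * turns g n) =
      sgn_side s * edge_direction a b * (\<Sum>n\<in>{min a b..<max a b}. turns g n)"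
    by (simp add: sum_distrib_left)
  have val: "(\<Sum>t\<in>crossings f ?e. crossing_sign (holonomy 1 ?e) f t) = (\<Sum>n\<in>M. edge_coeff s a b n * turns g n)"
    if f: "freely_homotopic ?X g f" "transverse f ?e" for f
  proof -
    have "pathin ?X f" "f 1 = f 0"
      using homotopic_with_imp_continuous_maps homotopic_with_imp_property f(1)
      unfolding freely_homotopic_def pathin_def by blast+
    from transverse_crossing_sum[OF this ab f(2)] show ?thesis
      unfolding S using turns_free_homotopy[OF f(1)] by simp
  qed
  show ?thesis
    unfolding loop_edge_intersection_def
  proof (rule the_equality)
    show "\<exists>f. freely_homotopic ?X g f \<and> transverse f ?e \<and>
        (\<Sum>n\<in>M. edge_coeff s a b n * turns g n) = (\<Sum>t\<in>crossings f ?e. crossing_sign (holonomy 1 ?e) f t)"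
      using exists_transverse_representative[OF g ab, of s] val by metis
  qed (use val in auto)
qed

section \<open>The intersection formula\<close>

lemma lookup_scaleR [simp]:
  "Poly_Mapping.lookup (r *\<^sub>R x) g = r *\<^sub>R Poly_Mapping.lookup (x :: 'g \<Rightarrow>\<^sub>0 'v::real_vector) g"
proof -
  have "{i. r *\<^sub>R Poly_Mapping.lookup x i \<noteq> 0} \<subseteq> {i. Poly_Mapping.lookup x i \<noteq> 0}" by auto
  then have "finite {i. r *\<^sub>R Poly_Mapping.lookup x i \<noteq> 0}"
    using finite_subset finite_lookup by blast
  then show ?thesis by (simp add: scaleR_poly_mapping_def)
qed

lemma lin_ext_superset:
  assumes "finite K" "Poly_Mapping.keys x \<subseteq> K"
  shows "lin_ext f x = (\<Sum>g\<in>K. Poly_Mapping.lookup x g *\<^sub>R f g)"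
  unfolding lin_ext_def using assms by (intro sum.mono_neutral_left) (auto simp: in_keys_iff)

lemma linear_lin_ext: "linear (lin_ext f)"
proof (rule linearI)
  fix x y :: "'a \<Rightarrow>\<^sub>0 real" and r :: real
  let ?K = "Poly_Mapping.keys x \<union> Poly_Mapping.keys y"
  have "Poly_Mapping.keys (x + y) \<subseteq> ?K" by (rule keys_add)
  then show "lin_ext f (x + y) = lin_ext f x + lin_ext f y"
    by (simp add: lin_ext_superset[of ?K] lookup_add scaleR_add_left sum.distrib)
  have "Poly_Mapping.keys (r *\<^sub>R x) \<subseteq> Poly_Mapping.keys x"
    by (auto simp: in_keys_iff)
  then show "lin_ext f (r *\<^sub>R x) = r *\<^sub>R lin_ext f x"
    by (simp add: lin_ext_superset[of "Poly_Mapping.keys x"] scaleR_sum_right)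
qed

lemma lin_ext_single [simp]: "lin_ext f (Poly_Mapping.single g 1) = f g"
  by (simp add: lin_ext_def)

lemma lin_ext_span_eq_0:
  assumes "y \<in> span S" "\<And>x. x \<in> S \<Longrightarrow> lin_ext f x = 0"
  shows "lin_ext f y = 0"
  using linear_eq_0_on_span[OF linear_lin_ext assms(2) assms(1)] .

lemma keys_span_singles:
  assumes "x \<in> span ((\<lambda>g. Poly_Mapping.single g (1::real)) ` G)"
  shows "Poly_Mapping.keys x \<subseteq> G"
  using assms
proof (induction rule: span_induct_alt)
  case (step c x y)
  then obtain g where g: "g \<in> G" "x = Poly_Mapping.single g 1" by blast
  have "Poly_Mapping.keys (c *\<^sub>R x) \<subseteq> {g}"
    by (auto simp: g(2) in_keys_iff lookup_single when_def split: if_splits)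
  then show ?case using keys_add[of "c *\<^sub>R x" y] step g by blast
qed simp

lemma presented_spaceE:
  assumes "\<xi> \<in> presented_space G R"
  obtains x where "Poly_Mapping.keys x \<subseteq> G" "x \<in> span ((\<lambda>g. Poly_Mapping.single g 1) ` G)" "\<xi> = (\<lambda>y. x + y) ` span R"
  using assms keys_span_singles unfolding presented_space_def by blast

lemma lin_ext_coset:
  assumes "\<xi> = (\<lambda>y. x + y) ` span R" "\<And>y. y \<in> R \<Longrightarrow> lin_ext f y = 0" "z \<in> \<xi>"
  shows "lin_ext f z = lin_ext f x"
proof -
  obtain y where "z = x + y" "y \<in> span R" using assms(1,3) by blast
  then show ?thesis
    using lin_ext_span_eq_0[OF _ assms(2)] linear_add[OF linear_lin_ext] by (metis add.right_neutral)
qed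

lemma the_elem_eqI: "v \<in> S \<Longrightarrow> (\<And>u. u \<in> S \<Longrightarrow> u = v) \<Longrightarrow> the_elem S = v"
  by (metis empty_iff insertI1 subset_singletonD subsetI singletonD the_elem_eq)

section \<open>The integral for one loop and one edge\<close>

lemma has_integral_cos_int:
  "((\<lambda>t. cos (of_int k * t)) has_integral (if k = 0 then pi else 0)) {0..pi}"
proof (cases "k = 0")
  case True
  then show ?thesis using has_integral_const_real[of "1::real" 0 pi] by simp
next
  case False
  have "((\<lambda>t. cos (of_int k * t)) has_integral (sin (of_int k * pi) / of_int k - sin (of_int k * 0) / of_int k)) {0..pi}"
  proof (rule fundamental_theorem_of_calculus)
    show "((\<lambda>t. sin (of_int k * t) / of_int k) has_vector_derivative cos (of_int k * t)) (at t within {0..pi})" for t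
      using False by (auto intro!: derivative_eq_intros simp flip: has_real_derivative_iff_has_vector_derivative)
  qed simp
  moreover have "sin (of_int k * pi) = 0" by (simp add: sin_times_pi_eq_0)
  ultimately show ?thesis using False by simp
qed

text \<open>The products of sines and cosines combine to \<open>2 * cos (a - b) * sin t\<close>. The
  last term stems from the constant 2 in the second coordinate of \<open>edge_sum\<close>, the sum
  of the constants 1 in \<open>1 - cos\<close> at two vertices; therefore it does not involve
  \<open>m\<close>.\<close>

lemma wedge_edge_sum_edge_vec:
  assumes "sin t \<noteq> 0"
  shows "wedge (edge_sum (cos t) m) (edge_vec (cos t) n) * (1 - cos t) =
    2 * cos (of_int (m - n) * t) - 2 * (sin (of_int (n + 1) * t) - sin (of_int n * t)) / sin t"
proof -
  have c: "1 - cos t \<noteq> 0" using assms by (metis cos_one_sin_zero eq_iff_diff_eq_0)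
  define a b where "a = of_int m * t" and "b = of_int n * t"
  have A: "of_int (m + 1) * t = a + t" and B: "of_int (n + 1) * t = b + t" and AB: "of_int (m - n) * t = a - b"
    by (simp_all add: a_def b_def algebra_simps)
  have key: "(sin a + sin (a + t)) * (cos b - cos (b + t)) -
      (2 - cos a - cos (a + t)) * (sin (b + t) - sin b) =
      2 * cos (a - b) * sin t - 2 * (sin (b + t) - sin b)"
  proof -
    have s: "(sin t)\<^sup>2 = 1 - (cos t)\<^sup>2" by (simp add: sin_squared_eq)
    have "(sin a + sin (a + t)) * (cos b - cos (b + t)) + (cos a + cos (a + t)) * (sin (b + t) - sin b)
       = (sin a * cos b - cos a * sin b) + (cos a * sin (b + t) - sin a * cos (b + t))
         + (sin (a + t) * cos b - cos (a + t) * sin b) - (sin (a + t) * cos (b + t) - cos (a + t) * sin (b + t))"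
      by (simp add: algebra_simps)
    also have "\<dots> = sin (a - b) + sin (b + t - a) + sin (a + t - b) - sin (a + t - (b + t))"
      by (simp only: sin_diff) (simp add: algebra_simps)
    also have "\<dots> = sin (t - (a - b)) + sin (t + (a - b))"
      by (simp add: algebra_simps)
    also have "\<dots> = 2 * cos (a - b) * sin t"
      by (simp only: sin_add sin_diff[of t]) simp
    finally show ?thesis by (simp add: algebra_simps)
  qed
  have combine: "((P / s) * (S / d) - (Q / d) * (R / s)) * d = (P * S - Q * R) / s"
    if "s \<noteq> 0" "d \<noteq> 0" for P Q R S s d :: real
    using that by (simp add: field_simps)
  have "fst (edge_sum (cos t) m) = (sin a + sin (a + t)) / sin t"
    "snd (edge_sum (cos t) m) = (2 - cos a - cos (a + t)) / (1 - cos t)"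
    "fst (edge_vec (cos t) n) = (sin (b + t) - sin b) / sin t"
    "snd (edge_vec (cos t) n) = (cos b - cos (b + t)) / (1 - cos t)"
    unfolding edge_sum_def edge_vec_def fst_add snd_add fst_diff snd_diff vtx_cos[OF assms] A B
    unfolding a_def[symmetric] b_def[symmetric] by (simp_all flip: add_divide_distrib diff_divide_distrib)
  then have "wedge (edge_sum (cos t) m) (edge_vec (cos t) n) * (1 - cos t) =
      ((sin a + sin (a + t)) * (cos b - cos (b + t)) - (2 - cos a - cos (a + t)) * (sin (b + t) - sin b)) / sin t"
    using combine[OF assms c] by (simp add: wedge_def)
  also have "\<dots> = 2 * cos (of_int (m - n) * t) - 2 * (sin (of_int (n + 1) * t) - sin (of_int n * t)) / sin t"
    unfolding key AB B unfolding b_def[symmetric] using assms by (simp add: field_simps)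
  finally show ?thesis .
qed

definition loop_poly :: "(int \<Rightarrow> real) \<Rightarrow> int set \<Rightarrow> real poly \<times> real poly" where
  "loop_poly \<tau> M = (\<Sum>m\<in>M. smult (\<tau> m) (fst (vtx_poly m) + fst (vtx_poly (m + 1))),
                   \<Sum>m\<in>M. smult (\<tau> m) (snd (vtx_poly m) + snd (vtx_poly (m + 1))))"

definition edge_poly :: "side \<Rightarrow> int \<Rightarrow> int \<Rightarrow> real poly \<times> real poly" where
  "edge_poly s a b = (smult (sgn_side s) (fst (vtx_poly b) - fst (vtx_poly a)),
                      smult (sgn_side s) (snd (vtx_poly b) - snd (vtx_poly a)))"

definition poly_pair :: "real poly \<times> real poly \<Rightarrow> real \<Rightarrow> real \<times> real" where
  "poly_pair u c = (poly (fst u) c, poly (snd u) c)"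

lemma poly_wedge: "poly (wedge u v) c = wedge (poly_pair u c) (poly_pair v c)"
  by (simp add: wedge_def poly_pair_def)

lemma sum_Pair: "(\<Sum>x\<in>A. (f x, g x)) = (\<Sum>x\<in>A. f x, \<Sum>x\<in>A. g x)"
  by (induction A rule: infinite_finite_induct) (auto simp: zero_prod_def)

lemma poly_pair_loop_poly: "poly_pair (loop_poly \<tau> M) c = (\<Sum>m\<in>M. \<tau> m *\<^sub>R edge_sum c m)"
  by (simp add: poly_pair_def loop_poly_def poly_sum edge_sum_def vtx_poly sum_Pair)

lemma poly_pair_edge_poly: "poly_pair (edge_poly s a b) c = vertex c s b - vertex c s a"
  by (simp add: poly_pair_def edge_poly_def vertex_sgn vtx_poly right_diff_distrib)

lemma vertex_diff_edge_vec:
  assumes "a \<noteq> b"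
  shows "vertex c s b - vertex c s a = (\<Sum>n\<in>{min a b..<max a b}. edge_coeff s a b n *\<^sub>R edge_vec c n)"
proof -
  have *: "(\<Sum>n\<in>{i..<j}. edge_vec c n) = vtx c j - vtx c i" if "i \<le> j" for i j
    using that
  proof (induction j rule: int_ge_induct)
    case (step j)
    then have "{i..<j + 1} = insert j {i..<j}" by auto
    then show ?case using step by (simp add: edge_vec_def)
  qed simp
  have "(\<Sum>n\<in>{min a b..<max a b}. edge_coeff s a b n *\<^sub>R edge_vec c n) =
      (sgn_side s * edge_direction a b) *\<^sub>R (\<Sum>n\<in>{min a b..<max a b}. edge_vec c n)"
    by (simp add: edge_coeff_def scaleR_sum_right)
  also have "\<dots> = (sgn_side s * edge_direction a b) *\<^sub>R (vtx c (max a b) - vtx c (min a b))"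
    by (subst *) auto
  also have "\<dots> = vertex c s b - vertex c s a"
    using assms by (auto simp: vertex_sgn edge_direction_def min_def max_def algebra_simps)
  finally show ?thesis by simp
qed

lemma wedge_sum_left: "wedge (\<Sum>x\<in>A. f x *\<^sub>R u x) v = (\<Sum>x\<in>A. f x * wedge (u x) v)"
  for u :: "'a \<Rightarrow> real \<times> real"
  by (induction A rule: infinite_finite_induct) (auto simp: wedge_def algebra_simps)

lemma wedge_sum_right: "wedge v (\<Sum>x\<in>A. f x *\<^sub>R u x) = (\<Sum>x\<in>A. f x * wedge v (u x))"
  for u :: "'a \<Rightarrow> real \<times> real"
  by (induction A rule: infinite_finite_induct) (auto simp: wedge_def algebra_simps)

text \<open>Away from the endpoints the integrand equals a finite sum of cosines, in which only the
  terms with \<open>m = n\<close> have a nonzero integral. A summand for \<open>n\<close> outside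
  \<open>M\<close> vanishes on both sides.\<close>

lemma has_integral_wedge_loop_edge:
  assumes M: "finite M" "\<And>m. m \<notin> M \<Longrightarrow> \<tau> m = 0" and sum0: "(\<Sum>m\<in>M. \<tau> m) = 0" and ab: "a \<noteq> b"
  shows "((\<lambda>t. poly (wedge (loop_poly \<tau> M) (edge_poly s a b)) (cos t) * (1 - cos t)) has_integral
    2 * pi * (\<Sum>n\<in>{min a b..<max a b}. edge_coeff s a b n * \<tau> n)) {0..pi}"
proof -
  let ?J = "{min a b..<max a b}" and ?k = "edge_coeff s a b"
  let ?F = "\<lambda>t. \<Sum>n\<in>?J. \<Sum>m\<in>M. ?k n * \<tau> m * 2 * cos (of_int (m - n) * t)"
  have "((\<lambda>t. ?F t) has_integral (\<Sum>n\<in>?J. \<Sum>m\<in>M. ?k n * \<tau> m * 2 * (if m - n = 0 then pi else 0))) {0..pi}"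
    using M(1) by (intro has_integral_sum has_integral_mult_right has_integral_cos_int) auto
  moreover have "(\<Sum>m\<in>M. ?k n * \<tau> m * 2 * (if m - n = 0 then pi else 0)) = 2 * pi * (?k n * \<tau> n)" for n
  proof -
    have "(\<Sum>m\<in>M. ?k n * \<tau> m * 2 * (if m - n = 0 then pi else 0)) = (\<Sum>m\<in>M. if m = n then 2 * pi * (?k n * \<tau> n) else 0)"
      by (intro sum.cong) auto
    also have "\<dots> = 2 * pi * (?k n * \<tau> n)" using M by (cases "n \<in> M") auto
    finally show ?thesis .
  qed
  ultimately have F: "(?F has_integral 2 * pi * (\<Sum>n\<in>?J. ?k n * \<tau> n)) {0..pi}"
    by (simp add: sum_distrib_left)
  have "poly (wedge (loop_poly \<tau> M) (edge_poly s a b)) (cos t) * (1 - cos t) = ?F t" if t: "t \<in> {0..pi} - {0, pi}" for t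
  proof -
    have "0 < sin t" using t by (intro sin_gt_zero) auto
    then have st: "sin t \<noteq> 0" by simp
    let ?c = "cos t"
    let ?K = "\<lambda>n. 2 * (sin (of_int (n + 1) * t) - sin (of_int n * t)) / sin t"
    have "poly (wedge (loop_poly \<tau> M) (edge_poly s a b)) ?c * (1 - ?c) =
        (\<Sum>n\<in>?J. ?k n * (\<Sum>m\<in>M. \<tau> m * wedge (edge_sum ?c m) (edge_vec ?c n))) * (1 - ?c)"
      unfolding poly_wedge poly_pair_loop_poly poly_pair_edge_poly vertex_diff_edge_vec[OF ab]
        wedge_sum_right wedge_sum_left ..
    also have "\<dots> = (\<Sum>n\<in>?J. ?k n * (\<Sum>m\<in>M. \<tau> m * (wedge (edge_sum ?c m) (edge_vec ?c n) * (1 - ?c))))"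
      by (simp add: sum_distrib_right sum_distrib_left mult.assoc)
    also have "\<dots> = (\<Sum>n\<in>?J. ?k n * ((\<Sum>m\<in>M. \<tau> m * (2 * cos (of_int (m - n) * t))) - (\<Sum>m\<in>M. \<tau> m) * ?K n))"
      unfolding wedge_edge_sum_edge_vec[OF st]
      by (simp only: right_diff_distrib sum_subtractf sum_distrib_right)
    also have "\<dots> = ?F t"
      unfolding sum0 by (simp add: sum_distrib_left mult.assoc mult.left_commute)
    finally show ?thesis .
  qed
  \<comment> \<open>At 0 and \<open>pi\<close> the trigonometric form of the vertices would divide
    by \<open>sin t = 0\<close>; two points do not affect the integral.\<close>
  then show ?thesis
    by (intro has_integral_spike_finite[OF _ _ F, of "{0, pi}"]) auto
qed

text \<open>A polynomial is determined by its values on \<open>c >= 1\<close>, an infinite set. This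
  carries the holonomy from the geometric range over to \<open>c = cos t\<close>.\<close>

lemma polynomial_form_eqI:
  assumes "\<And>c. 1 \<le> c \<Longrightarrow> F c = poly_pair u c"
  shows "polynomial_form F = u"
  unfolding polynomial_form_def
proof (rule the_equality)
  show "\<forall>c\<ge>1. (poly (fst u) c, poly (snd u) c) = F c" using assms by (simp add: poly_pair_def)
  fix v assume v: "\<forall>c\<ge>1. (poly (fst v) c, poly (snd v) c) = F c"
  have eqI: "p = q" if "\<And>c. 1 \<le> c \<Longrightarrow> poly p c = poly q c" for p q :: "real poly"
  proof (rule ccontr)
    assume "p \<noteq> q"
    then have "finite {x. poly (p - q) x = 0}" by (intro poly_roots_finite) simp
    moreover have "{1..} \<subseteq> {x. poly (p - q) x = 0}" using that by auto
    ultimately show False using infinite_Ici finite_subset by blast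
  qed
  have "poly (fst v) c = poly (fst u) c" "poly (snd v) c = poly (snd u) c" if "1 \<le> c" for c
    using v assms[OF that] that by (auto simp: poly_pair_def)
  then show "v = u" by (intro prod_eqI eqI)
qed

section \<open>Counts attached to homology classes\<close>

lemma abelianization_loops:
  assumes b: "b \<in> topspace X" and A: "A \<in> carrier (abelianization (fundamental_group X b))"
  shows "\<Union>A \<subseteq> based_loops X b"
    and "B \<in> carrier (abelianization (fundamental_group X b)) \<Longrightarrow>
      \<Union>(A \<otimes>\<^bsub>abelianization (fundamental_group X b)\<^esub> B) \<subseteq> based_loops X b"
proof -
  let ?G = "fundamental_group X b"
  interpret G: group ?G by (rule group_fundamental_group[OF b])
  have carr: "C \<in> carrier ?G" if "C \<in> D" "D \<in> carrier (abelianization ?G)" for C D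
    using that G.derived_in_carrier[of "carrier ?G"]
    by (auto simp: abelianization_def FactGroup_def RCOSETS_def r_coset_def)
  have loops: "C \<subseteq> based_loops X b" if "C \<in> carrier ?G" for C
    using that path_homotopic_imp by (fastforce simp: carrier_fundamental_group in_loop_class based_loops_def)
  show "\<Union>A \<subseteq> based_loops X b" using carr[OF _ A] loops by blast
  show "\<Union>(A \<otimes>\<^bsub>abelianization ?G\<^esub> B) \<subseteq> based_loops X b" if B: "B \<in> carrier (abelianization ?G)"
  proof -
    have "C \<otimes>\<^bsub>?G\<^esub> D \<in> carrier ?G" if "C \<in> A" "D \<in> B" for C D
      using carr[OF that(1) A] carr[OF that(2) B] by simp
    moreover have "A \<otimes>\<^bsub>abelianization ?G\<^esub> B = {C \<otimes>\<^bsub>?G\<^esub> D |C D. C \<in> A \<and> D \<in> B}"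
      by (auto simp: abelianization_def FactGroup_def set_mult_def)
    ultimately show ?thesis using loops by blast
  qed
qed

lemma loop_hom_turns: "loop_hom (punctured_surface 1) b (\<lambda>g. turns g m)"
  unfolding loop_hom_def
proof (intro conjI allI impI ballI)
  fix f g assume "path_homotopic (punctured_surface 1) b b f g"
  then have "freely_homotopic (punctured_surface 1) f g"
    unfolding path_homotopic_def freely_homotopic_def by (rule homotopic_with_mono) auto
  then show "turns f m = turns g m" by (rule turns_free_homotopy)
next
  fix f g assume "f \<in> based_loops (punctured_surface 1) b" "g \<in> based_loops (punctured_surface 1) b"
  then show "turns (concat_paths f g) m = turns f m + turns g m"
    by (intro turns_concat pathin_concat) (auto simp: based_loops_def)
qed

lemma on_coset_eqI:
  assumes "\<Union>A \<noteq> {}" "\<And>f. f \<in> \<Union>A \<Longrightarrow> F f = v"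
  shows "on_coset F A = v"
  unfolding on_coset_def using assms by (intro the_elem_eqI) auto

definition class_turns :: "(real \<Rightarrow> point) set set \<Rightarrow> int \<Rightarrow> real" where
  "class_turns A m = on_coset (\<lambda>g. turns g m) A"

definition class_support :: "(real \<Rightarrow> point) set set \<Rightarrow> int set" where
  "class_support A = {m. class_turns A m \<noteq> 0}"

context
  fixes b :: point
  assumes base: "b \<in> topspace (punctured_surface 1)"
begin

abbreviation homology_classes :: "(real \<Rightarrow> point) set set monoid" where
  "homology_classes \<equiv> abelianization (fundamental_group (punctured_surface 1) b)"

lemma class_turns:
  assumes A: "A \<in> carrier homology_classes"
  shows "\<Union>A \<noteq> {}" "\<And>f m. f \<in> \<Union>A \<Longrightarrow> turns f m = class_turns A m"
proof -
  obtain g where g: "g \<in> \<Union>A" "\<And>(F :: (real \<Rightarrow> point) \<Rightarrow> real) f. loop_hom (punctured_surface 1) b F \<Longrightarrow> f \<in> \<Union>A \<Longrightarrow> F f = F g"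
    using abelianization_representative[OF base A, where ?'v = real] by blast
  then show ne: "\<Union>A \<noteq> {}" by blast
  have eq: "turns f m = turns g m" if "f \<in> \<Union>A" for f m
    using g(2)[OF loop_hom_turns that] .
  show "turns f m = class_turns A m" if "f \<in> \<Union>A" for f m
    unfolding class_turns_def using on_coset_eqI[OF ne, of "\<lambda>g. turns g m" "turns g m"] eq that by simp
qed

lemma class_turns_mult:
  assumes A: "A \<in> carrier homology_classes" and B: "B \<in> carrier homology_classes"
  shows "\<Union>(A \<otimes>\<^bsub>homology_classes\<^esub> B) \<noteq> {}"
    "\<And>f m. f \<in> \<Union>(A \<otimes>\<^bsub>homology_classes\<^esub> B) \<Longrightarrow> turns f m = class_turns A m + class_turns B m"
proof -
  obtain f g where fg: "f \<in> \<Union>A" "g \<in> \<Union>B" using class_turns(1)[OF A] class_turns(1)[OF B] by blast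
  show "\<Union>(A \<otimes>\<^bsub>homology_classes\<^esub> B) \<noteq> {}"
    by (rule abelianization_mult_representative(1)[OF base A B loop_hom_turns fg])
  fix k m assume "k \<in> \<Union>(A \<otimes>\<^bsub>homology_classes\<^esub> B)"
  from abelianization_mult_representative(2)[OF base A B loop_hom_turns fg this]
  show "turns k m = class_turns A m + class_turns B m"
    using class_turns(2)[OF A fg(1)] class_turns(2)[OF B fg(2)] by simp
qed

lemma finite_class_support:
  assumes A: "A \<in> carrier homology_classes"
  shows "finite (class_support A)" "finite M \<Longrightarrow> class_support A \<subseteq> M \<Longrightarrow> (\<Sum>m\<in>M. class_turns A m) = 0"
proof -
  obtain f where f: "f \<in> \<Union>A" using class_turns(1)[OF A] by blast
  then have "f \<in> based_loops (punctured_surface 1) b" using abelianization_loops(1)[OF base A] by blast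
  then have f': "pathin (punctured_surface 1) f" "f 1 = f 0" by (auto simp: based_loops_def)
  have eq: "turns f m = class_turns A m" for m by (rule class_turns(2)[OF A f])
  have sub: "class_support A \<subseteq> support f"
    using turns_support[of _ f] eq by (auto simp: class_support_def)
  then show "finite (class_support A)" using finite_support[OF f'(1)] finite_subset by blast
  assume M: "finite M" "class_support A \<subseteq> M"
  have fin: "finite (M \<union> support f)" using M finite_support[OF f'(1)] by simp
  have "(\<Sum>m\<in>M. class_turns A m) = (\<Sum>m\<in>M \<union> support f. class_turns A m)"
    using fin M(2) by (intro sum.mono_neutral_left) (auto simp: class_support_def)
  also have "\<dots> = 0" using sum_turns_closed[OF f' fin] eq by simp
  finally show "(\<Sum>m\<in>M. class_turns A m) = 0" .
qed

end

lemma loop_edge_intersection_interval: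
  assumes g: "g \<in> based_loops (punctured_surface 1) b" and ab: "x \<noteq> y" and \<tau>: "\<And>m. turns g m = \<tau> m"
  shows "loop_edge_intersection g (edge_path s x y) = (\<Sum>n\<in>{min x y..<max x y}. edge_coeff s x y n * \<tau> n)"
proof -
  have g': "pathin (punctured_surface 1) g" "g 1 = g 0" using g by (auto simp: based_loops_def)
  let ?M = "support g \<union> {min x y..<max x y}"
  have M: "finite ?M" using finite_support[OF g'(1)] by simp
  have "loop_edge_intersection g (edge_path s x y) = (\<Sum>n\<in>?M. edge_coeff s x y n * \<tau> n)"
    using loop_edge_intersection[OF g' ab M, of s] \<tau> by simp
  also have "\<dots> = (\<Sum>n\<in>{min x y..<max x y}. edge_coeff s x y n * \<tau> n)"
    using M by (intro sum.mono_neutral_right) (auto simp: edge_coeff_def)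
  finally show ?thesis .
qed

lemma (in canonical_lift) holonomy_based_loop:
  assumes g: "g \<in> based_loops (punctured_surface 1) b" and \<tau>: "\<And>m. turns g m = \<tau> m"
    and M: "finite M" "\<And>m. m \<notin> M \<Longrightarrow> \<tau> m = 0"
  shows "holonomy c (h \<circ> g) = (\<Sum>m\<in>M. \<tau> m *\<^sub>R edge_sum c m)"
proof -
  have g': "pathin (punctured_surface 1) g" "g 1 = g 0" using g by (auto simp: based_loops_def)
  have fin: "finite (M \<union> support g)" using finite_support[OF g'(1)] M by simp
  have "holonomy c (h \<circ> g) = (\<Sum>m\<in>M \<union> support g. \<tau> m *\<^sub>R edge_sum c m)"
    using holonomy_loop[OF g' fin] \<tau> by simp
  also have "\<dots> = (\<Sum>m\<in>M. \<tau> m *\<^sub>R edge_sum c m)"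
    using fin M(2) by (intro sum.mono_neutral_right) auto
  finally show ?thesis .
qed

lemma sum_edge_coeff:
  assumes "i < j"
  shows "(\<Sum>n\<in>{min i j..<max i j}. edge_coeff s i j n * \<tau> n) = sgn_side s * (\<Sum>n\<in>{i..<j}. \<tau> n)"
    and "(\<Sum>n\<in>{min j i..<max j i}. edge_coeff s j i n * \<tau> n) = - sgn_side s * (\<Sum>n\<in>{i..<j}. \<tau> n)"
  using assms by (simp_all add: edge_coeff_def edge_direction_def sum_distrib_left)

lemma sum_edge_coeff_reverse:
  assumes "x \<noteq> y"
  shows "(\<Sum>n\<in>{min x y..<max x y}. edge_coeff s x y n * \<tau> n) +
    (\<Sum>n\<in>{min y x..<max y x}. edge_coeff s y x n * \<tau> n) = 0"
  using assms sum_edge_coeff[of x y] sum_edge_coeff[of y x] by (cases x y rule: linorder_cases) auto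

lemma sum_edge_coeff_triangle:
  assumes "i < j" "j < k"
  shows "(\<Sum>n\<in>{min i j..<max i j}. edge_coeff s i j n * \<tau> n) +
    (\<Sum>n\<in>{min j k..<max j k}. edge_coeff s j k n * \<tau> n) +
    (\<Sum>n\<in>{min k i..<max k i}. edge_coeff s k i n * \<tau> n) = 0"
proof -
  have "{i..<k} = {i..<j} \<union> {j..<k}" "{i..<j} \<inter> {j..<k} = {}" using assms by auto
  then have "(\<Sum>n\<in>{i..<k}. \<tau> n) = (\<Sum>n\<in>{i..<j}. \<tau> n) + (\<Sum>n\<in>{j..<k}. \<tau> n)"
    by (simp add: sum.union_disjoint)
  moreover have "i < k" using assms by simp
  ultimately show ?thesis
    using sum_edge_coeff(1)[OF assms(1)] sum_edge_coeff(1)[OF assms(2)] sum_edge_coeff(2)[of i k]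
    by (simp add: algebra_simps)
qed

section \<open>Edges of a triangulation and their relators\<close>

lemma oriented_edgesE:
  assumes "e \<in> oriented_edges \<T>" "polygonal_triangulation \<T>"
  obtains s x y where "e = edge_path s x y" "x \<noteq> y"
  using assms unfolding oriented_edges_def by blast

lemma edge_relators_cases:
  assumes "r \<in> edge_relators \<T>" and T: "polygonal_triangulation \<T>"
  obtains (reverse) s x y where "r = edge_chain s x y + edge_chain s y x" "x \<noteq> y"
      "edge_path s x y \<in> oriented_edges \<T>" "edge_path s y x \<in> oriented_edges \<T>"
    | (triangle) s i j k where "r = edge_chain s i j + edge_chain s j k + edge_chain s k i" "i < j" "j < k"
      "edge_path s i j \<in> oriented_edges \<T>" "edge_path s j k \<in> oriented_edges \<T>" "edge_path s k i \<in> oriented_edges \<T>"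
proof -
  have oriented: "edge_path s x y \<in> oriented_edges \<T>"
    if "(s, i, j, k) \<in> \<T>" "x \<in> {i, j, k}" "y \<in> {i, j, k}" "x \<noteq> y" for s i j k x y
    using that unfolding oriented_edges_def by blast
  consider (r) s x y i j k where "r = edge_chain s x y + edge_chain s y x" "(s, i, j, k) \<in> \<T>"
      "x \<in> {i, j, k}" "y \<in> {i, j, k}" "x \<noteq> y"
    | (t) s i j k where "r = edge_chain s i j + edge_chain s j k + edge_chain s k i" "(s, i, j, k) \<in> \<T>"
    using assms(1) unfolding edge_relators_def by blast
  then show ?thesis
  proof cases
    case r
    then show ?thesis using oriented[OF r(2)] by (intro reverse[of s x y]) simp_all
  next
    case t
    then have ijk: "i < j" "j < k" using T unfolding polygonal_triangulation_def by fastforce+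
    then show ?thesis using t(1) oriented[OF t(2)] by (intro triangle[of s i j k]) simp_all
  qed
qed

text \<open>Consequently every chain in a relative homology class, not only a chosen one, is
  supported on oriented edges.\<close>

lemma edge_relators_span:
  assumes "polygonal_triangulation \<T>"
  shows "span (edge_relators \<T>) \<subseteq> span ((\<lambda>e. Poly_Mapping.single e 1) ` oriented_edges \<T>)"
proof (rule span_minimal[OF _ subspace_span], rule subsetI)
  have chain: "edge_chain s x y \<in> span ((\<lambda>e. Poly_Mapping.single e 1) ` oriented_edges \<T>)"
    if "edge_path s x y \<in> oriented_edges \<T>" for s x y
    unfolding edge_chain_def using that by (intro span_base imageI)
  fix r assume "r \<in> edge_relators \<T>"
  then show "r \<in> span ((\<lambda>e. Poly_Mapping.single e 1) ` oriented_edges \<T>)"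
    using assms
  proof (cases rule: edge_relators_cases)
    case reverse
    show ?thesis unfolding reverse(1) by (intro span_add chain reverse)
  next
    case triangle
    show ?thesis unfolding triangle(1) by (intro span_add chain triangle)
  qed
qed

lemma lin_ext_edge_relators:
  fixes F :: "(real \<Rightarrow> point) \<Rightarrow> 'v::real_vector"
  assumes "r \<in> edge_relators \<T>" "polygonal_triangulation \<T>"
    and "\<And>s x y. x \<noteq> y \<Longrightarrow> F (edge_path s x y) + F (edge_path s y x) = 0"
    and "\<And>s i j k. i < j \<Longrightarrow> j < k \<Longrightarrow> F (edge_path s i j) + F (edge_path s j k) + F (edge_path s k i) = 0"
  shows "lin_ext F r = 0"
  using assms(1,2)
proof (cases rule: edge_relators_cases)
  case reverse
  then show ?thesis using assms(3) by (simp add: linear_add[OF linear_lin_ext] edge_chain_def)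
next
  case triangle
  then show ?thesis using assms(4) by (simp add: linear_add[OF linear_lin_ext] edge_chain_def)
qed

definition combine :: "'i set \<Rightarrow> ('i \<Rightarrow> real) \<Rightarrow> ('i \<Rightarrow> real poly \<times> real poly) \<Rightarrow> real poly \<times> real poly" where
  "combine K r u = (\<Sum>k\<in>K. smult (r k) (fst (u k)), \<Sum>k\<in>K. smult (r k) (snd (u k)))"

lemma poly_pair_combine: "poly_pair (combine K r u) c = (\<Sum>k\<in>K. r k *\<^sub>R poly_pair (u k) c)"
  by (simp add: poly_pair_def combine_def poly_sum sum_Pair)

lemma has_integral_wedge_combine:
  assumes K: "finite K" and L: "finite L"
    and int: "\<And>k l. k \<in> K \<Longrightarrow> l \<in> L \<Longrightarrow>
      ((\<lambda>t. poly (wedge (u k) (v l)) (cos t) * (1 - cos t)) has_integral 2 * pi * I k l) {0..pi}"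
  shows "((\<lambda>t. poly (wedge (combine K r u) (combine L q v)) (cos t) * (1 - cos t)) has_integral
    2 * pi * (\<Sum>k\<in>K. r k * (\<Sum>l\<in>L. q l * I k l))) {0..pi}"
proof -
  have "((\<lambda>t. \<Sum>k\<in>K. \<Sum>l\<in>L. r k * q l * (poly (wedge (u k) (v l)) (cos t) * (1 - cos t))) has_integral
      (\<Sum>k\<in>K. \<Sum>l\<in>L. r k * q l * (2 * pi * I k l))) {0..pi}"
    by (intro has_integral_sum K L has_integral_mult_right int)
  moreover have "(\<Sum>k\<in>K. \<Sum>l\<in>L. r k * q l * (2 * pi * I k l)) = 2 * pi * (\<Sum>k\<in>K. r k * (\<Sum>l\<in>L. q l * I k l))"
    by (simp add: sum_distrib_left mult_ac)
  moreover have "poly (wedge (combine K r u) (combine L q v)) (cos t) * (1 - cos t) =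
      (\<Sum>k\<in>K. \<Sum>l\<in>L. r k * q l * (poly (wedge (u k) (v l)) (cos t) * (1 - cos t)))" for t
  proof -
    have "poly (wedge (combine K r u) (combine L q v)) (cos t) * (1 - cos t) =
        (\<Sum>k\<in>K. r k * (\<Sum>l\<in>L. q l * poly (wedge (u k) (v l)) (cos t))) * (1 - cos t)"
      unfolding poly_wedge poly_pair_combine by (subst wedge_sum_left) (simp only: wedge_sum_right)
    then show ?thesis by (simp add: sum_distrib_left sum_distrib_right mult_ac)
  qed
  ultimately show ?thesis by simp
qed

theorem lemma12:
  fixes b :: point
    and \<T> :: "(side \<times> int \<times> int \<times> int) set"
    and h :: "real \<Rightarrow> point \<Rightarrow> point"
    and \<gamma> :: "((real \<Rightarrow> point) set set \<Rightarrow>\<^sub>0 real) set"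
    and \<sigma> :: "((real \<Rightarrow> point) \<Rightarrow>\<^sub>0 real) set"
  assumes base: "b \<in> topspace (punctured_surface 1)"
    and T: "polygonal_triangulation \<T>"
    and canonical: "\<And>c. 1 \<le> c \<Longrightarrow> canonical_homeo c (h c)"
    and \<gamma>: "\<gamma> \<in> H1_punctured b"
    and \<sigma>: "\<sigma> \<in> H1_relative \<T>"
  shows "intersection_number \<gamma> \<sigma> =
    1 / (2 * pi) * integral {0..pi}
      (\<lambda>t. poly (wedge (polynomial_form (hol_punctured h \<gamma>))
                       (polynomial_form (hol_relative h \<sigma>))) (cos t) * (1 - cos t))"
proof -
  define \<C> where "\<C> = abelianization (fundamental_group (punctured_surface 1) b)"
  define R where "R = {Poly_Mapping.single (x \<otimes>\<^bsub>\<C>\<^esub> y) (1::real) - Poly_Mapping.single x 1 - Poly_Mapping.single y 1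
        |x y. x \<in> carrier \<C> \<and> y \<in> carrier \<C>}"
  define \<iota> where "\<iota> e A = on_coset (\<lambda>g. loop_edge_intersection g e) A" for e A
  let ?ct = "class_turns" and ?cs = "class_support"
  note ct = class_turns[OF base, folded \<C>_def] and ctm = class_turns_mult[OF base, folded \<C>_def]
    and loops = abelianization_loops[OF base, folded \<C>_def] and fin = finite_class_support[OF base, folded \<C>_def]
  have "\<gamma> \<in> presented_space (carrier \<C>) R"
    using \<gamma> unfolding H1_punctured_def tensor_real_def \<C>_def R_def .
  then obtain x0 where x0: "Poly_Mapping.keys x0 \<subseteq> carrier \<C>" "\<gamma> = (\<lambda>y. x0 + y) ` span R"
    by (rule presented_spaceE)
  from \<sigma>[unfolded H1_relative_def]
  obtain y0 where y0: "Poly_Mapping.keys y0 \<subseteq> oriented_edges \<T>"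
    "y0 \<in> span ((\<lambda>g. Poly_Mapping.single g 1) ` oriented_edges \<T>)"
    "\<sigma> = (\<lambda>y. y0 + y) ` span (edge_relators \<T>)"
    by (rule presented_spaceE)
  let ?K = "Poly_Mapping.keys x0" and ?L = "Poly_Mapping.keys y0"
  have x0_in: "x0 \<in> \<gamma>" unfolding x0(2) by (rule image_eqI[of _ _ 0]) (simp_all add: span_zero)
  have y0_in: "y0 \<in> \<sigma>" unfolding y0(3) by (rule image_eqI[of _ _ 0]) (simp_all add: span_zero)
  \<comment> \<open>Additivity on classes is what makes a linear extension descend to the tensor
    product with the reals.\<close>
  have lin_R: "lin_ext F r = 0" if "r \<in> R" and add: "\<And>A B. A \<in> carrier \<C> \<Longrightarrow> B \<in> carrier \<C> \<Longrightarrow> F (A \<otimes>\<^bsub>\<C>\<^esub> B) = F A + F B"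
    for F :: "(real \<Rightarrow> point) set set \<Rightarrow> 'v::real_vector" and r
    using that(1) add by (auto simp: R_def linear_diff[OF linear_lin_ext])
  \<comment> \<open>\<open>\<iota> e\<close> is shown to be additive for oriented edges
    \<open>e\<close>, and this is applied to an arbitrary chain in the coset.\<close>
  have keys_\<sigma>: "Poly_Mapping.keys y \<subseteq> oriented_edges \<T>" if y: "y \<in> \<sigma>" for y
  proof -
    obtain z where "y = y0 + z" "z \<in> span (edge_relators \<T>)" using y unfolding y0(3) by blast
    then have "y \<in> span ((\<lambda>g. Poly_Mapping.single g 1) ` oriented_edges \<T>)"
      using y0(2) edge_relators_span[OF T] span_add by blast
    then show ?thesis by (rule keys_span_singles)
  qed
  have \<iota>: "\<iota> (edge_path s x y) A = (\<Sum>n\<in>{min x y..<max x y}. edge_coeff s x y n * ?ct A n)"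
    if A: "A \<in> carrier \<C>" and xy: "x \<noteq> y" for A s x y
    unfolding \<iota>_def
  proof (rule on_coset_eqI[OF ct(1)[OF A]])
    fix f assume f: "f \<in> \<Union>A"
    show "loop_edge_intersection f (edge_path s x y) = (\<Sum>n\<in>{min x y..<max x y}. edge_coeff s x y n * ?ct A n)"
      using loops(1)[OF A] f xy ct(2)[OF A f] by (intro loop_edge_intersection_interval[where b = b]) auto
  qed
  have \<iota>_mult: "\<iota> e (A \<otimes>\<^bsub>\<C>\<^esub> B) = \<iota> e A + \<iota> e B"
    if A: "A \<in> carrier \<C>" and B: "B \<in> carrier \<C>" and e: "e \<in> oriented_edges \<T>" for A B e
  proof -
    obtain s x y where e: "e = edge_path s x y" "x \<noteq> y" using oriented_edgesE[OF e T] .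
    have "\<iota> e (A \<otimes>\<^bsub>\<C>\<^esub> B) = (\<Sum>n\<in>{min x y..<max x y}. edge_coeff s x y n * (?ct A n + ?ct B n))"
      unfolding \<iota>_def e(1)
    proof (rule on_coset_eqI[OF ctm(1)[OF A B]])
      fix f assume f: "f \<in> \<Union>(A \<otimes>\<^bsub>\<C>\<^esub> B)"
      show "loop_edge_intersection f (edge_path s x y) = (\<Sum>n\<in>{min x y..<max x y}. edge_coeff s x y n * (?ct A n + ?ct B n))"
        using loops(2)[OF A B] f e(2) ctm(2)[OF A B f] by (intro loop_edge_intersection_interval[where b = b]) auto
    qed
    then show ?thesis unfolding e(1) \<iota>[OF A e(2)] \<iota>[OF B e(2)] by (simp add: distrib_left sum.distrib)
  qed
  \<comment> \<open>The pairing evaluated on the fixed representatives \<open>x0\<close> and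
    \<open>y0\<close>. Both the intersection number and the integral are compared with it.\<close>
  define V where "V = (\<Sum>A\<in>?K. Poly_Mapping.lookup x0 A * (\<Sum>e\<in>?L. Poly_Mapping.lookup y0 e * \<iota> e A))"
  \<comment> \<open>With \<open>y\<close> fixed, \<open>x\<close> is replaced by \<open>x0\<close>;
    then \<open>y\<close> is replaced by \<open>y0\<close> for each class in the support of
    \<open>x0\<close> separately.\<close>
  have number: "lin_ext (\<lambda>A. lin_ext (\<lambda>e. \<iota> e A) y) x = V" if x: "x \<in> \<gamma>" and y: "y \<in> \<sigma>" for x y
  proof -
    have "lin_ext (\<lambda>e. \<iota> e (A \<otimes>\<^bsub>\<C>\<^esub> B)) y = lin_ext (\<lambda>e. \<iota> e A) y + lin_ext (\<lambda>e. \<iota> e B) y"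
      if "A \<in> carrier \<C>" "B \<in> carrier \<C>" for A B
      unfolding lin_ext_def sum.distrib[symmetric]
      using keys_\<sigma>[OF y] by (intro sum.cong refl) (auto simp: \<iota>_mult[OF that] algebra_simps)
    then have "lin_ext (\<lambda>A. lin_ext (\<lambda>e. \<iota> e A) y) x = lin_ext (\<lambda>A. lin_ext (\<lambda>e. \<iota> e A) y) x0"
      by (intro lin_ext_coset[OF x0(2) _ x] lin_R)
    also have "\<dots> = (\<Sum>A\<in>?K. Poly_Mapping.lookup x0 A *\<^sub>R lin_ext (\<lambda>e. \<iota> e A) y0)"
      unfolding lin_ext_def[of _ x0]
    proof (intro sum.cong refl)
      fix A assume "A \<in> ?K"
      then have A: "A \<in> carrier \<C>" using x0(1) by blast
      have "lin_ext (\<lambda>e. \<iota> e A) y = lin_ext (\<lambda>e. \<iota> e A) y0"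
      proof (rule lin_ext_coset[OF y0(3) _ y])
        fix r assume "r \<in> edge_relators \<T>"
        then show "lin_ext (\<lambda>e. \<iota> e A) r = 0"
          using T
        proof (rule lin_ext_edge_relators)
          show "\<iota> (edge_path s x y) A + \<iota> (edge_path s y x) A = 0" if "x \<noteq> y" for s x y
            using that by (simp only: \<iota>[OF A] sum_edge_coeff_reverse not_sym simp_thms)
          show "\<iota> (edge_path s i j) A + \<iota> (edge_path s j k) A + \<iota> (edge_path s k i) A = 0" if "i < j" "j < k" for s i j k
          proof -
            have "i \<noteq> j" "j \<noteq> k" "k \<noteq> i" using that by auto
            from this[THEN \<iota>[OF A]] show ?thesis
              using sum_edge_coeff_triangle[OF that, of s "?ct A"] by simp
          qed
        qed
      qed
      then show "Poly_Mapping.lookup x0 A *\<^sub>R lin_ext (\<lambda>e. \<iota> e A) y = Poly_Mapping.lookup x0 A *\<^sub>R lin_ext (\<lambda>e. \<iota> e A) y0"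
        by simp
    qed
    also have "\<dots> = V" by (simp add: V_def lin_ext_def)
    finally show ?thesis .
  qed
  have intersection: "intersection_number \<gamma> \<sigma> = V"
    unfolding intersection_number_def \<iota>_def[symmetric]
  proof (rule the_elem_eqI)
    have "V = lin_ext (\<lambda>A. lin_ext (\<lambda>e. \<iota> e A) y0) x0" by (rule number[OF x0_in y0_in, symmetric])
    then show "V \<in> {lin_ext (\<lambda>A. lin_ext (\<lambda>e. \<iota> e A) y) x |x y. x \<in> \<gamma> \<and> y \<in> \<sigma>}"
      using x0_in y0_in by blast
  qed (use number in blast)
  define u where "u A = loop_poly (?ct A) (?cs A)" for A
  have hol_\<gamma>: "hol_punctured h \<gamma> c = poly_pair (combine ?K (Poly_Mapping.lookup x0) u) c" if c: "1 \<le> c" for c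
  proof -
    obtain H where "canonical_lift c (h c) H" using canonical_homeo_lift[OF c canonical[OF c]] by blast
    then interpret canonical_lift c "h c" H .
    let ?F = "on_coset (\<lambda>g. holonomy c (h c \<circ> g))"
    \<comment> \<open>The index set may be any finite superset of the support, so that two classes
      can be summed over a common set.\<close>
    have F: "?F A = (\<Sum>m\<in>M. ?ct A m *\<^sub>R edge_sum c m)"
      if A: "A \<in> carrier \<C>" and M: "finite M" "?cs A \<subseteq> M" for A M
    proof (rule on_coset_eqI[OF ct(1)[OF A]])
      fix f assume f: "f \<in> \<Union>A"
      show "holonomy c (h c \<circ> f) = (\<Sum>m\<in>M. ?ct A m *\<^sub>R edge_sum c m)"
        using loops(1)[OF A] f ct(2)[OF A f] M
        by (intro holonomy_based_loop[where b = b]) (auto simp: class_support_def)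
    qed
    have mult: "?F (A \<otimes>\<^bsub>\<C>\<^esub> B) = ?F A + ?F B" if A: "A \<in> carrier \<C>" and B: "B \<in> carrier \<C>" for A B
    proof -
      let ?M = "?cs A \<union> ?cs B"
      have M: "finite ?M" using fin(1)[OF A] fin(1)[OF B] by simp
      have "?F (A \<otimes>\<^bsub>\<C>\<^esub> B) = (\<Sum>m\<in>?M. (?ct A m + ?ct B m) *\<^sub>R edge_sum c m)"
      proof (rule on_coset_eqI[OF ctm(1)[OF A B]])
        fix f assume f: "f \<in> \<Union>(A \<otimes>\<^bsub>\<C>\<^esub> B)"
        show "holonomy c (h c \<circ> f) = (\<Sum>m\<in>?M. (?ct A m + ?ct B m) *\<^sub>R edge_sum c m)"
          using loops(2)[OF A B] f ctm(2)[OF A B f] M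
          by (intro holonomy_based_loop[where b = b]) (auto simp: class_support_def)
      qed
      also have "\<dots> = ?F A + ?F B"
        unfolding F[OF A M Un_upper1] F[OF B M Un_upper2] by (simp add: scaleR_add_left sum.distrib)
      finally show ?thesis .
    qed
    have val: "lin_ext ?F x = lin_ext ?F x0" if "x \<in> \<gamma>" for x
      using mult by (intro lin_ext_coset[OF x0(2) _ that] lin_R)
    have "hol_punctured h \<gamma> c = lin_ext ?F x0"
      unfolding hol_punctured_def by (rule the_elem_eqI[OF imageI[OF x0_in]]) (use val in blast)
    also have "\<dots> = (\<Sum>A\<in>?K. Poly_Mapping.lookup x0 A *\<^sub>R poly_pair (u A) c)"
      unfolding lin_ext_def
    proof (intro sum.cong refl)
      fix A assume "A \<in> ?K"
      then have A: "A \<in> carrier \<C>" using x0(1) by blast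
      show "Poly_Mapping.lookup x0 A *\<^sub>R ?F A = Poly_Mapping.lookup x0 A *\<^sub>R poly_pair (u A) c"
        unfolding F[OF A fin(1)[OF A] subset_refl] u_def poly_pair_loop_poly ..
    qed
    finally show ?thesis by (simp add: poly_pair_combine)
  qed
  \<comment> \<open>A generator is a path, and one on a glued edge can be described from either
    polygon; \<open>z\<close> fixes one description.\<close>
  have "\<forall>e\<in>oriented_edges \<T>. \<exists>z. e = edge_path (fst z) (fst (snd z)) (snd (snd z)) \<and> fst (snd z) \<noteq> snd (snd z)"
    using oriented_edgesE[OF _ T] by (metis fst_conv snd_conv)
  then obtain z where z: "\<And>e. e \<in> oriented_edges \<T> \<Longrightarrow>
      e = edge_path (fst (z e)) (fst (snd (z e))) (snd (snd (z e))) \<and> fst (snd (z e)) \<noteq> snd (snd (z e))"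
    by metis
  define v where "v e = edge_poly (fst (z e)) (fst (snd (z e))) (snd (snd (z e)))" for e
  have hol_\<sigma>: "hol_relative h \<sigma> c = poly_pair (combine ?L (Poly_Mapping.lookup y0) v) c" if c: "1 \<le> c" for c
  proof -
    obtain H where "canonical_lift c (h c) H" using canonical_homeo_lift[OF c canonical[OF c]] by blast
    then interpret canonical_lift c "h c" H .
    let ?F = "\<lambda>e. holonomy c (h c \<circ> e)"
    have val: "lin_ext ?F y = lin_ext ?F y0" if y: "y \<in> \<sigma>" for y
    proof (rule lin_ext_coset[OF y0(3) _ y])
      fix r assume "r \<in> edge_relators \<T>"
      then show "lin_ext ?F r = 0"
        using T
      proof (rule lin_ext_edge_relators)
        show "?F (edge_path s i j) + ?F (edge_path s j k) + ?F (edge_path s k i) = 0" if "i < j" "j < k" for s i j k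
        proof -
          have "i \<noteq> j" "j \<noteq> k" "k \<noteq> i" using that by auto
          then show ?thesis by (simp add: holonomy_edge)
        qed
      qed (simp add: holonomy_edge)
    qed
    have "hol_relative h \<sigma> c = lin_ext ?F y0"
      unfolding hol_relative_def by (rule the_elem_eqI[OF imageI[OF y0_in]]) (use val in blast)
    also have "\<dots> = (\<Sum>e\<in>?L. Poly_Mapping.lookup y0 e *\<^sub>R poly_pair (v e) c)"
      unfolding lin_ext_def
    proof (intro sum.cong refl)
      fix e assume "e \<in> ?L"
      then have "e \<in> oriented_edges \<T>" using y0(1) by blast
      then have "?F e = poly_pair (v e) c"
        using z[of e] holonomy_edge by (metis poly_pair_edge_poly v_def)
      then show "Poly_Mapping.lookup y0 e *\<^sub>R ?F e = Poly_Mapping.lookup y0 e *\<^sub>R poly_pair (v e) c" by simp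
    qed
    finally show ?thesis by (simp add: poly_pair_combine)
  qed
  have "((\<lambda>t. poly (wedge (combine ?K (Poly_Mapping.lookup x0) u) (combine ?L (Poly_Mapping.lookup y0) v)) (cos t) * (1 - cos t))
      has_integral 2 * pi * V) {0..pi}"
    unfolding V_def
  proof (rule has_integral_wedge_combine)
    fix A e assume "A \<in> ?K" "e \<in> ?L"
    then have A: "A \<in> carrier \<C>" and e: "e \<in> oriented_edges \<T>" using x0(1) y0(1) by auto
    have "\<iota> e A = (\<Sum>n\<in>{min (fst (snd (z e))) (snd (snd (z e)))..<max (fst (snd (z e))) (snd (snd (z e)))}.
        edge_coeff (fst (z e)) (fst (snd (z e))) (snd (snd (z e))) n * ?ct A n)"
      using \<iota>[OF A] z[OF e] by metis
    then show "((\<lambda>t. poly (wedge (u A) (v e)) (cos t) * (1 - cos t)) has_integral 2 * pi * \<iota> e A) {0..pi}"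
      unfolding u_def v_def using z[OF e] fin(1)[OF A] fin(2)[OF A]
      by (simp only:) (intro has_integral_wedge_loop_edge, auto simp: class_support_def)
  qed simp_all
  then have "integral {0..pi} (\<lambda>t. poly (wedge (polynomial_form (hol_punctured h \<gamma>))
      (polynomial_form (hol_relative h \<sigma>))) (cos t) * (1 - cos t)) = 2 * pi * V"
    using polynomial_form_eqI[OF hol_\<gamma>] polynomial_form_eqI[OF hol_\<sigma>] by (simp add: integral_unique)
  then show ?thesis using intersection by simp
qed

end
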